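(* Let $x_0\in\mathbb{R}$ and let $X$ be the one-dimensional diffusion $X(t)=x_0+\int_0^t\mu(s,X(s))\,ds+W(t)$, where $W$ is a standard Brownian motion and the drift $\mu$ satisfies: for every fixed $x\in\mathbb{R}$, $\mu(\cdot,x)\in C^1([0,1])$; for every fixed $t\in[0,1]$, $\mu(t,\cdot)\in C^2(\mathbb{R})$; and for every $r>0$ there is $K_r<\infty$ such that $$|\mu(t,x)|+|\partial_t\mu(t,x)|+|\partial_x\mu(t,x)|+|\partial_{xx}\mu(t,x)|\le K_r,\qquad t\in[0,1],\ |x|\le r.$$ Let $g^-,g^+:[0,1]\to\mathbb{R}$ be continuous functions with $g^-(0)<x_0<g^+(0)$ and $\min_{0\le t\le 1}(g^+(t)-g^-(t))>0$. Let $V:\mathbb{R}\to\mathbb{C}$ and $\phi:\mathbb{R}\to\mathbb{R}$ be continuous functions. Set $$Q:=\mathbf{E}\Bigl(e^{-\int_0^1V(X(s))\,ds}\,\phi(X(1))\,;\ g^-(t)<X(t)<g^+(t)\ \text{for all } t\in[0,1]\Bigr),$$ and, for fixed $\delta\in(0,\tfrac12]$ and $\gamma>0$, let $Q_n$ be the matrix-product approximation $Q_n=S_{n,1}S_{n,2}\cdots S_{n,n}\phi_n$ defined in the context (for all sufficiently large $n$). Then $Q_n\to Q$ as $n\to\infty$.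
   Context: The notation $\mathbf{E}(\xi;A)$ means $\mathbf{E}(\xi\mathbf{1}_A)$. It is a standing assumption that the process $X$ satisfying the stated equation exists (as a non-exploding process) on $[0,1]$. Definition of $Q_n$. Fix $\delta\in(0,\tfrac12]$ and $\gamma>0$. For $n\ge1$ put $\Delta_n:=1/n$, $t_{n,k}:=k/n$ and $g^\pm_{n,k}:=g^\pm(t_{n,k})$, $k=0,1,\ldots,n$. Throughout, $n$ is taken large enough that the integer parts in the denominators below are positive and that the variances $\sigma^2_{n,k}(x)$ below are positive at all points $x$ where they are used. Space steps: for $1\le k<n$, $$w_{n,k}:=\frac{(g^+_{n,k}-g^-_{n,k})/\Delta_n^{1/2+\delta}}{\lfloor\gamma(g^+_{n,k}-g^-_{n,k})/\Delta_n^{1/2+\delta}\rfloor},\qquad h_{n,k}:=w_{n,k}\Delta_n^{1/2+\delta},$$ and for $k=n$, $$w_{n,n}:=\frac{(g^+(1)-g^-(1))/\Delta_n}{\lfloor\gamma(g^+(1)-g^-(1))/\Delta_n\rfloor},\qquad h_{n,n}:=w_{n,n}\Delta_n.$$ Grids: $E_{n,0}:=\{x_0\}$, $E_{n,k}:=\{g^+_{n,k}-jh_{n,k}:j\in\mathbb{Z}\}$ for $k=1,\ldots,n$; restricted grids: $E^G_{n,0}:=\{x_0\}$, $E^G_{n,k}:=\{x\in E_{n,k}:g^-_{n,k}<x<g^+_{n,k}\}$ for $k=1,\ldots,n$. Discrete drift and variance, $k=1,\ldots,n$: $$\mu_{n,k}(x):=\Bigl(\mu+\tfrac12\Delta_n\bigl(\partial_t\mu+\mu\,\partial_x\mu+\tfrac12\partial_{xx}\mu\bigr)\Bigr)(t_{n,k-1},x)\,\Delta_n,$$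 $$\sigma^2_{n,k}(x):=\bigl(1+\tfrac12\Delta_n\,\partial_x\mu(t_{n,k-1},x)\bigr)^2\Delta_n.$$ With $\varphi(y\,|\,m,\sigma^2):=(2\pi\sigma^2)^{-1/2}e^{-(y-m)^2/(2\sigma^2)}$, define $$p_{n,k}(x,y):=\varphi\bigl(y\,|\,x+\mu_{n,k}(x),\sigma^2_{n,k}(x)\bigr)\,h_{n,k},$$ $$\pi_{n,k}(x,y):=1-\exp\Bigl\{-\tfrac{2}{\Delta_n}(g^+_{n,k-1}-x)(g^+_{n,k}-y)\Bigr\}-\exp\Bigl\{-\tfrac{2}{\Delta_n}(g^-_{n,k-1}-x)(g^-_{n,k}-y)\Bigr\},$$ $$e_{n,k}(x,y):=\exp\Bigl\{-\tfrac{\Delta_n}{2}\bigl(V(x)+V(y)\bigr)\Bigr\}.$$ Matrices: $S_{n,k}:=\bigl[p_{n,k}(x,y)\,\pi_{n,k}(x,y)\,e_{n,k}(x,y)\bigr]_{(x,y)\in E^G_{n,k-1}\times E^G_{n,k}}$ (a finite matrix with complex entries, rows indexed by $E^G_{n,k-1}$ and columns by $E^G_{n,k}$), and $\phi_n:=[\phi(x)]_{x\in E^G_{n,n}}$ (a column vector). Then $Q_n:=S_{n,1}S_{n,2}\cdots S_{n,n}\phi_n$, a $1\times1$ matrix identified with a complex number. *)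

theory Defs
  imports "HOL-Probability.Probability"
begin

text \<open>Standard Brownian motion with time set \<open>I\<close>. For \<open>I = {0..1}\<close>, this is satisfied by
  (the restriction of) every standard Brownian motion on the half-line.\<close>

locale standard_brownian_motion_on = prob_space M for M :: "'a measure" +
  fixes I :: "real set" and W :: "real \<Rightarrow> 'a \<Rightarrow> real"
  assumes measurable_W: "\<And>t. t \<in> I \<Longrightarrow> W t \<in> borel_measurable M"
    and start_0: "AE \<omega> in M. W 0 \<omega> = 0"
    and normal_increments: "\<And>s t. s \<in> I \<Longrightarrow> t \<in> I \<Longrightarrow> s < t \<Longrightarrow>
      distributed M lborel (\<lambda>\<omega>. W t \<omega> - W s \<omega>) (normal_density 0 (sqrt (t - s)))"
    and indep_increments: "\<And>m (\<tau> :: nat \<Rightarrow> real). (\<forall>i\<le>m. \<tau> i \<in> I) \<Longrightarrow> (\<forall>i<m. \<tau> i < \<tau> (Suc i)) \<Longrightarrow>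
      indep_vars (\<lambda>_. borel) (\<lambda>i \<omega>. W (\<tau> (Suc i)) \<omega> - W (\<tau> i) \<omega>) {..<m}"
    and continuous_paths: "AE \<omega> in M. continuous_on I (\<lambda>t. W t \<omega>)"

text \<open>Derivatives in the time variable are one-sided at the endpoints of \<open>[0, 1]\<close>.\<close>

definition C1_on_unit_interval :: "(real \<Rightarrow> real) \<Rightarrow> bool" where
  "C1_on_unit_interval f \<longleftrightarrow>
    (\<exists>f'. (\<forall>t\<in>{0..1}. (f has_real_derivative f' t) (at t within {0..1})) \<and> continuous_on {0..1} f')"

definition C2_on_real :: "(real \<Rightarrow> real) \<Rightarrow> bool" where
  "C2_on_real f \<longleftrightarrow>
    (\<exists>f' f''. (\<forall>x. (f has_real_derivative f' x) (at x)) \<and>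
              (\<forall>x. (f' has_real_derivative f'' x) (at x)) \<and> continuous_on UNIV f'')"

definition partial_t :: "(real \<Rightarrow> real \<Rightarrow> real) \<Rightarrow> real \<Rightarrow> real \<Rightarrow> real" where
  "partial_t f t x = vector_derivative (\<lambda>s. f s x) (at t within {0..1})"

definition partial_x :: "(real \<Rightarrow> real \<Rightarrow> real) \<Rightarrow> real \<Rightarrow> real \<Rightarrow> real" where
  "partial_x f t x = deriv (f t) x"

definition partial_xx :: "(real \<Rightarrow> real \<Rightarrow> real) \<Rightarrow> real \<Rightarrow> real \<Rightarrow> real" where
  "partial_xx f t x = deriv (deriv (f t)) x"

text \<open>Matrices and column vectors whose rows and columns are indexed by finite sets of reals are
  functions; \<open>J\<close> is the common index set over which a product is formed.\<close>

definition matrix_mult_over ::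
    "real set \<Rightarrow> (real \<Rightarrow> real \<Rightarrow> complex) \<Rightarrow> (real \<Rightarrow> real \<Rightarrow> complex) \<Rightarrow> real \<Rightarrow> real \<Rightarrow> complex" where
  "matrix_mult_over J A B x z = (\<Sum>y\<in>J. A x y * B y z)"

definition matrix_vec_over ::
    "real set \<Rightarrow> (real \<Rightarrow> real \<Rightarrow> complex) \<Rightarrow> (real \<Rightarrow> complex) \<Rightarrow> real \<Rightarrow> complex" where
  "matrix_vec_over J A v x = (\<Sum>y\<in>J. A x y * v y)"

definition time_step :: "nat \<Rightarrow> real" where
  "time_step n = 1 / real n"

definition time_point :: "nat \<Rightarrow> nat \<Rightarrow> real" where
  "time_point n k = real k / real n"

text \<open>The definitions below are total in \<open>n\<close>. Their values are meaningful once \<open>n\<close> is so large that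
  the integer parts in \<open>mesh_ratio\<close> and the variances in use are positive; finitely many smaller
  \<open>n\<close> do not affect a limit.\<close>

context
  fixes x0 :: real and mu :: "real \<Rightarrow> real \<Rightarrow> real" and gminus gplus :: "real \<Rightarrow> real"
    and V :: "real \<Rightarrow> complex" and phi :: "real \<Rightarrow> real" and \<delta> \<gamma> :: real
begin

definition mesh_scale :: "nat \<Rightarrow> nat \<Rightarrow> real" where
  "mesh_scale n k = (if k = n then time_step n else time_step n powr (1/2 + \<delta>))"

definition mesh_ratio :: "nat \<Rightarrow> nat \<Rightarrow> real" where
  "mesh_ratio n k =
    (let width = gplus (time_point n k) - gminus (time_point n k)
     in (width / mesh_scale n k) / of_int \<lfloor>\<gamma> * width / mesh_scale n k\<rfloor>)"

definition mesh :: "nat \<Rightarrow> nat \<Rightarrow> real" where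
  "mesh n k = mesh_ratio n k * mesh_scale n k"

definition grid :: "nat \<Rightarrow> nat \<Rightarrow> real set" where
  "grid n k = (if k = 0 then {x0} else {gplus (time_point n k) - of_int j * mesh n k | j :: int. True})"

definition restricted_grid :: "nat \<Rightarrow> nat \<Rightarrow> real set" where
  "restricted_grid n k =
    (if k = 0 then {x0}
     else {x \<in> grid n k. gminus (time_point n k) < x \<and> x < gplus (time_point n k)})"

definition discrete_drift :: "nat \<Rightarrow> nat \<Rightarrow> real \<Rightarrow> real" where
  "discrete_drift n k x =
    (let t = time_point n (k - 1)
     in (mu t x + 1/2 * time_step n *
          (partial_t mu t x + mu t x * partial_x mu t x + 1/2 * partial_xx mu t x)) * time_step n)"

definition discrete_variance :: "nat \<Rightarrow> nat \<Rightarrow> real \<Rightarrow> real" where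
  "discrete_variance n k x =
    (1 + 1/2 * time_step n * partial_x mu (time_point n (k - 1)) x)\<^sup>2 * time_step n"

text \<open>The library's \<open>normal_density\<close> takes the standard deviation, not the variance.\<close>

definition transition_weight :: "nat \<Rightarrow> nat \<Rightarrow> real \<Rightarrow> real \<Rightarrow> real" where
  "transition_weight n k x y =
    normal_density (x + discrete_drift n k x) (sqrt (discrete_variance n k x)) y * mesh n k"

definition bridge_factor :: "nat \<Rightarrow> nat \<Rightarrow> real \<Rightarrow> real \<Rightarrow> real" where
  "bridge_factor n k x y =
    1 - exp (- (2 / time_step n) * (gplus (time_point n (k - 1)) - x) * (gplus (time_point n k) - y))
      - exp (- (2 / time_step n) * (gminus (time_point n (k - 1)) - x) * (gminus (time_point n k) - y))"

definition potential_factor :: "nat \<Rightarrow> real \<Rightarrow> real \<Rightarrow> complex" where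
  "potential_factor n x y = exp (- (complex_of_real (time_step n) / 2) * (V x + V y))"

definition step_matrix :: "nat \<Rightarrow> nat \<Rightarrow> real \<Rightarrow> real \<Rightarrow> complex" where
  "step_matrix n k x y =
    complex_of_real (transition_weight n k x y) * complex_of_real (bridge_factor n k x y) *
    potential_factor n x y"

text \<open>\<open>step_product n k\<close> is the product of the first \<open>k\<close> step matrices, with rows indexed by
  \<open>restricted_grid n 0\<close> and columns by \<open>restricted_grid n k\<close>; the empty product is the identity.\<close>

primrec step_product :: "nat \<Rightarrow> nat \<Rightarrow> real \<Rightarrow> real \<Rightarrow> complex" where
  "step_product n 0 = (\<lambda>x y. if x = y then 1 else 0)"
| "step_product n (Suc k) =
    matrix_mult_over (restricted_grid n k) (step_product n k) (step_matrix n (Suc k))"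

definition matrix_approximation :: "nat \<Rightarrow> complex" where
  "matrix_approximation n =
    matrix_vec_over (restricted_grid n n) (step_product n n) (\<lambda>x. complex_of_real (phi x)) x0"

end

definition corridor_functional ::
    "'a measure \<Rightarrow> (real \<Rightarrow> 'a \<Rightarrow> real) \<Rightarrow> (real \<Rightarrow> real) \<Rightarrow> (real \<Rightarrow> real) \<Rightarrow>
     (real \<Rightarrow> complex) \<Rightarrow> (real \<Rightarrow> real) \<Rightarrow> complex" where
  "corridor_functional M X gminus gplus V phi =
    (LINT \<omega>:{\<omega> \<in> space M. \<forall>t\<in>{0..1}. gminus t < X t \<omega> \<and> X t \<omega> < gplus t}|M.
       exp (- (LINT s:{0..1}|lborel. V (X s \<omega>))) * complex_of_real (phi (X 1 \<omega>)))"

end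

(*
The path of the approximating chain can be realised on the probability space of X.  The lattice
weights h * phi(y | m, sigma^2) have total mass and mean exponentially close to those of the normal
law, because sigma / h is of order n^delta; hence a quantile transform of the increment of W over
[t_(k-1), t_k] produces the k-th transition up to a relative error eta_n with n * eta_n -> 0, and its
rounding error is bounded by 2h with negligible conditional mean.  The accumulated rounding errors are
almost surely o(1) by an exponential moment bound and Borel-Cantelli, so a Gronwall argument makes the
chain follow X uniformly up to its exit from the corridor.

Q_n is the expectation of the product of the step factors along this chain.  If X stays strictly
inside the corridor, all bridge factors together tend to 1 and the potential factors form a Riemann
sum; if X leaves the closed corridor, so does the chain.  The remaining event, that X touches the
boundary without crossing it, is null: an Euler scheme whose first step is [0, a] is strictly monotone
in the Gaussian variable W(a), so that X touches the boundary after time a with probability O(sqrt a).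
Dominated convergence concludes.
*)

theory Submission
  imports Defs "HOL-Real_Asymp.Real_Asymp"
begin

section \<open>Gaussian sums over a lattice\<close>

text \<open>Rounding by up to 2h in each of n steps could add up to n h, of order n^(1/2 - delta),
  which does not tend to zero. Only cancellation brings it down to h sqrt n, of order n^(-delta);
  hence the insistence on a tiny conditional mean, and on partial sums of the rounding errors in the
  Gronwall argument. A variance bound would give probabilities that decay like a small power of n,
  in general not summable; exponential moments make Borel-Cantelli work for every delta > 0. Q_n
  multiplies n unnormalised kernels, so the chain has to match them in relative error, even far out
  in the Gaussian tails. The coupling therefore reproduces every lattice weight exactly except the
  central one. That weight is at least of order h / sigma, so the exponentially small defect of the
  total mass stays exponentially small relative to it. The boundaries are merely continuous and the
  drift is controlled only locally. Hence no density of a hitting time or of a maximum is used, and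
  constants are tied either to the corridor or to the path under study.\<close>

text \<open>The shift costs y^2 <= 2 x^2 + 2 \<sigma>^2, hence a factor exp(1/4) <= 3/2, and
  doubling the standard deviation costs 2 in the normalisation; together 3. The exponent on the left
  is only half the Gaussian one, so the other half can absorb polynomial factors. A Gaussian
  majorant at a nearby point can again be summed over a lattice.\<close>

lemma normal_density_le_double:
  assumes s: "0 < \<sigma>" and xy: "\<bar>x - y\<bar> \<le> \<sigma>"
  shows "exp (- x\<^sup>2 / (4 * \<sigma>\<^sup>2)) / sqrt (2 * pi * \<sigma>\<^sup>2) \<le> 3 * normal_density 0 (2 * \<sigma>) y"
proof -
  have "y\<^sup>2 \<le> 2 * x\<^sup>2 + 2 * (x - y)\<^sup>2"
    using zero_le_power2[of "2 * x - y"] by (simp add: power2_eq_square algebra_simps)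
  moreover have "(x - y)\<^sup>2 \<le> \<sigma>\<^sup>2" using xy s by (metis abs_le_square_iff abs_of_pos)
  ultimately have "y\<^sup>2 \<le> 2 * x\<^sup>2 + 2 * \<sigma>\<^sup>2" by linarith
  then have e: "- x\<^sup>2 / (4 * \<sigma>\<^sup>2) \<le> 1/4 + - y\<^sup>2 / (8 * \<sigma>\<^sup>2)"
    using s by (simp add: field_simps)
  have q: "exp (1/4::real) \<le> 3/2"
  proof -
    have "exp (1/4::real) \<le> 1 + 1/4 + (1/4)\<^sup>2" by (rule exp_bound) auto
    then show ?thesis by (simp add: power2_eq_square)
  qed
  have "exp (- x\<^sup>2 / (4 * \<sigma>\<^sup>2)) \<le> exp (1/4) * exp (- y\<^sup>2 / (8 * \<sigma>\<^sup>2))"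
    using e by (simp flip: exp_add)
  also have "\<dots> \<le> 3/2 * exp (- y\<^sup>2 / (8 * \<sigma>\<^sup>2))" using q by (intro mult_right_mono) auto
  finally have "exp (- x\<^sup>2 / (4 * \<sigma>\<^sup>2)) / sqrt (2 * pi * \<sigma>\<^sup>2)
      \<le> 3/2 * exp (- y\<^sup>2 / (8 * \<sigma>\<^sup>2)) / sqrt (2 * pi * \<sigma>\<^sup>2)"
    using s by (intro divide_right_mono) auto
  also have "sqrt (2 * pi * (2 * \<sigma>)\<^sup>2) = 2 * sqrt (2 * pi * \<sigma>\<^sup>2)"
  proof -
    have "2 * pi * (2 * \<sigma>)\<^sup>2 = 4 * (2 * pi * \<sigma>\<^sup>2)" by (simp add: power2_eq_square)
    then show ?thesis by (simp only: real_sqrt_mult[of 4]) simp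
  qed
  then have "3/2 * exp (- y\<^sup>2 / (8 * \<sigma>\<^sup>2)) / sqrt (2 * pi * \<sigma>\<^sup>2) = 3 * normal_density 0 (2 * \<sigma>) y"
    by (simp add: normal_density_def)
  finally show ?thesis .
qed

lemma normal_density_le_double':
  assumes s: "0 < \<sigma>" and xy: "\<bar>x - y\<bar> \<le> \<sigma>"
  shows "normal_density 0 \<sigma> x \<le> 3 * normal_density 0 (2 * \<sigma>) y"
proof -
  have "- x\<^sup>2 / (2 * \<sigma>\<^sup>2) \<le> - x\<^sup>2 / (4 * \<sigma>\<^sup>2)" using s by (simp add: field_simps)
  then have "normal_density 0 \<sigma> x \<le> exp (- x\<^sup>2 / (4 * \<sigma>\<^sup>2)) / sqrt (2 * pi * \<sigma>\<^sup>2)"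
    using s by (auto simp: normal_density_def intro!: divide_right_mono)
  then show ?thesis using normal_density_le_double[OF assms] by linarith
qed

text \<open>Half of the Gaussian exponent pays for the linear factor: t <= 1 + t^2/4 <= exp(t^2/4)
  with t = |z|/\<sigma>.\<close>

lemma normal_density_times_abs_le:
  assumes s: "0 < \<sigma>" and z: "\<bar>z - y\<bar> \<le> \<sigma>"
  shows "\<bar>z\<bar> / \<sigma> * normal_density 0 \<sigma> z \<le> 3 * normal_density 0 (2 * \<sigma>) y"
proof -
  let ?t = "\<bar>z\<bar> / \<sigma>"
  have "?t \<le> 1 + (?t)\<^sup>2 / 4" using zero_le_power2[of "?t / 2 - 1"] by (simp add: power2_eq_square algebra_simps)
  also have "\<dots> \<le> exp ((?t)\<^sup>2 / 4)" by (rule exp_ge_add_one_self)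
  finally have t: "?t \<le> exp (z\<^sup>2 / (4 * \<sigma>\<^sup>2))" by (simp add: power_divide mult.commute)
  then have "?t * normal_density 0 \<sigma> z \<le> exp (z\<^sup>2 / (4 * \<sigma>\<^sup>2)) * normal_density 0 \<sigma> z"
    by (intro mult_right_mono) auto
  also have "exp (z\<^sup>2 / (4 * \<sigma>\<^sup>2)) * normal_density 0 \<sigma> z = exp (- z\<^sup>2 / (4 * \<sigma>\<^sup>2)) / sqrt (2 * pi * \<sigma>\<^sup>2)"
  proof -
    have "z\<^sup>2 / (4 * \<sigma>\<^sup>2) + - z\<^sup>2 / (2 * \<sigma>\<^sup>2) = - z\<^sup>2 / (4 * \<sigma>\<^sup>2)" using s by (simp add: field_simps)
    then have "exp (z\<^sup>2 / (4 * \<sigma>\<^sup>2)) * exp (- z\<^sup>2 / (2 * \<sigma>\<^sup>2)) = exp (- z\<^sup>2 / (4 * \<sigma>\<^sup>2))"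
      by (simp only: flip: exp_add)
    then show ?thesis by (simp add: normal_density_def)
  qed
  also have "\<dots> \<le> 3 * normal_density 0 (2 * \<sigma>) y" by (rule normal_density_le_double[OF s z])
  finally show ?thesis .
qed

text \<open>Mean value bound on the ball of radius \<open>\<sigma>\<close> about \<open>y\<close>:
  there the derivative, of modulus |z|/\<sigma>^2 times the density, is dominated by one multiple of
  the wider Gaussian at \<open>y\<close>.\<close>

lemma normal_density_lipschitz:
  assumes s: "0 < \<sigma>" and xy: "\<bar>x - y\<bar> \<le> \<sigma>"
  shows "\<bar>normal_density 0 \<sigma> x - normal_density 0 \<sigma> y\<bar> \<le> 3 * (\<bar>x - y\<bar> / \<sigma>) * normal_density 0 (2 * \<sigma>) y"
proof -
  define B where "B = 3 * normal_density 0 (2 * \<sigma>) y / \<sigma>"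
  have d: "(normal_density 0 \<sigma> has_real_derivative (- z / \<sigma>\<^sup>2) * normal_density 0 \<sigma> z) (at z within S)" for z S
  proof -
    define c where "c = 1 / sqrt (2 * pi * \<sigma>\<^sup>2)"
    have *: "normal_density 0 \<sigma> = (\<lambda>z. c * exp (- z\<^sup>2 / (2 * \<sigma>\<^sup>2)))"
      by (simp add: normal_density_def c_def fun_eq_iff)
    show ?thesis unfolding * using s
      by (auto intro!: derivative_eq_intros simp: power2_eq_square field_simps)
  qed
  have b: "\<bar>(- z / \<sigma>\<^sup>2) * normal_density 0 \<sigma> z\<bar> \<le> B" if z: "\<bar>z - y\<bar> \<le> \<sigma>" for z
  proof -
    have "\<bar>(- z / \<sigma>\<^sup>2) * normal_density 0 \<sigma> z\<bar> = \<bar>z\<bar> / \<sigma> * normal_density 0 \<sigma> z / \<sigma>"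
      using s by (simp add: abs_mult power2_eq_square)
    also have "\<dots> \<le> B"
      using normal_density_times_abs_le[OF s z] s unfolding B_def by (intro divide_right_mono) auto
    finally show ?thesis .
  qed
  have "\<bar>normal_density 0 \<sigma> x - normal_density 0 \<sigma> y\<bar> \<le> B * \<bar>x - y\<bar>"
  proof -
    have c: "convex (cball y \<sigma>)" by simp
    have "norm (normal_density 0 \<sigma> x - normal_density 0 \<sigma> y) \<le> B * norm (x - y)"
    proof (rule field_differentiable_bound[OF c, of _ "\<lambda>z. (- z / \<sigma>\<^sup>2) * normal_density 0 \<sigma> z"])
      show "x \<in> cball y \<sigma>" "y \<in> cball y \<sigma>" using xy s by (auto simp: dist_real_def)
      show "norm (- z / \<sigma>\<^sup>2 * normal_density 0 \<sigma> z) \<le> B" if "z \<in> cball y \<sigma>" for z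
        using b[of z] that by (simp add: dist_real_def abs_minus_commute)
    qed (rule d)
    then show ?thesis by simp
  qed
  then show ?thesis by (simp add: B_def field_simps)
qed

section \<open>Periodisation and the Gaussian mass of a shifted lattice\<close>

lemma nn_integral_count_int_reindex:
  fixes f :: "int \<Rightarrow> ennreal"
  shows "(\<integral>\<^sup>+j. f (j + m) \<partial>count_space UNIV) = (\<integral>\<^sup>+j. f j \<partial>count_space UNIV)"
    and "(\<integral>\<^sup>+j. f (m - j) \<partial>count_space UNIV) = (\<integral>\<^sup>+j. f j \<partial>count_space UNIV)"
proof -
  have "bij_betw (\<lambda>j::int. j + m) UNIV UNIV" "bij_betw (\<lambda>j::int. m - j) UNIV UNIV"
    by (rule bij_betw_byWitness[where f' = "\<lambda>j. j - m"], auto)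
       (rule bij_betw_byWitness[where f' = "\<lambda>j. m - j"], auto)
  from this[THEN nn_integral_bij_count_space, of f]
  show "(\<integral>\<^sup>+j. f (j + m) \<partial>count_space UNIV) = (\<integral>\<^sup>+j. f j \<partial>count_space UNIV)"
    "(\<integral>\<^sup>+j. f (m - j) \<partial>count_space UNIV) = (\<integral>\<^sup>+j. f j \<partial>count_space UNIV)" by auto
qed

lemma nn_integral_count_lborel_swap:
  fixes f :: "int \<Rightarrow> real \<Rightarrow> ennreal"
  assumes "\<And>j. f j \<in> borel_measurable borel"
  shows "(\<integral>\<^sup>+u. (\<integral>\<^sup>+j. f j u \<partial>count_space UNIV) \<partial>lborel) = (\<integral>\<^sup>+j. (\<integral>\<^sup>+u. f j u \<partial>lborel) \<partial>count_space UNIV)"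
proof -
  interpret c: sigma_finite_measure "count_space (UNIV::int set)"
    by (rule sigma_finite_measure_count_space)
  interpret pair_sigma_finite "count_space (UNIV::int set)" lborel ..
  show ?thesis
    by (rule Fubini[where f = "\<lambda>(j, u). f j u", simplified])
       (rule measurable_pair_measure_countable1, use assms in auto)
qed

text \<open>Unfolding: every u lies in exactly one cell [jh, jh + h), and translation carries each
  cell to [0, h).\<close>

lemma nn_integral_periodize:
  fixes g :: "real \<Rightarrow> ennreal"
  assumes [measurable]: "g \<in> borel_measurable borel" and h: "0 < h"
  shows "(\<integral>\<^sup>+u. g u \<partial>lborel) =
    (\<integral>\<^sup>+u\<in>{0..<h}. (\<integral>\<^sup>+j. g (u + of_int j * h) \<partial>count_space UNIV) \<partial>lborel)"
proof -
  have one: "(\<integral>\<^sup>+j. indicator {of_int j * h..<of_int j * h + h} u \<partial>count_space UNIV) = (1::ennreal)" for u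
  proof -
    have "indicator {of_int j * h..<of_int j * h + h} u = (indicator {\<lfloor>u / h\<rfloor>} j :: ennreal)" for j
    proof -
      have "(u \<in> {of_int j * h..<of_int j * h + h}) = (j = \<lfloor>u / h\<rfloor>)"
        using h by (auto simp: eq_commute[of j] floor_eq_iff pos_le_divide_eq pos_divide_less_eq algebra_simps)
      then show ?thesis by (simp add: indicator_def)
    qed
    then show ?thesis by simp
  qed
  have "(\<integral>\<^sup>+u. g u \<partial>lborel) = (\<integral>\<^sup>+u. (\<integral>\<^sup>+j. g u * indicator {of_int j * h..<of_int j * h + h} u \<partial>count_space UNIV) \<partial>lborel)"
    by (simp add: nn_integral_cmult one)
  also have "\<dots> = (\<integral>\<^sup>+j. (\<integral>\<^sup>+u. g u * indicator {of_int j * h..<of_int j * h + h} u \<partial>lborel) \<partial>count_space UNIV)"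
    by (rule nn_integral_count_lborel_swap) measurable
  also have "\<dots> = (\<integral>\<^sup>+j. (\<integral>\<^sup>+u. g (u + of_int j * h) * indicator {0..<h} u \<partial>lborel) \<partial>count_space UNIV)"
  proof (rule nn_integral_cong)
    fix j :: int
    have "(\<integral>\<^sup>+u. g u * indicator {of_int j * h..<of_int j * h + h} u \<partial>lborel)
      = ennreal \<bar>1\<bar> * (\<integral>\<^sup>+u. g (of_int j * h + 1 * u) * indicator {of_int j * h..<of_int j * h + h} (of_int j * h + 1 * u) \<partial>lborel)"
      by (rule nn_integral_real_affine) auto
    also have "\<dots> = (\<integral>\<^sup>+u. g (u + of_int j * h) * indicator {0..<h} u \<partial>lborel)"
      by (auto intro!: nn_integral_cong simp: indicator_def add_ac)
    finally show "(\<integral>\<^sup>+u. g u * indicator {of_int j * h..<of_int j * h + h} u \<partial>lborel) = (\<integral>\<^sup>+u. g (u + of_int j * h) * indicator {0..<h} u \<partial>lborel)" .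
  qed
  also have "\<dots> = (\<integral>\<^sup>+u. (\<integral>\<^sup>+j. g (u + of_int j * h) * indicator {0..<h} u \<partial>count_space UNIV) \<partial>lborel)"
    by (rule nn_integral_count_lborel_swap[symmetric]) measurable
  finally show ?thesis by (simp add: nn_integral_multc)
qed

text \<open>Riemann sum of the Gaussian density over the lattice a + hZ, a theta function in
  \<open>a\<close>; it is the total of the unnormalised transition weights of one step. Values in
  \<open>ennreal\<close> let sums and integrals be exchanged without integrability side
  conditions.\<close>

definition lattice_nn_mass :: "real \<Rightarrow> real \<Rightarrow> real \<Rightarrow> ennreal" where
  "lattice_nn_mass \<sigma> h a = (\<integral>\<^sup>+j. ennreal (h * normal_density 0 \<sigma> (a + of_int j * h)) \<partial>count_space UNIV)"

lemma lattice_nn_mass_measurable[measurable]: "lattice_nn_mass \<sigma> h \<in> borel_measurable borel"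
proof -
  interpret c: sigma_finite_measure "count_space (UNIV::int set)"
    by (rule sigma_finite_measure_count_space)
  have "(\<lambda>(u, j). ennreal (h * normal_density 0 \<sigma> (u + of_int j * h))) \<in> borel_measurable (borel \<Otimes>\<^sub>M count_space (UNIV::int set))"
    by (subst measurable_pair_swap_iff, rule measurable_pair_measure_countable1) auto
  from c.borel_measurable_nn_integral_fst[OF this] show ?thesis by (simp add: lattice_nn_mass_def[abs_def])
qed

lemma lattice_nn_mass_periodic: "lattice_nn_mass \<sigma> h (a + of_int m * h) = lattice_nn_mass \<sigma> h a"
  using nn_integral_count_int_reindex(1)[of "\<lambda>j. ennreal (h * normal_density 0 \<sigma> (a + of_int j * h))" m]
  by (simp add: lattice_nn_mass_def algebra_simps)

lemma lattice_nn_mass_periodic': "lattice_nn_mass \<sigma> h (a - of_int m * h) = lattice_nn_mass \<sigma> h a"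
  using lattice_nn_mass_periodic[of \<sigma> h a "- m"] by simp

lemma nn_integral_normal_density: "0 < \<sigma> \<Longrightarrow> (\<integral>\<^sup>+u. ennreal (normal_density m \<sigma> u) \<partial>lborel) = 1"
  by (simp add: nn_integral_eq_integral)

text \<open>Unfolding turns the integral over one period into the total Gaussian mass, so the
  average over a period is 1. The reflected version in \<open>a - u\<close> is the one that occurs
  in convolutions and in averaging around a given point.\<close>

lemma lattice_nn_mass_mean:
  assumes s: "0 < \<sigma>" and h: "0 < h"
  shows "(\<integral>\<^sup>+u\<in>{0..<h}. lattice_nn_mass \<sigma> h (a - u) \<partial>lborel) = h"
    and "(\<integral>\<^sup>+u\<in>{0..<h}. lattice_nn_mass \<sigma> h u \<partial>lborel) = h"
proof -
  have "ennreal h = (\<integral>\<^sup>+u. ennreal (h * normal_density 0 \<sigma> u) \<partial>lborel)"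
    using h s by (simp add: ennreal_mult' nn_integral_cmult nn_integral_normal_density)
  also have "\<dots> = (\<integral>\<^sup>+u\<in>{0..<h}. lattice_nn_mass \<sigma> h u \<partial>lborel)"
    unfolding lattice_nn_mass_def by (rule nn_integral_periodize) (use h in auto)
  finally show "(\<integral>\<^sup>+u\<in>{0..<h}. lattice_nn_mass \<sigma> h u \<partial>lborel) = h" ..
  have "ennreal h = (\<integral>\<^sup>+u. ennreal (h * normal_density a \<sigma> u) \<partial>lborel)"
    using h s by (simp add: ennreal_mult' nn_integral_cmult nn_integral_normal_density)
  also have "\<dots> = (\<integral>\<^sup>+u. ennreal (h * normal_density 0 \<sigma> (a - u)) \<partial>lborel)"
    by (simp add: normal_density_def power2_commute)
  also have "\<dots> = (\<integral>\<^sup>+u\<in>{0..<h}. (\<integral>\<^sup>+j. ennreal (h * normal_density 0 \<sigma> (a - (u + of_int j * h))) \<partial>count_space UNIV) \<partial>lborel)"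
    by (rule nn_integral_periodize) (use h in auto)
  also have "\<dots> = (\<integral>\<^sup>+u\<in>{0..<h}. lattice_nn_mass \<sigma> h (a - u) \<partial>lborel)"
    unfolding lattice_nn_mass_def
    by (subst nn_integral_count_int_reindex(2)[where m = 0, symmetric]) (simp add: algebra_simps)
  finally show "(\<integral>\<^sup>+u\<in>{0..<h}. lattice_nn_mass \<sigma> h (a - u) \<partial>lborel) = h" ..
qed

text \<open>The Gaussian convolution identity, summed over the lattice and unfolded in the
  integration variable: the \<open>\<sigma>\<close>-mass is periodic and leaves the inner sum, which
  collapses to the \<open>\<tau>\<close>-mass.\<close>

lemma lattice_nn_mass_conv:
  assumes s: "0 < \<sigma>" "0 < \<tau>" and h: "0 < h"
  shows "h * lattice_nn_mass (sqrt (\<sigma>\<^sup>2 + \<tau>\<^sup>2)) h a = (\<integral>\<^sup>+u\<in>{0..<h}. lattice_nn_mass \<tau> h u * lattice_nn_mass \<sigma> h (a - u) \<partial>lborel)"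
proof -
  have c: "ennreal (h * normal_density 0 (sqrt (\<sigma>\<^sup>2 + \<tau>\<^sup>2)) x) = (\<integral>\<^sup>+u. ennreal (h * normal_density 0 \<sigma> (x - u)) * ennreal (normal_density 0 \<tau> u) \<partial>lborel)" for x
  proof -
    have "ennreal (h * normal_density 0 (sqrt (\<sigma>\<^sup>2 + \<tau>\<^sup>2)) x) = ennreal h * (\<integral>\<^sup>+u. ennreal (normal_density 0 \<sigma> (x - u) * normal_density 0 \<tau> u) \<partial>lborel)"
      using fun_cong[OF conv_normal_density_zero_mean[OF s], of x] h by (simp add: ennreal_mult')
    also have "\<dots> = (\<integral>\<^sup>+u. ennreal h * ennreal (normal_density 0 \<sigma> (x - u) * normal_density 0 \<tau> u) \<partial>lborel)"
      by (simp add: nn_integral_cmult)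
    finally show ?thesis using h by (simp add: ennreal_mult mult.assoc)
  qed
  have "lattice_nn_mass (sqrt (\<sigma>\<^sup>2 + \<tau>\<^sup>2)) h a = (\<integral>\<^sup>+j. (\<integral>\<^sup>+u. ennreal (h * normal_density 0 \<sigma> (a + of_int j * h - u)) * ennreal (normal_density 0 \<tau> u) \<partial>lborel) \<partial>count_space UNIV)"
    unfolding lattice_nn_mass_def c ..
  also have "\<dots> = (\<integral>\<^sup>+u. (\<integral>\<^sup>+j. ennreal (h * normal_density 0 \<sigma> (a + of_int j * h - u)) * ennreal (normal_density 0 \<tau> u) \<partial>count_space UNIV) \<partial>lborel)"
    by (rule nn_integral_count_lborel_swap[symmetric]) measurable
  also have "\<dots> = (\<integral>\<^sup>+u. lattice_nn_mass \<sigma> h (a - u) * ennreal (normal_density 0 \<tau> u) \<partial>lborel)"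
    by (simp add: nn_integral_cmult lattice_nn_mass_def algebra_simps)
  finally have "ennreal h * lattice_nn_mass (sqrt (\<sigma>\<^sup>2 + \<tau>\<^sup>2)) h a = (\<integral>\<^sup>+u. ennreal h * (lattice_nn_mass \<sigma> h (a - u) * ennreal (normal_density 0 \<tau> u)) \<partial>lborel)"
    by (simp add: nn_integral_cmult)
  also have "\<dots> = (\<integral>\<^sup>+u. lattice_nn_mass \<sigma> h (a - u) * ennreal (h * normal_density 0 \<tau> u) \<partial>lborel)"
    using h by (simp add: ennreal_mult' mult_ac)
  also have "\<dots> = (\<integral>\<^sup>+u\<in>{0..<h}. (\<integral>\<^sup>+j. lattice_nn_mass \<sigma> h (a - (u + of_int j * h)) * ennreal (h * normal_density 0 \<tau> (u + of_int j * h)) \<partial>count_space UNIV) \<partial>lborel)"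
    by (rule nn_integral_periodize) (use h in auto)
  also have "\<dots> = (\<integral>\<^sup>+u\<in>{0..<h}. lattice_nn_mass \<tau> h u * lattice_nn_mass \<sigma> h (a - u) \<partial>lborel)"
  proof (intro nn_integral_cong arg_cong2[where f = "(*)"] refl)
    fix u
    have "lattice_nn_mass \<sigma> h (a - (u + of_int j * h)) = lattice_nn_mass \<sigma> h (a - u)" for j
      using lattice_nn_mass_periodic'[of \<sigma> h "a - u" j] by (simp add: diff_diff_eq)
    then show "(\<integral>\<^sup>+j. lattice_nn_mass \<sigma> h (a - (u + of_int j * h)) * ennreal (h * normal_density 0 \<tau> (u + of_int j * h)) \<partial>count_space UNIV) = lattice_nn_mass \<tau> h u * lattice_nn_mass \<sigma> h (a - u)"
      unfolding lattice_nn_mass_def[of \<tau> h u] by (simp add: nn_integral_cmult) (simp add: mult.commute)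
  qed
  finally show ?thesis .
qed

lemma nn_integral_Ico_const: "0 < h \<Longrightarrow> (\<integral>\<^sup>+u\<in>{0..<h}. c \<partial>lborel) = ennreal h * c" for h :: real
  by (simp add: nn_integral_cmult_indicator mult.commute)

lemma lattice_nn_mass_le_double:
  assumes h: "0 < h" and hs: "h \<le> \<sigma>" and ab: "\<bar>a - b\<bar> \<le> h"
  shows "lattice_nn_mass \<sigma> h a \<le> 3 * lattice_nn_mass (2 * \<sigma>) h b"
proof -
  have "lattice_nn_mass \<sigma> h a \<le> (\<integral>\<^sup>+j. 3 * ennreal (h * normal_density 0 (2 * \<sigma>) (b + of_int j * h)) \<partial>count_space UNIV)"
    unfolding lattice_nn_mass_def
  proof (rule nn_integral_mono)
    fix j :: int
    have "normal_density 0 \<sigma> (a + of_int j * h) \<le> 3 * normal_density 0 (2 * \<sigma>) (b + of_int j * h)"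
      by (rule normal_density_le_double') (use assms in auto)
    then have "ennreal (h * normal_density 0 \<sigma> (a + of_int j * h)) \<le> ennreal (3 * (h * normal_density 0 (2 * \<sigma>) (b + of_int j * h)))"
      using h by (intro ennreal_leI) (simp add: mult_left_mono)
    then show "ennreal (h * normal_density 0 \<sigma> (a + of_int j * h)) \<le> 3 * ennreal (h * normal_density 0 (2 * \<sigma>) (b + of_int j * h))"
      using h by (simp add: ennreal_mult')
  qed
  then show ?thesis by (simp add: lattice_nn_mass_def nn_integral_cmult)
qed

text \<open>The mass at \<open>a\<close> is at most 3 times the mass of the doubled Gaussian at
  every point within h, and the latter averages to 1 over a period.\<close>

lemma lattice_nn_mass_le_3:
  assumes h: "0 < h" and hs: "h \<le> \<sigma>"
  shows "lattice_nn_mass \<sigma> h a \<le> 3"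
proof -
  have "ennreal h * lattice_nn_mass \<sigma> h a = (\<integral>\<^sup>+u\<in>{0..<h}. lattice_nn_mass \<sigma> h a \<partial>lborel)"
    by (rule nn_integral_Ico_const[OF h, symmetric])
  also have "\<dots> \<le> (\<integral>\<^sup>+u. 3 * (lattice_nn_mass (2 * \<sigma>) h (a - u) * indicator {0..<h} u) \<partial>lborel)"
    by (intro nn_integral_mono) (use lattice_nn_mass_le_double[OF h hs] in \<open>auto simp: indicator_def\<close>)
  also have "\<dots> = ennreal h * 3"
    using lattice_nn_mass_mean(1)[of "2 * \<sigma>" h a] h hs by (simp add: nn_integral_cmult mult.commute)
  finally show ?thesis using h by (simp add: ennreal_mult_le_mult_iff)
qed

text \<open>The Lipschitz estimate summed over the lattice costs 3 h/\<sigma> times the mass of the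
  doubled Gaussian, itself at most 3; hence the constant 9.\<close>

lemma lattice_nn_mass_diff:
  assumes h: "0 < h" and hs: "h \<le> \<sigma>" and ab: "\<bar>a - b\<bar> \<le> h"
  shows "lattice_nn_mass \<sigma> h a \<le> lattice_nn_mass \<sigma> h b + ennreal (9 * h / \<sigma>)"
proof -
  have "lattice_nn_mass \<sigma> h a \<le> (\<integral>\<^sup>+j. ennreal (h * normal_density 0 \<sigma> (b + of_int j * h)) + ennreal (3 * h / \<sigma>) * ennreal (h * normal_density 0 (2 * \<sigma>) (b + of_int j * h)) \<partial>count_space UNIV)"
    unfolding lattice_nn_mass_def
  proof (rule nn_integral_mono)
    fix j :: int
    let ?x = "a + of_int j * h" and ?y = "b + of_int j * h"
    have "\<bar>normal_density 0 \<sigma> ?x - normal_density 0 \<sigma> ?y\<bar> \<le> 3 * (\<bar>?x - ?y\<bar> / \<sigma>) * normal_density 0 (2 * \<sigma>) ?y"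
      by (rule normal_density_lipschitz) (use assms in auto)
    also have "\<dots> \<le> 3 * (h / \<sigma>) * normal_density 0 (2 * \<sigma>) ?y"
      using assms by (intro mult_right_mono mult_left_mono divide_right_mono) auto
    finally have "normal_density 0 \<sigma> ?x \<le> normal_density 0 \<sigma> ?y + 3 * (h / \<sigma>) * normal_density 0 (2 * \<sigma>) ?y"
      by linarith
    then have "h * normal_density 0 \<sigma> ?x \<le> h * (normal_density 0 \<sigma> ?y + 3 * (h / \<sigma>) * normal_density 0 (2 * \<sigma>) ?y)"
      using h by (intro mult_left_mono) auto
    also have "\<dots> = h * normal_density 0 \<sigma> ?y + (3 * h / \<sigma>) * (h * normal_density 0 (2 * \<sigma>) ?y)"
      by (simp add: algebra_simps)
    finally show "ennreal (h * normal_density 0 \<sigma> ?x) \<le> ennreal (h * normal_density 0 \<sigma> ?y) + ennreal (3 * h / \<sigma>) * ennreal (h * normal_density 0 (2 * \<sigma>) ?y)"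
    proof -
      assume le: "h * normal_density 0 \<sigma> ?x \<le> h * normal_density 0 \<sigma> ?y + (3 * h / \<sigma>) * (h * normal_density 0 (2 * \<sigma>) ?y)"
      have "ennreal (h * normal_density 0 \<sigma> ?y) + ennreal (3 * h / \<sigma>) * ennreal (h * normal_density 0 (2 * \<sigma>) ?y)
        = ennreal (h * normal_density 0 \<sigma> ?y + (3 * h / \<sigma>) * (h * normal_density 0 (2 * \<sigma>) ?y))"
        using h hs by (simp only: ennreal_plus ennreal_mult mult_nonneg_nonneg divide_nonneg_nonneg normal_density_nonneg)
      then show ?thesis using le by (simp only: ennreal_leI)
    qed
  qed
  also have "\<dots> = lattice_nn_mass \<sigma> h b + ennreal (3 * h / \<sigma>) * lattice_nn_mass (2 * \<sigma>) h b"
    by (simp add: nn_integral_add nn_integral_cmult lattice_nn_mass_def)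
  also have "\<dots> \<le> lattice_nn_mass \<sigma> h b + ennreal (3 * h / \<sigma>) * ennreal 3"
    using lattice_nn_mass_le_3[of h "2 * \<sigma>" b] h hs by (intro add_left_mono mult_left_mono) auto
  also have "ennreal (3 * h / \<sigma>) * ennreal 3 = ennreal (9 * h / \<sigma>)"
    using h hs by (subst ennreal_mult[symmetric]) auto
  finally show ?thesis .
qed

text \<open>Since the mean over a period is 1, a bound on the oscillation within a period bounds the
  distance to 1.\<close>

lemma lattice_nn_mass_bounds:
  assumes h: "0 < h" and hs: "h \<le> \<sigma>"
  shows "lattice_nn_mass \<sigma> h a \<le> 1 + ennreal (9 * h / \<sigma>)" "1 \<le> lattice_nn_mass \<sigma> h a + ennreal (9 * h / \<sigma>)"
proof -
  have s: "0 < \<sigma>" using h hs by simp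
  have "ennreal h * lattice_nn_mass \<sigma> h a = (\<integral>\<^sup>+u\<in>{0..<h}. lattice_nn_mass \<sigma> h a \<partial>lborel)"
    by (rule nn_integral_Ico_const[OF h, symmetric])
  also have "\<dots> \<le> (\<integral>\<^sup>+u. (lattice_nn_mass \<sigma> h (a - u) * indicator {0..<h} u + ennreal (9 * h / \<sigma>) * indicator {0..<h} u) \<partial>lborel)"
    by (intro nn_integral_mono) (use lattice_nn_mass_diff[OF h hs] in \<open>auto simp: indicator_def\<close>)
  also have "\<dots> = ennreal h * (1 + ennreal (9 * h / \<sigma>))"
    using lattice_nn_mass_mean(1)[OF s h, of a] h
    by (subst nn_integral_add) (simp_all only: nn_integral_Ico_const distrib_left mult_1_right, auto)
  finally show "lattice_nn_mass \<sigma> h a \<le> 1 + ennreal (9 * h / \<sigma>)" using h by (simp add: ennreal_mult_le_mult_iff)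
  have "ennreal h * 1 = (\<integral>\<^sup>+u\<in>{0..<h}. lattice_nn_mass \<sigma> h (a - u) \<partial>lborel)"
    using lattice_nn_mass_mean(1)[OF s h, of a] by simp
  also have "\<dots> \<le> (\<integral>\<^sup>+u\<in>{0..<h}. (lattice_nn_mass \<sigma> h a + ennreal (9 * h / \<sigma>)) \<partial>lborel)"
    by (intro nn_integral_mono) (use lattice_nn_mass_diff[OF h hs] in \<open>auto simp: indicator_def\<close>)
  also have "\<dots> = ennreal h * (lattice_nn_mass \<sigma> h a + ennreal (9 * h / \<sigma>))"
    by (rule nn_integral_Ico_const[OF h])
  finally show "1 \<le> lattice_nn_mass \<sigma> h a + ennreal (9 * h / \<sigma>)" 
    using h ennreal_mult_le_mult_iff[of "ennreal h" 1 "lattice_nn_mass \<sigma> h a + ennreal (9 * h / \<sigma>)"] by auto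
qed

section \<open>Exponentially small deviation of the lattice mass and of its first moment\<close>

definition lattice_mass :: "real \<Rightarrow> real \<Rightarrow> real \<Rightarrow> real" where
  "lattice_mass \<sigma> h a = enn2real (lattice_nn_mass \<sigma> h a)"

lemma lattice_nn_mass_eq:
  assumes "0 < h" "h \<le> \<sigma>" shows "lattice_nn_mass \<sigma> h a = ennreal (lattice_mass \<sigma> h a)"
proof -
  have "lattice_nn_mass \<sigma> h a < top" using lattice_nn_mass_le_3[OF assms] by (rule order.strict_trans1) simp
  then show ?thesis by (simp add: lattice_mass_def)
qed

lemma lattice_mass_nonneg: "0 \<le> lattice_mass \<sigma> h a" by (simp add: lattice_mass_def)

lemma lattice_mass_measurable[measurable]: "lattice_mass \<sigma> h \<in> borel_measurable borel"
  unfolding lattice_mass_def[abs_def] by measurable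

text \<open>Uniform in the offset, since the mean of a transition may lie anywhere relative to the
  grid; uniformity is also what makes the convolution estimate iterate.\<close>

definition lattice_dev :: "real \<Rightarrow> real \<Rightarrow> real \<Rightarrow> bool" where
  "lattice_dev \<sigma> h d \<longleftrightarrow> (\<forall>a. \<bar>lattice_mass \<sigma> h a - 1\<bar> \<le> d)"

text \<open>A first-order bound in h/\<sigma>, far from exponentially small; it only serves as the
  starting point for iterated convolution.\<close>

lemma lattice_dev_basic:
  assumes "0 < h" "h \<le> \<sigma>" shows "lattice_dev \<sigma> h (9 * h / \<sigma>)"
  unfolding lattice_dev_def
proof
  fix a
  have nn: "0 \<le> 9 * h / \<sigma>" using assms by simp
  have "ennreal (lattice_mass \<sigma> h a) \<le> ennreal (1 + 9 * h / \<sigma>)"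
    using lattice_nn_mass_bounds(1)[OF assms, of a] nn by (simp add: lattice_nn_mass_eq[OF assms])
  then have 1: "lattice_mass \<sigma> h a \<le> 1 + 9 * h / \<sigma>" using nn by (subst (asm) ennreal_le_iff) auto
  have "ennreal 1 \<le> ennreal (lattice_mass \<sigma> h a + 9 * h / \<sigma>)"
    using lattice_nn_mass_bounds(2)[OF assms, of a] nn lattice_mass_nonneg[of \<sigma> h a] by (simp add: lattice_nn_mass_eq[OF assms])
  then have 2: "1 \<le> lattice_mass \<sigma> h a + 9 * h / \<sigma>"
    using nn lattice_mass_nonneg[of \<sigma> h a] by (subst (asm) ennreal_le_iff) auto
  from 1 2 show "\<bar>lattice_mass \<sigma> h a - 1\<bar> \<le> 9 * h / \<sigma>" by linarith
qed

text \<open>The lattice mass of a convolution of two Gaussians is the circular convolution of their lattice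
  masses, both of which have mean one; so deviations from one multiply, and iterating this bound makes
  the deviation exponentially small.\<close>

lemma lattice_dev_conv:
  assumes h: "0 < h" and s: "h \<le> \<sigma>" "h \<le> \<tau>" and d: "lattice_dev \<sigma> h d" "lattice_dev \<tau> h e"
  shows "lattice_dev (sqrt (\<sigma>\<^sup>2 + \<tau>\<^sup>2)) h (d * e)"
  unfolding lattice_dev_def
proof
  fix a
  let ?S = "\<lambda>u. lattice_mass \<sigma> h (a - u)" and ?T = "lattice_mass \<tau> h"
  let ?I = "indicator {0..<h} :: real \<Rightarrow> real"
  have hst: "h \<le> sqrt (\<sigma>\<^sup>2 + \<tau>\<^sup>2)"
    using h s by (intro order.trans[OF s(1)] real_le_rsqrt) auto
  have bd: "\<bar>?S u\<bar> \<le> 1 + d" "\<bar>?T u\<bar> \<le> 1 + e" "\<bar>?S u - 1\<bar> \<le> d" "\<bar>?T u - 1\<bar> \<le> e" for u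
    using d[unfolded lattice_dev_def, THEN spec, of "a - u"] d[unfolded lattice_dev_def, THEN spec, of u]
      d(2)[unfolded lattice_dev_def, THEN spec, of u] by linarith+
  have d0: "0 \<le> d" "0 \<le> e" using bd(3,4)[of 0] by linarith+
  have intI: "integrable lborel (\<lambda>u. f u * ?I u)" if "f \<in> borel_measurable borel" "\<And>u. \<bar>f u\<bar> \<le> B" for f B
  proof (rule Bochner_Integration.integrable_bound[where f = "\<lambda>u. B * ?I u"])
    show "AE u in lborel. norm (f u * ?I u) \<le> norm (B * ?I u)"
      using order.trans[OF that(2) abs_ge_self] by (intro AE_I2) (auto simp: indicator_def)
  qed (use that h in \<open>auto simp: less_top[symmetric]\<close>)
  have ST: "integrable lborel (\<lambda>u. ?T u * ?S u * ?I u)"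
    by (rule intI[where B = "(1 + e) * (1 + d)"]) (use bd(1,2) d0 in \<open>auto simp: abs_mult intro!: mult_mono\<close>)
  have S: "integrable lborel (\<lambda>u. ?S u * ?I u)" by (rule intI[OF _ bd(1)]) measurable
  have T: "integrable lborel (\<lambda>u. ?T u * ?I u)" by (rule intI[OF _ bd(2)]) measurable
  have I: "integrable lborel ?I" using intI[of "\<lambda>_. 1" 1] by simp
  have toR: "(LINT u|lborel. f u * ?I u) = c"
    if "(\<integral>\<^sup>+u\<in>{0..<h}. ennreal (f u) \<partial>lborel) = ennreal c" "0 \<le> c" "\<And>u. 0 \<le> f u" "f \<in> borel_measurable borel" for f c
  proof -
    have "(\<integral>\<^sup>+u. ennreal (f u * ?I u) \<partial>lborel) = ennreal c"
      using that(1) by (simp add: ennreal_mult' that(3) ennreal_indicator[symmetric] mult.commute del: ennreal_indicator)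
    then show ?thesis
      using that by (subst integral_eq_nn_integral) auto
  qed
  have S1: "(LINT u|lborel. ?S u * ?I u) = h"
    by (rule toR) (use lattice_nn_mass_mean(1)[of \<sigma> h a] h s in \<open>auto simp: lattice_nn_mass_eq lattice_mass_nonneg\<close>)
  have T1: "(LINT u|lborel. ?T u * ?I u) = h"
    by (rule toR) (use lattice_nn_mass_mean(2)[of \<tau> h] h s in \<open>auto simp: lattice_nn_mass_eq lattice_mass_nonneg\<close>)
  have ST1: "(LINT u|lborel. ?T u * ?S u * ?I u) = h * lattice_mass (sqrt (\<sigma>\<^sup>2 + \<tau>\<^sup>2)) h a"
    by (rule toR) (use lattice_nn_mass_conv[of \<sigma> \<tau> h a] h s hst in \<open>auto simp: lattice_nn_mass_eq lattice_mass_nonneg ennreal_mult''\<close>)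
  have "h * (lattice_mass (sqrt (\<sigma>\<^sup>2 + \<tau>\<^sup>2)) h a - 1) = (LINT u|lborel. (?T u * ?S u * ?I u - ?S u * ?I u) - (?T u * ?I u - ?I u))"
  proof -
    have "(LINT u|lborel. ?I u) = h" using h by simp
    then show ?thesis
      unfolding Bochner_Integration.integral_diff[OF Bochner_Integration.integrable_diff[OF ST S] Bochner_Integration.integrable_diff[OF T I]]
        Bochner_Integration.integral_diff[OF ST S] Bochner_Integration.integral_diff[OF T I] S1 T1 ST1
      by (simp add: right_diff_distrib)
  qed
  also have "\<dots> = (LINT u|lborel. (?T u - 1) * (?S u - 1) * ?I u)"
    by (rule Bochner_Integration.integral_cong) (auto simp: algebra_simps)
  finally have eq: "h * (lattice_mass (sqrt (\<sigma>\<^sup>2 + \<tau>\<^sup>2)) h a - 1) = (LINT u|lborel. (?T u - 1) * (?S u - 1) * ?I u)" .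
  have "\<bar>LINT u|lborel. (?T u - 1) * (?S u - 1) * ?I u\<bar> \<le> (LINT u|lborel. \<bar>(?T u - 1) * (?S u - 1) * ?I u\<bar>)"
    by (rule integral_abs_bound)
  also have "\<dots> \<le> (LINT u|lborel. (d * e) * ?I u)"
  proof (rule integral_mono)
    show "integrable lborel (\<lambda>u. \<bar>(?T u - 1) * (?S u - 1) * ?I u\<bar>)"
      by (intro integrable_abs intI[where B = "e * d"]) (use bd(3,4) d0 in \<open>auto simp: abs_mult intro!: mult_mono\<close>)
    show "\<bar>(?T u - 1) * (?S u - 1) * ?I u\<bar> \<le> (d * e) * ?I u" for u
      using mult_mono[OF bd(3)[of u] bd(4)[of u]] d0 by (auto simp: abs_mult indicator_def mult.commute)
  qed (use I in auto)
  also have "\<dots> = h * (d * e)" using h by simp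
  finally have "h * \<bar>lattice_mass (sqrt (\<sigma>\<^sup>2 + \<tau>\<^sup>2)) h a - 1\<bar> \<le> h * (d * e)"
    using h by (simp add: eq[symmetric] abs_mult)
  then show "\<bar>lattice_mass (sqrt (\<sigma>\<^sup>2 + \<tau>\<^sup>2)) h a - 1\<bar> \<le> d * e" using h by simp
qed

lemma lattice_dev_power:
  assumes h: "0 < h" and s: "h \<le> \<sigma>" and d: "lattice_dev \<sigma> h d"
  shows "lattice_dev (sqrt (real (Suc n)) * \<sigma>) h (d ^ Suc n)"
proof (induction n)
  case 0 show ?case using d by simp
next
  case (Suc n)
  have "1 * \<sigma> \<le> sqrt (real (Suc n)) * \<sigma>" using h s by (intro mult_right_mono) auto
  then have "h \<le> sqrt (real (Suc n)) * \<sigma>" using s by simp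
  from lattice_dev_conv[OF h this s Suc d]
  have "lattice_dev (sqrt ((sqrt (real (Suc n)) * \<sigma>)\<^sup>2 + \<sigma>\<^sup>2)) h (d ^ Suc n * d)" .
  moreover have "sqrt ((sqrt (real (Suc n)) * \<sigma>)\<^sup>2 + \<sigma>\<^sup>2) = sqrt (real (Suc (Suc n))) * \<sigma>"
  proof -
    have "(sqrt (real (Suc n)) * \<sigma>)\<^sup>2 + \<sigma>\<^sup>2 = real (Suc (Suc n)) * \<sigma>\<^sup>2"
      by (simp add: power_mult_distrib algebra_simps)
    then show ?thesis using h s by (simp add: real_sqrt_mult)
  qed
  ultimately show ?case by (simp add: mult.commute)
qed

text \<open>Write the Gaussian as a sum of N = floor((\<sigma>/(18h))^2) independent ones. Each
  still has standard deviation at least 18h, hence deviation at most 9/18 = 1/2, and the N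
  deviations multiply to 2^(-N). With ln 2 >= 1/2 and 648 = 2 * 18^2 this is the stated exponent;
  the factor 2 pays for the integer part. The argument takes the place of Poisson summation.\<close>

lemma lattice_dev_exp:
  assumes h: "0 < h" and s: "18 * h \<le> \<sigma>"
  shows "lattice_dev \<sigma> h (2 * exp (- (\<sigma> / h)\<^sup>2 / 648))"
proof -
  define q where "q = (\<sigma> / (18 * h))\<^sup>2"
  have "1 \<le> \<sigma> / (18 * h)" using h s by simp
  then have q1: "1 \<le> q" unfolding q_def by (simp add: one_le_power)
  define N where "N = nat \<lfloor>q\<rfloor>"
  have N: "1 \<le> N" "real N \<le> q" "q < real N + 1" using q1 unfolding N_def by (auto simp: le_nat_iff le_floor_iff)
  then obtain n where n: "N = Suc n" by (cases N) auto
  define \<sigma>0 where "\<sigma>0 = \<sigma> / sqrt (real N)"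
  have s0: "18 * h \<le> \<sigma>0"
  proof -
    have "sqrt (real N) \<le> \<sigma> / (18 * h)" using N h s by (intro real_le_lsqrt) (auto simp: q_def)
    then show ?thesis using h N by (simp add: \<sigma>0_def field_simps)
  qed
  have "lattice_dev \<sigma>0 h (9 * h / \<sigma>0)" by (rule lattice_dev_basic) (use h s0 in auto)
  then have "lattice_dev \<sigma>0 h (1/2)"
  proof -
    have "9 * h / \<sigma>0 \<le> 1/2" using h s0 by (simp add: field_simps)
    then show ?thesis using \<open>lattice_dev \<sigma>0 h (9 * h / \<sigma>0)\<close> unfolding lattice_dev_def by (meson order.trans)
  qed
  from lattice_dev_power[OF h _ this, of n] s0 h
  have dev: "lattice_dev \<sigma> h ((1/2) ^ N)" using N by (simp add: n[symmetric] \<sigma>0_def del: power_Suc)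
  have "(1/2) ^ N = exp (- ln 2 * real N)"
    by (simp add: exp_minus power_one_over exp_of_nat_mult[symmetric] mult.commute[of "ln 2"] exp_of_nat_mult inverse_eq_divide)
  also have "\<dots> \<le> exp (- ln 2 * (q - 1))" using N by simp
  also have "\<dots> = 2 * exp (- ln 2 * q)" by (simp add: right_diff_distrib exp_diff exp_minus field_simps)
  also have "\<dots> \<le> 2 * exp (- (1/2) * q)"
  proof -
    have "1/2 \<le> ln (2::real)"
      using ln_add_one_self_le_self2[of "-1/2::real"] ln_inverse[of 2] by (simp add: inverse_eq_divide)
    then show ?thesis using q1 by (simp add: mult_right_mono)
  qed
  also have "- (1/2) * q = - (\<sigma> / h)\<^sup>2 / 648" by (simp add: q_def power_divide power_mult_distrib)
  finally have "(1/2) ^ N \<le> 2 * exp (- (\<sigma> / h)\<^sup>2 / 648)" .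
  then show ?thesis using dev unfolding lattice_dev_def by (meson order.trans)
qed

lemma lattice_weights_integrable:
  assumes h: "0 < h" and s: "h \<le> \<sigma>"
  shows "integrable (count_space UNIV) (\<lambda>j::int. h * normal_density 0 \<sigma> (a + of_int j * h))"
    and "(LINT j|count_space UNIV. h * normal_density 0 \<sigma> (a + of_int j * h)) = lattice_mass \<sigma> h a"
    and "integrable (count_space UNIV) (\<lambda>j::int. (a + of_int j * h) * (h * normal_density 0 \<sigma> (a + of_int j * h)))"
proof -
  have i: "integrable (count_space UNIV) (\<lambda>j::int. h * normal_density 0 \<tau> (a + of_int j * h))" if "h \<le> \<tau>" for \<tau>
    using lattice_nn_mass_eq[OF h that, of a] h
    by (intro integrableI_nn_integral_finite[where x = "lattice_mass \<tau> h a"]) (auto simp: lattice_nn_mass_def lattice_mass_nonneg)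
  show "integrable (count_space UNIV) (\<lambda>j::int. h * normal_density 0 \<sigma> (a + of_int j * h))" by (rule i[OF s])
  show "(LINT j|count_space UNIV. h * normal_density 0 \<sigma> (a + of_int j * h)) = lattice_mass \<sigma> h a"
    using h by (subst integral_eq_nn_integral) (auto simp: lattice_mass_def lattice_nn_mass_def)
  show "integrable (count_space UNIV) (\<lambda>j::int. (a + of_int j * h) * (h * normal_density 0 \<sigma> (a + of_int j * h)))"
  proof (rule Bochner_Integration.integrable_bound)
    show "integrable (count_space UNIV) (\<lambda>j::int. (3 * \<sigma>) * (h * normal_density 0 (2 * \<sigma>) (a + of_int j * h)))"
      using i[of "2 * \<sigma>"] h s by (intro integrable_mult_right) auto
    show "AE j in count_space UNIV. norm ((a + of_int j * h) * (h * normal_density 0 \<sigma> (a + of_int j * h)))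
      \<le> norm ((3 * \<sigma>) * (h * normal_density 0 (2 * \<sigma>) (a + of_int j * h)))"
    proof (rule AE_I2)
      fix j :: int
      let ?x = "a + of_int j * h"
      have "\<bar>?x\<bar> / \<sigma> * normal_density 0 \<sigma> ?x \<le> 3 * normal_density 0 (2 * \<sigma>) ?x"
        using h s by (intro normal_density_times_abs_le) auto
      then have "\<bar>?x\<bar> * normal_density 0 \<sigma> ?x \<le> 3 * \<sigma> * normal_density 0 (2 * \<sigma>) ?x"
        using h s by (simp add: field_simps)
      then have "h * (\<bar>?x\<bar> * normal_density 0 \<sigma> ?x) \<le> h * (3 * \<sigma> * normal_density 0 (2 * \<sigma>) ?x)"
        using h by (intro mult_left_mono) auto
      then show "norm (?x * (h * normal_density 0 \<sigma> ?x)) \<le> norm ((3 * \<sigma>) * (h * normal_density 0 (2 * \<sigma>) ?x))"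
        using h s by (simp add: abs_mult mult_ac)
    qed
  qed simp
qed

text \<open>The first moment is bounded by comparing the lattice sums of shifted Gaussians through
  \<open>u \<le> e\<^sup>u - 1\<close>.\<close>

lemma lattice_first_moment:
  assumes h: "0 < h" and s: "h \<le> \<sigma>" and d: "lattice_dev \<sigma> h d" "0 < d" "d \<le> 1"
  shows "\<bar>LINT j|count_space (UNIV::int set). (a + of_int j * h) * (h * normal_density 0 \<sigma> (a + of_int j * h))\<bar> \<le> 4 * \<sigma> * sqrt d"
proof -
  define M where "M = (LINT j|count_space (UNIV::int set). (a + of_int j * h) * (h * normal_density 0 \<sigma> (a + of_int j * h)))"
  have sp: "0 < \<sigma>" using h s by simp
  note I = lattice_weights_integrable[OF h s]
  have key: "t / \<sigma> * sqrt d * M \<le> 4 * d" if t: "t\<^sup>2 = 1" for t :: real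
  proof -
    \<comment> \<open>The shift is chosen so that its second-order cost e^2/(2\<sigma>^2) = d/2 is
      of the order of the mass deviation \<open>d\<close>; dividing 4d by |e|/\<sigma>^2 then leaves
      4 \<sigma> sqrt d. The signs t = 1 and t = -1 give the two one-sided bounds.\<close>
    define e where "e = t * \<sigma> * sqrt d"
    have e2: "e\<^sup>2 / (2 * \<sigma>\<^sup>2) = d / 2" using t d sp by (simp add: e_def power_mult_distrib)
    have pt: "(e / \<sigma>\<^sup>2) * (x * (h * normal_density 0 \<sigma> x)) \<le> exp (d / 2) * (h * normal_density 0 \<sigma> (x - e)) - h * normal_density 0 \<sigma> x" for x
    proof -
      have "x * e / \<sigma>\<^sup>2 \<le> exp (x * e / \<sigma>\<^sup>2) - 1"
        using exp_ge_add_one_self[of "x * e / \<sigma>\<^sup>2"] by linarith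
      then have "(x * e / \<sigma>\<^sup>2) * (h * normal_density 0 \<sigma> x) \<le> (exp (x * e / \<sigma>\<^sup>2) - 1) * (h * normal_density 0 \<sigma> x)"
        using h by (intro mult_right_mono) auto
      moreover have "exp (x * e / \<sigma>\<^sup>2) * normal_density 0 \<sigma> x = exp (d / 2) * normal_density 0 \<sigma> (x - e)"
      proof -
        have "x * e / \<sigma>\<^sup>2 + - x\<^sup>2 / (2 * \<sigma>\<^sup>2) = e\<^sup>2 / (2 * \<sigma>\<^sup>2) + - (x - e)\<^sup>2 / (2 * \<sigma>\<^sup>2)"
          using sp by (simp add: field_simps power2_eq_square)
        then have "exp (x * e / \<sigma>\<^sup>2) * exp (- x\<^sup>2 / (2 * \<sigma>\<^sup>2)) = exp (d / 2) * exp (- (x - e)\<^sup>2 / (2 * \<sigma>\<^sup>2))"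
          unfolding e2 by (simp only: flip: exp_add)
        then show ?thesis by (simp add: normal_density_def)
      qed
      ultimately show ?thesis by (simp add: algebra_simps)
    qed
    have "(e / \<sigma>\<^sup>2) * M = (LINT j|count_space (UNIV::int set). (e / \<sigma>\<^sup>2) * ((a + of_int j * h) * (h * normal_density 0 \<sigma> (a + of_int j * h))))"
      by (simp add: M_def)
    also have "\<dots> \<le> (LINT j|count_space (UNIV::int set). exp (d / 2) * (h * normal_density 0 \<sigma> (a - e + of_int j * h)) - h * normal_density 0 \<sigma> (a + of_int j * h))"
    proof (rule integral_mono)
      show "(e / \<sigma>\<^sup>2) * ((a + of_int j * h) * (h * normal_density 0 \<sigma> (a + of_int j * h))) \<le> exp (d / 2) * (h * normal_density 0 \<sigma> (a - e + of_int j * h)) - h * normal_density 0 \<sigma> (a + of_int j * h)" for j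
        using pt[of "a + of_int j * h"] by (simp add: algebra_simps)
    qed (use I in \<open>auto intro!: Bochner_Integration.integrable_diff integrable_mult_right\<close>)
    also have "\<dots> = exp (d / 2) * lattice_mass \<sigma> h (a - e) - lattice_mass \<sigma> h a"
      by (subst Bochner_Integration.integral_diff) (use I in \<open>auto intro!: integrable_mult_right\<close>)
    also have "\<dots> \<le> (1 + d) * (1 + d) - (1 - d)"
    proof -
      have "exp (d / 2) \<le> 1 + d / 2 + (d / 2)\<^sup>2" using d by (intro exp_bound) auto
      also have "\<dots> \<le> 1 + d"
      proof -
        have "d * d \<le> d * 1" using d by (intro mult_left_mono) auto
        moreover have "(d / 2)\<^sup>2 = d * d / 4" by (simp add: power2_eq_square)
        ultimately show ?thesis using d by linarith
      qed
      finally have "exp (d / 2) \<le> 1 + d" .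
      moreover have "\<bar>lattice_mass \<sigma> h (a - e) - 1\<bar> \<le> d" "\<bar>lattice_mass \<sigma> h a - 1\<bar> \<le> d"
        using d(1) by (auto simp: lattice_dev_def)
      ultimately have "exp (d / 2) * lattice_mass \<sigma> h (a - e) \<le> (1 + d) * (1 + d)"
        using d by (intro mult_mono lattice_mass_nonneg) auto
      then show ?thesis using \<open>\<bar>lattice_mass \<sigma> h a - 1\<bar> \<le> d\<close> by linarith
    qed
    also have "\<dots> = 3 * d + d * d" by (simp add: algebra_simps)
    also have "\<dots> \<le> 3 * d + d * 1" using d by (intro add_left_mono mult_left_mono) auto
    finally have "(e / \<sigma>\<^sup>2) * M \<le> 4 * d" by simp
    moreover have "e / \<sigma>\<^sup>2 = t / \<sigma> * sqrt d" using sp by (simp add: e_def power2_eq_square)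
    ultimately show ?thesis by simp
  qed
  have "\<bar>M\<bar> * (sqrt d / \<sigma>) \<le> 4 * d"
  proof (cases "0 \<le> M")
    case True then show ?thesis using key[of 1] by (simp add: mult_ac)
  next
    case False then show ?thesis using key[of "-1"] by (simp add: mult_ac)
  qed
  also have "4 * d = (4 * \<sigma> * sqrt d) * (sqrt d / \<sigma>)" using d sp by simp
  finally have "\<bar>M\<bar> * (sqrt d / \<sigma>) \<le> (4 * \<sigma> * sqrt d) * (sqrt d / \<sigma>)" .
  then have "\<bar>M\<bar> \<le> 4 * \<sigma> * sqrt d" by (rule mult_right_le_imp_le) (use d sp in simp)
  then show ?thesis by (simp only: M_def)
qed

section \<open>Comparison of Gaussian tails with lattice tails\<close>

text \<open>A lattice sum is the integral of a step function on the cells (a + (j-1)h, a + jh]. The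
  first form evaluates \<open>f\<close> at the right end of the cell of u, the second at the left
  end; the end farther from the origin gives a minorant of the density, the nearer one a
  majorant.\<close>

lemma nn_integral_lattice_ceiling:
  fixes f :: "int \<Rightarrow> ennreal"
  assumes h: "0 < h"
  shows "(\<integral>\<^sup>+u. f \<lceil>(u - a) / h\<rceil> \<partial>lborel) = (\<integral>\<^sup>+j. ennreal h * f j \<partial>count_space UNIV)"
    and "(\<integral>\<^sup>+u. f (\<lceil>(u - a) / h\<rceil> - 1) \<partial>lborel) = (\<integral>\<^sup>+j. ennreal h * f j \<partial>count_space UNIV)"
proof -
  have *: "(\<integral>\<^sup>+u. g \<lceil>(u - a) / h\<rceil> \<partial>lborel) = (\<integral>\<^sup>+j. ennreal h * g j \<partial>count_space UNIV)" for g :: "int \<Rightarrow> ennreal"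
  proof -
    have i: "indicator {a + of_int j * h - h<..a + of_int j * h} u = (indicator {\<lceil>(u - a) / h\<rceil>} j :: ennreal)" for j u
    proof -
      have "(u \<in> {a + of_int j * h - h<..a + of_int j * h}) = (j = \<lceil>(u - a) / h\<rceil>)"
      proof -
        have "(j = \<lceil>(u - a) / h\<rceil>) \<longleftrightarrow> of_int j - 1 < (u - a) / h \<and> (u - a) / h \<le> of_int j"
          by (auto simp: eq_commute[of j] ceiling_eq_iff)
        also have "\<dots> \<longleftrightarrow> (of_int j - 1) * h < u - a \<and> u - a \<le> of_int j * h"
          by (simp only: pos_less_divide_eq[OF h] pos_divide_le_eq[OF h])
        also have "\<dots> \<longleftrightarrow> u \<in> {a + of_int j * h - h<..a + of_int j * h}" by (auto simp: algebra_simps)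
        finally show ?thesis ..
      qed
      then show ?thesis by (simp add: indicator_def)
    qed
    have "(\<integral>\<^sup>+u. g \<lceil>(u - a) / h\<rceil> \<partial>lborel) = (\<integral>\<^sup>+u. (\<integral>\<^sup>+j. g j * indicator {a + of_int j * h - h<..a + of_int j * h} u \<partial>count_space UNIV) \<partial>lborel)"
      by (simp add: i)
    also have "\<dots> = (\<integral>\<^sup>+j. (\<integral>\<^sup>+u. g j * indicator {a + of_int j * h - h<..a + of_int j * h} u \<partial>lborel) \<partial>count_space UNIV)"
      by (rule nn_integral_count_lborel_swap) measurable
    finally show ?thesis using h by (simp add: nn_integral_cmult_indicator mult.commute)
  qed
  from *[of f] show "(\<integral>\<^sup>+u. f \<lceil>(u - a) / h\<rceil> \<partial>lborel) = (\<integral>\<^sup>+j. ennreal h * f j \<partial>count_space UNIV)" .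
  from *[of "\<lambda>j. f (j - 1)"] nn_integral_count_int_reindex(1)[of "\<lambda>j. ennreal h * f j" "-1"]
  show "(\<integral>\<^sup>+u. f (\<lceil>(u - a) / h\<rceil> - 1) \<partial>lborel) = (\<integral>\<^sup>+j. ennreal h * f j \<partial>count_space UNIV)" by simp
qed

definition normal_measure :: "real \<Rightarrow> real measure" where
  "normal_measure \<sigma> = density lborel (\<lambda>x. ennreal (normal_density 0 \<sigma> x))"

lemma sets_normal_measure[simp, measurable_cong]: "sets (normal_measure \<sigma>) = sets borel"
  and space_normal_measure[simp]: "space (normal_measure \<sigma>) = UNIV"
  by (simp_all add: normal_measure_def)

lemma prob_space_normal_measure: "0 < \<sigma> \<Longrightarrow> prob_space (normal_measure \<sigma>)"
  unfolding normal_measure_def by (rule prob_space_normal_density)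

text \<open>Deliberately unnormalised, like the weights of the scheme: its total mass is
  \<open>lattice_mass\<close>, close to but in general not equal to 1.\<close>

definition lattice_measure :: "real \<Rightarrow> real \<Rightarrow> real \<Rightarrow> int measure" where
  "lattice_measure \<sigma> h a = density (count_space UNIV) (\<lambda>j. ennreal (h * normal_density 0 \<sigma> (a + of_int j * h)))"

lemma normal_density_antimono: "\<bar>y\<bar> \<le> \<bar>x\<bar> \<Longrightarrow> 0 < \<sigma> \<Longrightarrow> normal_density 0 \<sigma> x \<le> normal_density 0 \<sigma> y"
  by (auto simp: normal_density_def divide_right_mono abs_le_square_iff)

context
  fixes \<sigma> h a :: real
  assumes h: "0 < h" and s: "h \<le> \<sigma>"
begin

interpretation N: prob_space "normal_measure \<sigma>"
  using h s by (intro prob_space_normal_measure) auto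

lemma emeasure_lattice: "emeasure (lattice_measure \<sigma> h a) A
  = (\<integral>\<^sup>+j. ennreal h * (ennreal (normal_density 0 \<sigma> (a + of_int j * h)) * indicator A j) \<partial>count_space UNIV)"
  using h by (simp add: lattice_measure_def emeasure_density ennreal_mult' mult.assoc)

lemma finite_lattice_measure: "finite_measure (lattice_measure \<sigma> h a)"
proof
  have "emeasure (lattice_measure \<sigma> h a) UNIV = lattice_nn_mass \<sigma> h a"
    by (simp add: lattice_measure_def emeasure_density lattice_nn_mass_def)
  then show "emeasure (lattice_measure \<sigma> h a) (space (lattice_measure \<sigma> h a)) \<noteq> \<infinity>"
    using lattice_nn_mass_eq[OF h s, of a] by (simp add: lattice_measure_def)
qed

interpretation P: finite_measure "lattice_measure \<sigma> h a" by (rule finite_lattice_measure)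

lemma measure_lattice_UNIV: "measure (lattice_measure \<sigma> h a) UNIV = lattice_mass \<sigma> h a"
  by (simp add: lattice_measure_def measure_def emeasure_density lattice_nn_mass_def lattice_mass_def)

lemma measure_lattice_singleton: "measure (lattice_measure \<sigma> h a) {j} = h * normal_density 0 \<sigma> (a + of_int j * h)"
  using h by (simp add: lattice_measure_def measure_def emeasure_density)

lemma emeasure_normal_measure: "A \<in> sets borel \<Longrightarrow> emeasure (normal_measure \<sigma>) A = (\<integral>\<^sup>+u. ennreal (normal_density 0 \<sigma> u) * indicator A u \<partial>lborel)"
  by (simp add: normal_measure_def emeasure_density)

lemma ceiling_lattice: "a + of_int \<lceil>(u - a) / h\<rceil> * h - h < u" "u \<le> a + of_int \<lceil>(u - a) / h\<rceil> * h"
proof -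
  have "of_int \<lceil>(u - a) / h\<rceil> - 1 < (u - a) / h" "(u - a) / h \<le> of_int \<lceil>(u - a) / h\<rceil>"
    using ceiling_correct[of "(u - a) / h"] by auto
  then have "(of_int \<lceil>(u - a) / h\<rceil> - 1) * h < u - a" "u - a \<le> of_int \<lceil>(u - a) / h\<rceil> * h"
    by (simp_all only: pos_less_divide_eq[OF h] pos_divide_le_eq[OF h])
  then show "a + of_int \<lceil>(u - a) / h\<rceil> * h - h < u" "u \<le> a + of_int \<lceil>(u - a) / h\<rceil> * h"
    by (auto simp: algebra_simps)
qed

lemma lattice_mono: "of_int i * h \<le> of_int j * h \<longleftrightarrow> i \<le> j"
  using h by simp

text \<open>On either side of the origin the density is monotone, so a lattice weight lies between
  the integrals of the density over the two adjacent cells. A lattice tail is thus caught between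
  the Gaussian tails at neighbouring lattice points, which is what confines the cell boundaries of
  the coupling.\<close>

lemma lattice_tail_bounds:
  shows "0 \<le> a + of_int j * h \<Longrightarrow> measure (lattice_measure \<sigma> h a) {j<..} \<le> measure (normal_measure \<sigma>) {a + of_int j * h<..}"
    and "0 \<le> a + of_int j * h \<Longrightarrow> measure (normal_measure \<sigma>) {a + of_int (j + 1) * h<..} \<le> measure (lattice_measure \<sigma> h a) {j<..}"
    and "a + of_int j * h \<le> 0 \<Longrightarrow> measure (lattice_measure \<sigma> h a) {..<j} \<le> measure (normal_measure \<sigma>) {..a + of_int j * h}"
    and "a + of_int (j - 1) * h \<le> 0 \<Longrightarrow> measure (normal_measure \<sigma>) {..a + of_int (j - 1) * h} \<le> measure (lattice_measure \<sigma> h a) {..<j}"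
proof -
  have sp: "0 < \<sigma>" using h s by simp
  let ?P = "emeasure (lattice_measure \<sigma> h a)" and ?N = "emeasure (normal_measure \<sigma>)"
  let ?x = "\<lambda>j::int. a + of_int j * h"
  let ?k = "\<lambda>u. \<lceil>(u - a) / h\<rceil>"
  have PN: "measure (lattice_measure \<sigma> h a) A \<le> measure (normal_measure \<sigma>) B" if "?P A \<le> ?N B" for A B
    using that by (simp add: P.emeasure_eq_measure N.emeasure_eq_measure)
  have NP: "measure (normal_measure \<sigma>) B \<le> measure (lattice_measure \<sigma> h a) A" if "?N B \<le> ?P A" for A B
    using that by (simp add: P.emeasure_eq_measure N.emeasure_eq_measure)
  have xm: "?x i \<le> ?x j" if "i \<le> j" for i j using lattice_mono that by simp
  have xs: "?x i < ?x j \<longleftrightarrow> i < j" for i j using h by simp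
  have xd: "?x (i - 1) = ?x i - h" for i by (simp add: algebra_simps)
  { assume j: "0 \<le> ?x j"
    have "?P {j<..} = (\<integral>\<^sup>+u. ennreal (normal_density 0 \<sigma> (?x (?k u))) * indicator {j<..} (?k u) \<partial>lborel)"
      unfolding emeasure_lattice by (rule nn_integral_lattice_ceiling(1)[OF h, symmetric])
    also have "\<dots> \<le> ?N {?x j<..}"
      unfolding emeasure_normal_measure[OF borel_open[OF open_greaterThan]]
    proof (rule nn_integral_mono)
      fix u
      show "ennreal (normal_density 0 \<sigma> (?x (?k u))) * indicator {j<..} (?k u) \<le> ennreal (normal_density 0 \<sigma> u) * indicator {?x j<..} u"
      proof (cases "j < ?k u")
        case True
        then have "?x j \<le> ?x (?k u - 1)" by (intro xm) simp
        then have "?x j < u" using ceiling_lattice(1)[of u] xd[of "?k u"] by linarith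
        moreover have "normal_density 0 \<sigma> (?x (?k u)) \<le> normal_density 0 \<sigma> u"
          by (rule normal_density_antimono[OF _ sp]) (use j ceiling_lattice(2)[of u] \<open>?x j < u\<close> in linarith)
        ultimately show ?thesis using True by (simp add: ennreal_leI)
      qed simp
    qed
    finally show "measure (lattice_measure \<sigma> h a) {j<..} \<le> measure (normal_measure \<sigma>) {?x j<..}" by (rule PN)
    have "?N {?x (j + 1)<..} \<le> (\<integral>\<^sup>+u. ennreal (normal_density 0 \<sigma> (?x (?k u - 1))) * indicator {j<..} (?k u - 1) \<partial>lborel)"
      unfolding emeasure_normal_measure[OF borel_open[OF open_greaterThan]]
    proof (rule nn_integral_mono)
      fix u
      show "ennreal (normal_density 0 \<sigma> u) * indicator {?x (j + 1)<..} u \<le> ennreal (normal_density 0 \<sigma> (?x (?k u - 1))) * indicator {j<..} (?k u - 1)"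
      proof (cases "?x (j + 1) < u")
        case True
        then have "?x (j + 1) < ?x (?k u)" using ceiling_lattice(2)[of u] by linarith
        then have k: "j + 1 < ?k u" by (simp only: xs)
        then have "?x j \<le> ?x (?k u - 1)" by (intro xm) simp
        then have "normal_density 0 \<sigma> u \<le> normal_density 0 \<sigma> (?x (?k u - 1))"
          by (intro normal_density_antimono[OF _ sp]) (use j ceiling_lattice(1)[of u] xd[of "?k u"] in linarith)
        then show ?thesis using True k by (simp add: ennreal_leI)
      qed simp
    qed
    also have "\<dots> = ?P {j<..}"
      unfolding emeasure_lattice by (rule nn_integral_lattice_ceiling(2)[OF h])
    finally show "measure (normal_measure \<sigma>) {?x (j + 1)<..} \<le> measure (lattice_measure \<sigma> h a) {j<..}" by (rule NP) }
  { assume j: "?x j \<le> 0"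
    have "?P {..<j} = (\<integral>\<^sup>+u. ennreal (normal_density 0 \<sigma> (?x (?k u - 1))) * indicator {..<j} (?k u - 1) \<partial>lborel)"
      unfolding emeasure_lattice by (rule nn_integral_lattice_ceiling(2)[OF h, symmetric])
    also have "\<dots> \<le> ?N {..?x j}"
      unfolding emeasure_normal_measure[OF borel_closed[OF closed_atMost]]
    proof (rule nn_integral_mono)
      fix u
      show "ennreal (normal_density 0 \<sigma> (?x (?k u - 1))) * indicator {..<j} (?k u - 1) \<le> ennreal (normal_density 0 \<sigma> u) * indicator {..?x j} u"
      proof (cases "?k u - 1 < j")
        case True
        then have "?x (?k u) \<le> ?x j" by (intro xm) simp
        then have "u \<le> ?x j" using ceiling_lattice(2)[of u] by linarith
        moreover have "normal_density 0 \<sigma> (?x (?k u - 1)) \<le> normal_density 0 \<sigma> u"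
          by (rule normal_density_antimono[OF _ sp]) (use j ceiling_lattice(1)[of u] xd[of "?k u"] \<open>u \<le> ?x j\<close> in linarith)
        ultimately show ?thesis using True by (simp add: ennreal_leI)
      qed simp
    qed
    finally show "measure (lattice_measure \<sigma> h a) {..<j} \<le> measure (normal_measure \<sigma>) {..?x j}" by (rule PN) }
  { assume j: "?x (j - 1) \<le> 0"
    have "?N {..?x (j - 1)} \<le> (\<integral>\<^sup>+u. ennreal (normal_density 0 \<sigma> (?x (?k u))) * indicator {..<j} (?k u) \<partial>lborel)"
      unfolding emeasure_normal_measure[OF borel_closed[OF closed_atMost]]
    proof (rule nn_integral_mono)
      fix u
      show "ennreal (normal_density 0 \<sigma> u) * indicator {..?x (j - 1)} u \<le> ennreal (normal_density 0 \<sigma> (?x (?k u))) * indicator {..<j} (?k u)"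
      proof (cases "u \<le> ?x (j - 1)")
        case True
        then have "?x (?k u - 1) < ?x (j - 1)" using ceiling_lattice(1)[of u] xd[of "?k u"] by linarith
        then have k: "?k u - 1 < j - 1" by (simp only: xs)
        then have "?x (?k u) \<le> ?x (j - 1)" by (intro xm) simp
        then have "normal_density 0 \<sigma> u \<le> normal_density 0 \<sigma> (?x (?k u))"
          by (intro normal_density_antimono[OF _ sp]) (use j ceiling_lattice(2)[of u] in linarith)
        then show ?thesis using True k by (simp add: ennreal_leI)
      qed simp
    qed
    also have "\<dots> = ?P {..<j}"
      unfolding emeasure_lattice by (rule nn_integral_lattice_ceiling(1)[OF h])
    finally show "measure (normal_measure \<sigma>) {..?x (j - 1)} \<le> measure (lattice_measure \<sigma> h a) {..<j}" by (rule NP) }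
qed

end

section \<open>Quantile coupling of a Gaussian with its lattice discretisation\<close>

text \<open>Here \<open>r\<close> stands for \<sigma>/h and d = 2 exp(-r^2/648) for the deviation of
  the total mass; 24 r exp(-r^2/648) is 2d divided by 1/(6r), a lower bound for the central weight.
  The rate 1/1300 lies just below 1/1296, half of 1/648, because the first moment is only controlled
  by the square root of d.\<close>

lemma lattice_deviation_vs_centre:
  fixes r :: real
  assumes r: "1000 \<le> r"
  shows "24 * r * exp (- r\<^sup>2 / 648) \<le> 1000 * exp (- r\<^sup>2 / 1300)"
    and "1000 * exp (- r\<^sup>2 / 800) \<le> 1" and "24 * r * exp (- r\<^sup>2 / 648) \<le> 1" and "2 * exp (- r\<^sup>2 / 648) \<le> 1"
proof -
  have "r / 40 \<le> 1 + (r / 40)\<^sup>2 / 4" using zero_le_power2[of "r / 40 / 2 - 1"] by (simp add: power2_eq_square algebra_simps)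
  also have "\<dots> \<le> exp ((r / 40)\<^sup>2 / 4)" by (rule exp_ge_add_one_self)
  finally have "24 * r * exp (- r\<^sup>2 / 648) \<le> 24 * (40 * exp ((r / 40)\<^sup>2 / 4)) * exp (- r\<^sup>2 / 648)"
    by (intro mult_right_mono mult_left_mono) auto
  also have "\<dots> = 960 * exp ((r / 40)\<^sup>2 / 4 + - r\<^sup>2 / 648)" by (simp only: exp_add mult.assoc)
  also have "\<dots> \<le> 960 * exp (- r\<^sup>2 / 800)" by (simp add: power2_eq_square)
  finally have 1: "24 * r * exp (- r\<^sup>2 / 648) \<le> 960 * exp (- r\<^sup>2 / 800)" .
  have "960 * exp (- r\<^sup>2 / 800) \<le> 1000 * exp (- r\<^sup>2 / 1300)" by (intro mult_mono) auto
  with 1 show "24 * r * exp (- r\<^sup>2 / 648) \<le> 1000 * exp (- r\<^sup>2 / 1300)" by linarith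
  have "1000 * 1000 \<le> r * r" using r by (intro mult_mono) auto
  then have "1000 \<le> 1 + r\<^sup>2 / 800" by (simp add: power2_eq_square)
  also have "\<dots> \<le> exp (r\<^sup>2 / 800)" by (rule exp_ge_add_one_self)
  finally show 2: "1000 * exp (- r\<^sup>2 / 800) \<le> 1" by (simp add: exp_minus field_simps)
  then show 3: "24 * r * exp (- r\<^sup>2 / 648) \<le> 1" using 1 exp_gt_zero[of "- r\<^sup>2 / 800"] by linarith
  have "2 * exp (- r\<^sup>2 / 648) \<le> 24 * r * exp (- r\<^sup>2 / 648)" using r by (intro mult_right_mono) auto
  with 3 show "2 * exp (- r\<^sup>2 / 648) \<le> 1" by linarith
qed

lemma cdf_normal_measure_IVT:
  assumes s: "0 < \<sigma>" and xy: "x \<le> y" "cdf (normal_measure \<sigma>) x \<le> \<theta>" "\<theta> \<le> cdf (normal_measure \<sigma>) y"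
  shows "\<exists>b. x \<le> b \<and> b \<le> y \<and> cdf (normal_measure \<sigma>) b = \<theta>"
proof -
  interpret N: prob_space "normal_measure \<sigma>" by (rule prob_space_normal_measure[OF s])
  interpret N: real_distribution "normal_measure \<sigma>" by standard auto
  have "measure (normal_measure \<sigma>) {b} = 0" for b
  proof -
    have "emeasure (normal_measure \<sigma>) {b} = 0"
      unfolding normal_measure_def by (subst emeasure_density) (auto simp: nn_integral_indicator_singleton)
    then show ?thesis by (simp add: measure_def)
  qed
  then have "isCont (cdf (normal_measure \<sigma>)) b" for b by (simp add: N.isCont_cdf)
  then show ?thesis using IVT[of "cdf (normal_measure \<sigma>)" x \<theta> y] xy by blast
qed

lemma int_strict_monoI:
  fixes b :: "int \<Rightarrow> real"
  assumes step: "\<And>j. b j < b (j + 1)" and ij: "i < j"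
  shows "b i < b j"
  using ij
proof (induction j rule: int_gr_induct)
  case base show ?case by (rule step)
next
  case (step j) then show ?case using assms(1)[of j] by linarith
qed

lemma int_interval_cover:
  fixes b :: "int \<Rightarrow> real"
  assumes "i \<le> k" "b i < u" "u \<le> b k"
  shows "\<exists>j. b j < u \<and> u \<le> b (j + 1)"
proof (rule ccontr)
  assume c: "\<not> ?thesis"
  have "b j < u" if "i \<le> j" for j using that
  proof (induction j rule: int_ge_induct)
    case base show ?case by fact
  next
    case (step j) then show ?case using c by (meson not_le)
  qed
  then show False using assms by force
qed

text \<open>The cells are cut by matching the Gaussian tails with the lattice tails on either side of the
  centre; the central lattice point absorbs the deviation of the total lattice mass from one.\<close>

lemma lattice_coupling_centred:
  assumes h: "0 < h" and s: "1000 * h \<le> \<sigma>" and a: "0 \<le> a" "a < h"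
  defines "\<eta> \<equiv> 1000 * exp (- (\<sigma> / h)\<^sup>2 / 1300)"
  shows "\<exists>J \<in> borel \<rightarrow>\<^sub>M count_space (UNIV :: int set).
    (\<forall>u. \<bar>a + of_int (J u) * h - u\<bar> \<le> 2 * h) \<and>
    (\<forall>j. \<bar>h * normal_density 0 \<sigma> (a + of_int j * h) - measure (normal_measure \<sigma>) {u. J u = j}\<bar>
        \<le> \<eta> * measure (normal_measure \<sigma>) {u. J u = j}) \<and>
    \<bar>LINT u|normal_measure \<sigma>. a + of_int (J u) * h\<bar> \<le> \<eta> * \<sigma>"
proof -
  define r where "r = \<sigma> / h"
  define d where "d = 2 * exp (- r\<^sup>2 / 648)"
  have sp: "0 < \<sigma>" and hs: "h \<le> \<sigma>" and r: "1000 \<le> r" using h s by (auto simp: r_def pos_le_divide_eq)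
  note rb = lattice_deviation_vs_centre[OF r]
  have dev: "lattice_dev \<sigma> h d" using lattice_dev_exp[of h \<sigma>] h s by (simp add: d_def r_def)
  define x where "x = (\<lambda>j::int. a + of_int j * h)"
  define p where "p = (\<lambda>j. h * normal_density 0 \<sigma> (x j))"
  interpret N: prob_space "normal_measure \<sigma>" by (rule prob_space_normal_measure[OF sp])
  interpret N: real_distribution "normal_measure \<sigma>" by standard auto
  interpret P: finite_measure "lattice_measure \<sigma> h a" by (rule finite_lattice_measure[OF h hs])
  let ?P = "measure (lattice_measure \<sigma> h a)"
  let ?G = "cdf (normal_measure \<sigma>)"
  have setsP[simp]: "sets (lattice_measure \<sigma> h a) = UNIV" by (simp add: lattice_measure_def)
  have G1: "measure (normal_measure \<sigma>) {y<..} = 1 - ?G y" for y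
    using N.prob_compl[of "{..y}"] by (simp add: cdf_def Compl_atMost[symmetric] Compl_eq_Diff_UNIV)
  have tail: "0 \<le> x j \<Longrightarrow> ?P {j<..} \<le> 1 - ?G (x j)" "0 \<le> x j \<Longrightarrow> 1 - ?G (x (j + 1)) \<le> ?P {j<..}"
    "x j \<le> 0 \<Longrightarrow> ?P {..<j} \<le> ?G (x j)" "x (j - 1) \<le> 0 \<Longrightarrow> ?G (x (j - 1)) \<le> ?P {..<j}" for j
    using lattice_tail_bounds[OF h hs, of a j, unfolded G1] by (simp_all only: x_def cdf_def)
  have psingle: "?P {j} = p j" for j using measure_lattice_singleton[OF h hs, of a j] by (simp add: p_def x_def)
  have ppos: "0 < p j" for j using h sp by (simp add: p_def normal_density_pos)
  have total: "\<bar>?P UNIV - 1\<bar> \<le> d" using dev measure_lattice_UNIV[OF h hs, of a] by (simp add: lattice_dev_def)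
  \<comment> \<open>The central point is at most \<sigma> from the origin, so its exponential is at
    least exp(-1/2) >= 1/2; with sqrt(2 pi) <= 3 the central weight is at least
    h/(6\<sigma>).\<close>
  have p0: "1 / (6 * r) \<le> p 0"
  proof -
    have "1 / 2 \<le> exp (- 1 / 2 :: real)" using exp_ge_add_one_self[of "-1/2::real"] by simp
    also have "\<dots> \<le> exp (- a\<^sup>2 / (2 * \<sigma>\<^sup>2))"
    proof -
      have "a\<^sup>2 \<le> \<sigma>\<^sup>2" using a h hs by (intro power_mono) auto
      then show ?thesis using sp by (simp add: field_simps)
    qed
    finally have e: "1 / 2 \<le> exp (- a\<^sup>2 / (2 * \<sigma>\<^sup>2))" .
    have "sqrt (2 * pi * \<sigma>\<^sup>2) \<le> 3 * \<sigma>"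
    proof (rule real_le_lsqrt)
      have "2 * pi * \<sigma>\<^sup>2 \<le> 9 * \<sigma>\<^sup>2" using pi_less_4 by (intro mult_right_mono) auto
      then show "2 * pi * \<sigma>\<^sup>2 \<le> (3 * \<sigma>)\<^sup>2" by (simp add: power_mult_distrib)
    qed (use sp in auto)
    then have "(1 / 2) / (3 * \<sigma>) \<le> exp (- a\<^sup>2 / (2 * \<sigma>\<^sup>2)) / sqrt (2 * pi * \<sigma>\<^sup>2)"
      using e sp by (intro frac_le) auto
    then have "(1 / 2) / (3 * \<sigma>) \<le> normal_density 0 \<sigma> a" by (simp add: normal_density_def)
    then have "h * ((1 / 2) / (3 * \<sigma>)) \<le> h * normal_density 0 \<sigma> a" using h by (intro mult_left_mono) auto
    then have "h * ((1 / 2) / (3 * \<sigma>)) \<le> p 0" by (simp add: p_def x_def)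
    moreover have "h * ((1 / 2) / (3 * \<sigma>)) = 1 / (6 * r)" using h sp by (simp add: r_def)
    ultimately show ?thesis by simp
  qed
  have dp0: "2 * d \<le> 24 * r * exp (- r\<^sup>2 / 648) * p 0"
  proof -
    have "2 * d = 24 * r * exp (- r\<^sup>2 / 648) * (1 / (6 * r))" using r by (simp add: d_def)
    also have "\<dots> \<le> 24 * r * exp (- r\<^sup>2 / 648) * p 0" using p0 r by (intro mult_left_mono) auto
    finally show ?thesis .
  qed
  have d2: "2 * d \<le> p 0"
  proof -
    have "24 * r * exp (- r\<^sup>2 / 648) * p 0 \<le> 1 * p 0" using rb(3) ppos[of 0] by (intro mult_right_mono) auto
    then show ?thesis using dp0 by linarith
  qed
  have dpos: "0 < d" by (simp add: d_def)
  \<comment> \<open>\<open>\<theta> j\<close> is the Gaussian mass to be placed to the left of cell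
    j. It is read off from the lower lattice tail up to the centre and from the upper one beyond it;
    both tails are matched exactly, and the jump from \<open>\<theta> 0\<close> to
    \<open>\<theta> 1\<close> absorbs the defect of the total mass.\<close>
  define \<theta> where "\<theta> = (\<lambda>j::int. if j \<le> 0 then ?P {..<j} else 1 - ?P {j - 1<..})"
  define w where "w = (\<lambda>j. if j = 0 then p 0 + (1 - ?P UNIV) else p j)"
  have w: "\<theta> (j + 1) - \<theta> j = w j" for j
  proof -
    consider "j < 0" | "j = 0" | "0 < j" by linarith
    then show ?thesis
    proof cases
      case 1
      have "{..<j + 1} = insert j {..<j}" by auto
      then have "?P {..<j + 1} = p j + ?P {..<j}"
        using P.finite_measure_Union[of "{j}" "{..<j}"] psingle by simp
      then show ?thesis using 1 by (simp add: \<theta>_def w_def)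
    next
      case 2
      have "(UNIV :: int set) = insert 0 ({..<0} \<union> {0<..})" by auto
      then have "?P UNIV = ?P ({0} \<union> ({..<0} \<union> {0<..}))" by simp
      also have "\<dots> = p 0 + (?P {..<0} + ?P {0<..})"
        using P.finite_measure_Union[of "{0}" "{..<0} \<union> {0<..}"] P.finite_measure_Union[of "{..<0::int}" "{0<..}"] psingle[of 0]
        by (simp add: Int_Un_distrib disjoint_iff)
      finally show ?thesis using 2 by (simp add: \<theta>_def w_def)
    next
      case 3
      have "{j - 1<..} = insert j {j<..}" by auto
      then have "?P {j - 1<..} = p j + ?P {j<..}"
        using P.finite_measure_Union[of "{j}" "{j<..}"] psingle by simp
      then show ?thesis using 3 by (simp add: \<theta>_def w_def)
    qed
  qed
  have w0: "p 0 \<le> 2 * w 0" "\<bar>p 0 - w 0\<bar> \<le> d" using total d2 by (auto simp: w_def)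
  have wpos: "0 < w j" for j using ppos[of j] ppos[of 0] w0 by (cases "j = 0") (auto simp: w_def)
  have xm: "i \<le> j \<Longrightarrow> x i \<le> x j" for i j using h by (simp add: x_def)
  have xneg: "j < 0 \<Longrightarrow> x j \<le> 0" for j
  proof -
    assume "j < 0"
    then have "x j \<le> x (- 1)" by (intro xm) simp
    then show ?thesis using a by (simp add: x_def)
  qed
  have xnn: "0 \<le> j \<Longrightarrow> 0 \<le> x j" for j using a h by (simp add: x_def)
  have lo: "?G (x (j - 1)) \<le> \<theta> j" for j
  proof (cases "j \<le> 0")
    case True then show ?thesis using tail(4)[of j] xneg[of "j - 1"] by (simp add: \<theta>_def)
  next
    case False then show ?thesis using tail(1)[of "j - 1"] xnn[of "j - 1"] by (simp add: \<theta>_def)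
  qed
  have hi': "\<theta> j \<le> ?G (x j)" if "j \<noteq> 0" for j
  proof (cases "j \<le> 0")
    case True then show ?thesis using tail(3)[of j] xneg[of j] that by (simp add: \<theta>_def)
  next
    case False then show ?thesis using tail(2)[of "j - 1"] xnn[of "j - 1"] by (simp add: \<theta>_def)
  qed
  have hi: "\<theta> j \<le> ?G (x (j + 1))" for j
  proof (cases "j = 0")
    case True then show ?thesis using hi'[of 1] w[of 0] wpos[of 0] by simp
  next
    case False then show ?thesis using hi'[of j] N.cdf_nondecreasing[OF xm[of j "j + 1"]] by simp
  qed
  have "\<exists>b. x (j - 1) \<le> b \<and> b \<le> x (j + 1) \<and> ?G b = \<theta> j" for j
    by (rule cdf_normal_measure_IVT[OF sp xm lo hi]) simp
  then obtain b where b: "\<And>j. x (j - 1) \<le> b j" "\<And>j. b j \<le> x (j + 1)" "\<And>j. ?G (b j) = \<theta> j" by metis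
  have bstep: "b j < b (j + 1)" for j
  proof (rule ccontr)
    assume "\<not> ?thesis"
    then have "?G (b (j + 1)) \<le> ?G (b j)" by (intro N.cdf_nondecreasing) simp
    then show False using w[of j] wpos[of j] by (simp add: b(3))
  qed
  have bm: "i < j \<Longrightarrow> b i < b j" for i j by (rule int_strict_monoI[of b]) (rule bstep)
  have cover: "\<exists>j. b j < u \<and> u \<le> b (j + 1)" for u
  proof -
    define k where "k = \<lceil>(u - a) / h\<rceil>"
    have k: "x k - h < u" "u \<le> x k" using ceiling_lattice[OF h hs, where a = a and u = u] by (simp_all only: x_def k_def)
    have "b (k - 2) \<le> x (k - 1)" using b(2)[of "k - 2"] by (simp add: algebra_simps)
    also have "x (k - 1) = x k - h" by (simp add: x_def algebra_simps)
    finally have "b (k - 2) < u" using k by simp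
    moreover have "u \<le> b (k + 1)" using b(1)[of "k + 1"] k by simp
    ultimately show ?thesis by (intro int_interval_cover[of "k - 2" "k + 1"]) auto
  qed
  define J where "J = (\<lambda>u. SOME j. b j < u \<and> u \<le> b (j + 1))"
  have J: "b (J u) < u" "u \<le> b (J u + 1)" for u
    using someI_ex[OF cover[of u]] by (auto simp: J_def)
  have Jeq: "J u = j \<longleftrightarrow> u \<in> {b j<..b (j + 1)}" for u j
  proof
    assume u: "u \<in> {b j<..b (j + 1)}"
    show "J u = j"
    proof (rule linorder_cases[of "J u" j])
      assume "J u < j"
      then have "b (J u + 1) \<le> b j" using bm[of "J u + 1" j] by (cases "J u + 1 = j") auto
      then show ?thesis using J(2)[of u] u by simp
    next
      assume "j < J u"
      then have "b (j + 1) \<le> b (J u)" using bm[of "j + 1" "J u"] by (cases "j + 1 = J u") auto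
      then show ?thesis using J(1)[of u] u by simp
    qed
  qed (use J in auto)
  have Jset: "{u. J u = j} = {b j<..b (j + 1)}" for j by (auto simp: Jeq)
  have Jm: "J \<in> borel \<rightarrow>\<^sub>M count_space UNIV"
  proof (rule measurable_count_space_eq2_countable[THEN iffD2])
    have "J -` {j} \<inter> space borel = {b j<..b (j + 1)}" for j using Jset[of j] by auto
    then show "J \<in> space borel \<rightarrow> UNIV \<and> (\<forall>j\<in>UNIV. J -` {j} \<inter> space borel \<in> sets borel)" by simp
  qed
  have meas: "measure (normal_measure \<sigma>) {u. J u = j} = w j" for j
    unfolding Jset using N.cdf_diff_eq[OF bstep[of j]] w[of j] by (simp add: b(3))
  \<comment> \<open>u lies between b (J u) and b (J u + 1), hence between the lattice points with
    indices J u - 1 and J u + 2: this is the origin of 2h.\<close>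
  have A: "\<bar>x (J u) - u\<bar> \<le> 2 * h" for u
  proof -
    have "x (J u - 1) \<le> u" "u \<le> x (J u + 1 + 1)"
      using J[of u] b(1)[of "J u"] b(2)[of "J u + 1"] by auto
    then show ?thesis using h by (simp add: x_def algebra_simps abs_le_iff)
  qed
  have B: "\<bar>p j - w j\<bar> \<le> \<eta> * w j" for j
  proof (cases "j = 0")
    case True
    have "d \<le> 24 * r * exp (- r\<^sup>2 / 648) * (p 0 / 2)" using dp0 by simp
    also have "\<dots> \<le> \<eta> * w 0"
      using rb(1) w0(1) ppos[of 0] wpos[of 0] by (intro mult_mono) (auto simp: \<eta>_def r_def[symmetric])
    finally show ?thesis using w0(2) True by simp
  next
    case False then show ?thesis using wpos[of j] by (simp add: w_def \<eta>_def)
  qed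
  \<comment> \<open>The mean of the rounded variable is the lattice first moment plus the correction
    of the central weight times its position; both are at most of order \<sigma> sqrt d.\<close>
  have C: "\<bar>LINT u|normal_measure \<sigma>. x (J u)\<bar> \<le> \<eta> * \<sigma>"
  proof -
    have Jm': "J \<in> normal_measure \<sigma> \<rightarrow>\<^sub>M count_space UNIV"
      using Jm by (simp cong: measurable_cong_sets)
    have D: "distr (normal_measure \<sigma>) (count_space UNIV) J = density (count_space UNIV) (\<lambda>j. ennreal (w j))"
    proof (rule measure_eqI_countable[of _ UNIV])
      fix j
      have "emeasure (distr (normal_measure \<sigma>) (count_space UNIV) J) {j} = emeasure (normal_measure \<sigma>) {u. J u = j}"
        using Jm' by (subst emeasure_distr) (auto intro!: arg_cong[where f = "emeasure _"])
      also have "\<dots> = ennreal (w j)" by (simp add: N.emeasure_eq_measure meas)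
      finally show "emeasure (distr (normal_measure \<sigma>) (count_space UNIV) J) {j} = emeasure (density (count_space UNIV) (\<lambda>j. ennreal (w j))) {j}"
        by (simp add: emeasure_density)
    qed auto
    have "(LINT u|normal_measure \<sigma>. x (J u)) = (LINT j|distr (normal_measure \<sigma>) (count_space UNIV) J. x j)"
      by (rule integral_distr[symmetric]) (use Jm' in auto)
    also have "\<dots> = (LINT j|count_space UNIV. w j * x j)"
      unfolding D by (subst integral_density) (use wpos in \<open>auto intro: less_imp_le\<close>)
    also have "\<dots> = (LINT j|count_space UNIV. x j * p j + (w 0 - p 0) * x 0 * indicator {0} j)"
      by (rule Bochner_Integration.integral_cong) (auto simp: w_def indicator_def algebra_simps)
    also have "\<dots> = (LINT j|count_space UNIV. x j * p j) + (w 0 - p 0) * x 0"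
      using lattice_weights_integrable(3)[OF h hs, of a]
      by (subst Bochner_Integration.integral_add) (auto simp: x_def p_def integrable_mult_right_iff integrable_indicator_iff)
    finally have eq: "(LINT u|normal_measure \<sigma>. x (J u)) = (LINT j|count_space UNIV. x j * p j) + (w 0 - p 0) * x 0" .
    have "\<bar>LINT j|count_space UNIV. x j * p j\<bar> \<le> 4 * \<sigma> * sqrt d"
      unfolding x_def p_def by (rule lattice_first_moment[OF h hs dev]) (use rb(4) in \<open>auto simp: d_def\<close>)
    moreover have "\<bar>(w 0 - p 0) * x 0\<bar> \<le> sqrt d * \<sigma>"
    proof -
      have "d * d \<le> d * 1" using dpos rb(4) by (intro mult_left_mono) (auto simp: d_def)
      then have "d \<le> sqrt d" by (intro real_le_rsqrt) (simp add: power2_eq_square)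
      then show ?thesis using w0(2) a hs by (auto simp: abs_mult x_def abs_minus_commute intro!: mult_mono)
    qed
    moreover have "4 * \<sigma> * sqrt d + sqrt d * \<sigma> = 5 * sqrt d * \<sigma>" by (simp add: algebra_simps)
    ultimately have "\<bar>LINT u|normal_measure \<sigma>. x (J u)\<bar> \<le> 5 * sqrt d * \<sigma>"
      unfolding eq abs_le_iff by linarith
    also have "\<dots> \<le> \<eta> * \<sigma>"
    proof (intro mult_right_mono)
      have "sqrt d \<le> 2 * exp (- r\<^sup>2 / 1296)"
      proof (rule real_le_lsqrt)
        have "exp (- r\<^sup>2 / 648) = exp (- r\<^sup>2 / 1296 + - r\<^sup>2 / 1296)" by simp
        also have "\<dots> = (exp (- r\<^sup>2 / 1296))\<^sup>2" by (simp only: exp_add power2_eq_square)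
        finally show "d \<le> (2 * exp (- r\<^sup>2 / 1296))\<^sup>2" by (simp add: d_def power_mult_distrib)
      qed auto
      also have "2 * exp (- r\<^sup>2 / 1296) \<le> 2 * exp (- r\<^sup>2 / 1300)" by simp
      finally show "5 * sqrt d \<le> \<eta>" using exp_gt_zero[of "- r\<^sup>2 / 1300"] unfolding \<eta>_def r_def by linarith
    qed (use sp in auto)
    finally show ?thesis .
  qed
  show ?thesis
    using Jm A B C by (intro bexI[of _ J]) (auto simp: meas x_def p_def)
qed

text \<open>Translating by a multiple of h brings the offset of the lattice into [0, h). The last
  clause bounds the bias of the rounding, since the Gaussian itself is centred.\<close>

lemma lattice_coupling:
  assumes h: "0 < h" and s: "1000 * h \<le> \<sigma>"
  defines "\<eta> \<equiv> 1000 * exp (- (\<sigma> / h)\<^sup>2 / 1300)"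
  shows "\<exists>T \<in> borel_measurable borel.
    (\<forall>u. \<bar>T u - u\<bar> \<le> 2 * h) \<and> (\<forall>u. \<exists>j::int. T u = c + of_int j * h) \<and>
    (\<forall>j::int. \<bar>h * normal_density 0 \<sigma> (c + of_int j * h) - measure (normal_measure \<sigma>) {u. T u = c + of_int j * h}\<bar>
        \<le> \<eta> * measure (normal_measure \<sigma>) {u. T u = c + of_int j * h}) \<and>
    \<bar>LINT u|normal_measure \<sigma>. T u\<bar> \<le> \<eta> * \<sigma>"
proof -
  define m where "m = \<lfloor>c / h\<rfloor>"
  define a where "a = c - of_int m * h"
  have "of_int m \<le> c / h" "c / h < of_int m + 1" unfolding m_def by linarith+
  then have a: "0 \<le> a" "a < h" using h by (auto simp: a_def field_simps)
  obtain J where J: "J \<in> borel \<rightarrow>\<^sub>M count_space (UNIV :: int set)"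
    "\<And>u. \<bar>a + of_int (J u) * h - u\<bar> \<le> 2 * h"
    "\<And>j. \<bar>h * normal_density 0 \<sigma> (a + of_int j * h) - measure (normal_measure \<sigma>) {u. J u = j}\<bar>
        \<le> \<eta> * measure (normal_measure \<sigma>) {u. J u = j}"
    "\<bar>LINT u|normal_measure \<sigma>. a + of_int (J u) * h\<bar> \<le> \<eta> * \<sigma>"
    using lattice_coupling_centred[OF h s a] unfolding \<eta>_def by blast
  have e: "c + of_int j * h = a + of_int (j + m) * h" for j by (simp add: a_def algebra_simps)
  show ?thesis
  proof (intro bexI conjI allI)
    show "(\<lambda>u. a + of_int (J u) * h) \<in> borel_measurable borel" using J(1) by measurable
    show "\<exists>j::int. a + of_int (J u) * h = c + of_int j * h" for u
      using e[of "J u - m"] by (intro exI[of _ "J u - m"]) simp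
    show "\<bar>h * normal_density 0 \<sigma> (c + of_int j * h) - measure (normal_measure \<sigma>) {u. a + of_int (J u) * h = c + of_int j * h}\<bar>
        \<le> \<eta> * measure (normal_measure \<sigma>) {u. a + of_int (J u) * h = c + of_int j * h}" for j
    proof -
      have "{u. a + of_int (J u) * h = a + of_int (j + m) * h} = {u. J u = j + m}" using h by auto
      then show ?thesis using J(3)[of "j + m"] by (simp only: e)
    qed
  qed (use J in auto)
qed

section \<open>Markov chains driven by independent increments\<close>

text \<open>The sigma-algebra generated by the first k driving variables. It stands in for
  conditioning: functionals are split into a \<open>past\<close>-measurable factor times a function
  of \<open>\<xi> k\<close>, and \<open>expectation_past\<close> factorises the expectation.\<close>

definition past :: "'a measure \<Rightarrow> (nat \<Rightarrow> 'a \<Rightarrow> real) \<Rightarrow> nat \<Rightarrow> 'a measure" where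
  "past M \<xi> k = vimage_algebra (space M) (\<lambda>\<omega>. \<lambda>i\<in>{..<k}. \<xi> i \<omega>) (PiM {..<k} (\<lambda>_. borel))"

lemma space_past[simp]: "space (past M \<xi> k) = space M"
  by (simp add: past_def)

lemma measurable_past_restrict: "(\<lambda>\<omega>. \<lambda>i\<in>{..<k}. \<xi> i \<omega>) \<in> past M \<xi> k \<rightarrow>\<^sub>M PiM {..<k} (\<lambda>_. borel)"
  unfolding past_def by (rule measurable_vimage_algebra1) (auto simp: space_PiM)

lemma measurable_past_component: "i < k \<Longrightarrow> \<xi> i \<in> borel_measurable (past M \<xi> k)"
  using measurable_compose[OF measurable_past_restrict[of \<xi> k M] measurable_component_singleton[of i "{..<k}" "\<lambda>_. borel"]] by simp

lemma sets_past_subset: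
  assumes "\<And>i. i < k \<Longrightarrow> \<xi> i \<in> borel_measurable N" and N: "space N = space M"
  shows "sets (past M \<xi> k) \<subseteq> sets N"
proof -
  have "(\<lambda>\<omega>. \<lambda>i\<in>{..<k}. \<xi> i \<omega>) \<in> N \<rightarrow>\<^sub>M PiM {..<k} (\<lambda>_. borel)"
    by (rule measurable_restrict) (use assms in auto)
  then show ?thesis unfolding past_def N[symmetric] by (intro sets_image_in_sets) auto
qed

lemma measurable_subalgebra:
  "f \<in> F \<rightarrow>\<^sub>M N \<Longrightarrow> sets F \<subseteq> sets G \<Longrightarrow> space F = space G \<Longrightarrow> f \<in> G \<rightarrow>\<^sub>M N"
  by (auto simp: measurable_def)

lemma measurable_past_mono: "k \<le> l \<Longrightarrow> f \<in> past M \<xi> k \<rightarrow>\<^sub>M N \<Longrightarrow> f \<in> past M \<xi> l \<rightarrow>\<^sub>M N"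
  by (erule measurable_subalgebra, rule sets_past_subset) (auto intro: measurable_past_component)

context prob_space
begin

lemma measurable_past_imp_measurable:
  assumes "\<And>i. i < k \<Longrightarrow> \<xi> i \<in> borel_measurable M" "f \<in> past M \<xi> k \<rightarrow>\<^sub>M N"
  shows "f \<in> M \<rightarrow>\<^sub>M N"
  by (rule measurable_subalgebra[OF assms(2) sets_past_subset]) (use assms in auto)

text \<open>The sigma-algebras generated by Z and by g (\<xi> k) are contained in those of the
  blocks of variables with index below k and equal to k, and independence passes to smaller
  families.\<close>

lemma indep_var_past:
  fixes Z :: "'a \<Rightarrow> 'c :: topological_space" and g :: "real \<Rightarrow> 'c"
  assumes ind: "indep_vars (\<lambda>_. borel) \<xi> {..<n}" and k: "k < n"
    and Z: "Z \<in> past M \<xi> k \<rightarrow>\<^sub>M borel" and g: "g \<in> borel \<rightarrow>\<^sub>M borel"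
  shows "indep_var borel Z borel (\<lambda>\<omega>. g (\<xi> k \<omega>))"
proof -
  have rv: "\<And>i. i < n \<Longrightarrow> \<xi> i \<in> borel_measurable M" using ind by (auto simp: indep_vars_def)
  let ?H = "\<lambda>\<omega>. \<lambda>i\<in>{..<k}. \<xi> i \<omega>"
  have I: "indep_var (PiM {..<k} (\<lambda>_. borel)) ?H (PiM {k} (\<lambda>_. borel)) (\<lambda>\<omega>. \<lambda>i\<in>{k}. \<xi> i \<omega>)"
    by (rule indep_var_restrict[OF ind]) (use k in auto)
  have Z': "Z \<in> borel_measurable M"
    by (rule measurable_past_imp_measurable[OF rv Z]) (use k in simp)
  have g': "(\<lambda>\<omega>. g (\<xi> k \<omega>)) \<in> borel_measurable M"
    using measurable_compose[OF rv[OF k] g] .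
  have "{Z -` A \<inter> space M |A. A \<in> sets borel} \<subseteq> sets (past M \<xi> k)"
    using measurable_sets[OF Z] by auto
  from sets.sigma_sets_subset[OF this]
  have s1: "sigma_sets (space M) {Z -` A \<inter> space M |A. A \<in> sets borel}
    \<subseteq> sigma_sets (space M) {?H -` A \<inter> space M | A. A \<in> sets (PiM {..<k} (\<lambda>_. borel))}"
    by (simp add: past_def sets_vimage_algebra)
  have "{(\<lambda>\<omega>. g (\<xi> k \<omega>)) -` A \<inter> space M |A. A \<in> sets borel}
    \<subseteq> {(\<lambda>\<omega>. \<lambda>i\<in>{k}. \<xi> i \<omega>) -` A \<inter> space M | A. A \<in> sets (PiM {k} (\<lambda>_. borel))}"
  proof safe
    fix B :: "'c set" assume B: "B \<in> sets borel"
    have m: "(\<lambda>f. g (f k)) \<in> PiM {k} (\<lambda>_. borel) \<rightarrow>\<^sub>M borel"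
      using measurable_compose[OF measurable_component_singleton[of k "{k}" "\<lambda>_. borel :: real measure"] g] by simp
    show "\<exists>C. (\<lambda>\<omega>. g (\<xi> k \<omega>)) -` B \<inter> space M = (\<lambda>\<omega>. \<lambda>i\<in>{k}. \<xi> i \<omega>) -` C \<inter> space M \<and> C \<in> sets (PiM {k} (\<lambda>_. borel))"
      by (rule exI[of _ "(\<lambda>f. g (f k)) -` B \<inter> space (PiM {k} (\<lambda>_. borel))"])
        (use measurable_sets[OF m B] in \<open>auto simp: space_PiM\<close>)
  qed
  then have s2: "sigma_sets (space M) {(\<lambda>\<omega>. g (\<xi> k \<omega>)) -` A \<inter> space M |A. A \<in> sets borel}
    \<subseteq> sigma_sets (space M) {(\<lambda>\<omega>. \<lambda>i\<in>{k}. \<xi> i \<omega>) -` A \<inter> space M | A. A \<in> sets (PiM {k} (\<lambda>_. borel))}"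
    by (rule sigma_sets_mono')
  have "indep_set (sigma_sets (space M) {Z -` A \<inter> space M |A. A \<in> sets borel})
      (sigma_sets (space M) {(\<lambda>\<omega>. g (\<xi> k \<omega>)) -` A \<inter> space M |A. A \<in> sets borel})"
    unfolding indep_set_def
    by (rule indep_sets_mono_sets[OF I[unfolded indep_var_eq indep_set_def, THEN conjunct2]])
      (use s1 s2 in \<open>auto split: bool.split\<close>)
  then show ?thesis using g' Z' unfolding indep_var_eq by simp
qed

lemma expectation_past:
  fixes Z :: "'a \<Rightarrow> 'c :: {real_normed_field, banach, second_countable_topology}" and g :: "real \<Rightarrow> 'c"
  assumes ind: "indep_vars (\<lambda>_. borel) \<xi> {..<n}" and k: "k < n"
    and Z: "Z \<in> past M \<xi> k \<rightarrow>\<^sub>M borel" "integrable M Z" and g: "g \<in> borel \<rightarrow>\<^sub>M borel" "integrable M (\<lambda>\<omega>. g (\<xi> k \<omega>))"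
  shows "expectation (\<lambda>\<omega>. Z \<omega> * g (\<xi> k \<omega>)) = expectation Z * expectation (\<lambda>\<omega>. g (\<xi> k \<omega>))"
    and "integrable M (\<lambda>\<omega>. Z \<omega> * g (\<xi> k \<omega>))"
  using indep_var_lebesgue_integral[OF indep_var_past[OF ind k Z(1) g(1)] Z(2) g(2)]
    indep_var_integrable[OF indep_var_past[OF ind k Z(1) g(1)] Z(2) g(2)] by auto

end

section \<open>The killed chain and its path functionals\<close>

text \<open>From a state outside \<open>A k\<close> the chain stays put, because the step maps will
  only be specified on the grid. The same state may lie in a later \<open>A j\<close> again, so
  survival has to be recorded along the whole path; this is what \<open>alive\<close> does.\<close>

primrec chain :: "real \<Rightarrow> (nat \<Rightarrow> real set) \<Rightarrow> (nat \<Rightarrow> real \<Rightarrow> real \<Rightarrow> real) \<Rightarrow> (nat \<Rightarrow> 'a \<Rightarrow> real) \<Rightarrow> nat \<Rightarrow> 'a \<Rightarrow> real" where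
  "chain x0 A T \<xi> 0 \<omega> = x0"
| "chain x0 A T \<xi> (Suc k) \<omega> =
    (if chain x0 A T \<xi> k \<omega> \<in> A k then T k (chain x0 A T \<xi> k \<omega>) (\<xi> k \<omega>) else chain x0 A T \<xi> k \<omega>)"

locale driven_chain = prob_space M for M :: "'a measure" +
  fixes \<xi> :: "nat \<Rightarrow> 'a \<Rightarrow> real" and n :: nat and x0 :: real
    and A :: "nat \<Rightarrow> real set" and T :: "nat \<Rightarrow> real \<Rightarrow> real \<Rightarrow> real"
  assumes indep: "indep_vars (\<lambda>_. borel) \<xi> {..<n}"
    and finite_A: "\<And>k. k \<le> n \<Longrightarrow> finite (A k)"
    and T_measurable: "\<And>k x. k < n \<Longrightarrow> x \<in> A k \<Longrightarrow> T k x \<in> borel_measurable borel"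
begin

abbreviation "Y \<equiv> chain x0 A T \<xi>"

definition alive :: "nat \<Rightarrow> 'a \<Rightarrow> bool" where "alive k \<omega> \<longleftrightarrow> (\<forall>j\<le>k. Y j \<omega> \<in> A j)"

lemma alive_Suc: "alive (Suc k) \<omega> \<longleftrightarrow> alive k \<omega> \<and> Y (Suc k) \<omega> \<in> A (Suc k)"
  by (auto simp: alive_def le_Suc_eq)

lemma alive_mem: "alive k \<omega> \<Longrightarrow> Y k \<omega> \<in> A k" by (auto simp: alive_def)

lemma rv: "k < n \<Longrightarrow> \<xi> k \<in> borel_measurable M"
  using indep by (auto simp: indep_vars_def)

text \<open>With finitely many states, T k (Y k) (\<xi> k) becomes a finite sum over x of the
  indicator of Y k = x times T k x (\<xi> k). Measurability of \<open>T k x\<close> for each fixed x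
  then suffices, and each summand separates past from present.\<close>

lemma sum_over_state:
  fixes f :: "real \<Rightarrow> 'c :: comm_ring_1"
  assumes "finite B" "y \<in> B" shows "f y = (\<Sum>x\<in>B. of_bool (y = x) * f x)"
proof -
  have "(\<Sum>x\<in>B. of_bool (y = x) * f x) = (\<Sum>x\<in>B. if x = y then f x else 0)"
    by (rule sum.cong) auto
  then show ?thesis using assms by simp
qed

lemma Y_measurable: "k \<le> n \<Longrightarrow> Y k \<in> borel_measurable (past M \<xi> k)"
proof (induction k)
  case 0 then show ?case by (simp add: measurable_const[of x0])
next
  case (Suc k)
  then have k: "k < n" "k \<le> n" by auto
  have [measurable]: "Y k \<in> borel_measurable (past M \<xi> (Suc k))"
    using Suc.IH[OF k(2)] by (rule measurable_past_mono[rotated]) simp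
  have [measurable]: "\<xi> k \<in> borel_measurable (past M \<xi> (Suc k))" by (rule measurable_past_component) simp
  have [measurable]: "A k \<in> sets borel" using finite_A[OF k(2)] by (intro borel_closed finite_imp_closed)
  have Tm: "(\<lambda>\<omega>. T k x (\<xi> k \<omega>)) \<in> borel_measurable (past M \<xi> (Suc k))" if "x \<in> A k" for x
    using measurable_compose[OF _ T_measurable[OF k(1) that]] by measurable
  have "(\<lambda>\<omega>. if Y k \<omega> \<in> A k then (\<Sum>x\<in>A k. of_bool (Y k \<omega> = x) * T k x (\<xi> k \<omega>)) else Y k \<omega>) \<in> borel_measurable (past M \<xi> (Suc k))"
    by (intro measurable_If borel_measurable_sum borel_measurable_times Tm) measurable
  moreover have "Y (Suc k) \<omega> = (if Y k \<omega> \<in> A k then (\<Sum>x\<in>A k. of_bool (Y k \<omega> = x) * T k x (\<xi> k \<omega>)) else Y k \<omega>)" for \<omega>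
    using sum_over_state[OF finite_A[OF k(2)], of "Y k \<omega>" "\<lambda>x. T k x (\<xi> k \<omega>)"] by auto
  ultimately show ?case by (simp add: fun_eq_iff cong: measurable_cong)
qed

lemma alive_measurable: "k \<le> n \<Longrightarrow> Measurable.pred (past M \<xi> k) (alive k)"
proof (induction k)
  case 0
  then show ?case by (simp add: alive_def)
next
  case (Suc k)
  have [measurable]: "Y (Suc k) \<in> borel_measurable (past M \<xi> (Suc k))" by (rule Y_measurable) (use Suc in simp)
  have [measurable]: "A (Suc k) \<in> sets borel" using finite_A[of "Suc k"] Suc by (intro borel_closed finite_imp_closed) simp
  have [measurable]: "Measurable.pred (past M \<xi> (Suc k)) (alive k)"
    using Suc by (intro measurable_past_mono[of k "Suc k"]) auto
  show ?case unfolding alive_Suc by measurable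
qed

text \<open>A Feynman-Kac functional killed on leaving the sets \<open>A j\<close>; restricted to Y
  k = y, its expectation is an entry of a matrix product.\<close>

definition path_weight :: "(nat \<Rightarrow> real \<Rightarrow> real \<Rightarrow> complex) \<Rightarrow> nat \<Rightarrow> 'a \<Rightarrow> complex" where
  "path_weight G k \<omega> = of_bool (alive k \<omega>) * (\<Prod>j<k. G j (Y j \<omega>) (Y (Suc j) \<omega>))"

text \<open>Splitting by the previous state separates what is known before step k from a function of
  \<open>\<xi> k\<close> alone, the form required by \<open>expectation_past\<close>.\<close>

lemma path_weight_Suc_state:
  assumes k: "Suc k \<le> n" and y: "y \<in> A (Suc k)"
  shows "path_weight G (Suc k) \<omega> * of_bool (Y (Suc k) \<omega> = y)
    = (\<Sum>x\<in>A k. (path_weight G k \<omega> * of_bool (Y k \<omega> = x)) * (G k x y * of_bool (T k x (\<xi> k \<omega>) = y)))"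
proof (cases "alive k \<omega>")
  case True
  note fin = finite_A[of k]
  have Yk: "Y k \<omega> \<in> A k" by (rule alive_mem[OF True])
  have "(\<Sum>x\<in>A k. (path_weight G k \<omega> * of_bool (Y k \<omega> = x)) * (G k x y * of_bool (T k x (\<xi> k \<omega>) = y)))
    = (\<Sum>x\<in>A k. of_bool (Y k \<omega> = x) * (path_weight G k \<omega> * (G k x y * of_bool (T k x (\<xi> k \<omega>) = y))))"
    by (simp add: mult_ac)
  also have "\<dots> = path_weight G k \<omega> * (G k (Y k \<omega>) y * of_bool (T k (Y k \<omega>) (\<xi> k \<omega>) = y))"
    by (rule sum_over_state[symmetric]) (use fin k Yk in auto)
  also have "T k (Y k \<omega>) (\<xi> k \<omega>) = Y (Suc k) \<omega>" using Yk by simp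
  finally show ?thesis using True y by (auto simp: path_weight_def alive_Suc simp del: chain.simps)
next
  case False then show ?thesis by (simp add: path_weight_def alive_Suc)
qed

lemma indicator_integrable:
  assumes "k < n" "x \<in> A k"
  shows "integrable M (\<lambda>\<omega>. c * of_bool (T k x (\<xi> k \<omega>) = y) :: complex)"
    and "expectation (\<lambda>\<omega>. c * of_bool (T k x (\<xi> k \<omega>) = y) :: complex) = c * of_real (prob {\<omega> \<in> space M. T k x (\<xi> k \<omega>) = y})"
proof -
  have m: "(\<lambda>\<omega>. T k x (\<xi> k \<omega>)) \<in> borel_measurable M"
    using measurable_compose[OF rv T_measurable] assms by auto
  then have ev: "{\<omega> \<in> space M. T k x (\<xi> k \<omega>) = y} \<in> events" by measurable
  have eq: "of_bool (T k x (\<xi> k \<omega>) = y) = (indicator {\<omega> \<in> space M. T k x (\<xi> k \<omega>) = y} \<omega> :: complex)" if "\<omega> \<in> space M" for \<omega>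
    using that by (auto simp: indicator_def)
  have i: "integrable M (indicator {\<omega> \<in> space M. T k x (\<xi> k \<omega>) = y} :: 'a \<Rightarrow> complex)"
  proof (rule integrable_const_bound[where B = 1])
    show "AE \<omega> in M. norm (indicator {\<omega> \<in> space M. T k x (\<xi> k \<omega>) = y} \<omega> :: complex) \<le> 1"
      by (rule AE_I2) (simp add: indicator_def)
  qed (rule borel_measurable_indicator[OF ev])
  then have "integrable M (\<lambda>\<omega>. of_bool (T k x (\<xi> k \<omega>) = y) :: complex)"
    by (subst Bochner_Integration.integrable_cong[OF refl eq]) auto
  then show "integrable M (\<lambda>\<omega>. c * of_bool (T k x (\<xi> k \<omega>) = y) :: complex)" by simp
  have "expectation (\<lambda>\<omega>. of_bool (T k x (\<xi> k \<omega>) = y) :: complex) = expectation (indicator {\<omega> \<in> space M. T k x (\<xi> k \<omega>) = y})"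
    by (rule Bochner_Integration.integral_cong) (auto simp: eq)
  also have "\<dots> = of_real (prob {\<omega> \<in> space M. T k x (\<xi> k \<omega>) = y})"
  proof -
    have "expectation (indicator {\<omega> \<in> space M. T k x (\<xi> k \<omega>) = y} :: 'a \<Rightarrow> complex)
      = expectation (\<lambda>\<omega>. complex_of_real (indicator {\<omega> \<in> space M. T k x (\<xi> k \<omega>) = y} \<omega>))"
      by (rule Bochner_Integration.integral_cong) (auto simp: indicator_def)
    also have "\<dots> = complex_of_real (expectation (indicator {\<omega> \<in> space M. T k x (\<xi> k \<omega>) = y}))"
      by (rule integral_complex_of_real)
    also have "expectation (indicator {\<omega> \<in> space M. T k x (\<xi> k \<omega>) = y}) = prob {\<omega> \<in> space M. T k x (\<xi> k \<omega>) = y}"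
      using ev by simp
    finally show ?thesis .
  qed
  finally show "expectation (\<lambda>\<omega>. c * of_bool (T k x (\<xi> k \<omega>) = y) :: complex) = c * of_real (prob {\<omega> \<in> space M. T k x (\<xi> k \<omega>) = y})"
    by simp
qed

lemma path_weight_measurable:
  assumes "k \<le> n" shows "(\<lambda>\<omega>. path_weight G k \<omega> * of_bool (Y k \<omega> = x)) \<in> borel_measurable (past M \<xi> k)"
  using assms
proof (induction k arbitrary: x)
  case 0
  then show ?case
    by (simp add: path_weight_def alive_def measurable_const)
next
  case (Suc k)
  then have k: "k < n" "k \<le> n" by auto
  show ?case
  proof (cases "x \<in> A (Suc k)")
    case True
    have [measurable]: "(\<lambda>\<omega>. path_weight G k \<omega> * of_bool (Y k \<omega> = z)) \<in> borel_measurable (past M \<xi> (Suc k))" for z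
      using Suc.IH[OF k(2)] by (rule measurable_past_mono[rotated]) simp
    have [measurable]: "\<xi> k \<in> borel_measurable (past M \<xi> (Suc k))" by (rule measurable_past_component) simp
    have Tm: "(\<lambda>\<omega>. T k z (\<xi> k \<omega>)) \<in> borel_measurable (past M \<xi> (Suc k))" if "z \<in> A k" for z
      using measurable_compose[OF _ T_measurable[OF k(1) that]] by measurable
    have "(\<lambda>\<omega>. (path_weight G k \<omega> * of_bool (Y k \<omega> = z)) * (G k z x * of_bool (T k z (\<xi> k \<omega>) = x))) \<in> borel_measurable (past M \<xi> (Suc k))"
      if "z \<in> A k" for z
      using Tm[OF that] by measurable
    then show ?thesis
      unfolding path_weight_Suc_state[OF Suc.prems True] by (rule borel_measurable_sum)
  next
    case False
    then have z: "path_weight G (Suc k) \<omega> * of_bool (Y (Suc k) \<omega> = x) = 0" for \<omega>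
      by (auto simp: path_weight_def alive_Suc simp del: chain.simps)
    show ?thesis unfolding z by simp
  qed
qed

lemma path_weight_integrable_step:
  assumes k: "k < n" and I: "integrable M (\<lambda>\<omega>. path_weight G k \<omega> * of_bool (Y k \<omega> = x))" and x: "x \<in> A k"
  shows "integrable M (\<lambda>\<omega>. (path_weight G k \<omega> * of_bool (Y k \<omega> = x)) * (c * of_bool (T k x (\<xi> k \<omega>) = y)))"
    and "expectation (\<lambda>\<omega>. (path_weight G k \<omega> * of_bool (Y k \<omega> = x)) * (c * of_bool (T k x (\<xi> k \<omega>) = y)))
      = expectation (\<lambda>\<omega>. path_weight G k \<omega> * of_bool (Y k \<omega> = x)) * (c * of_real (prob {\<omega> \<in> space M. T k x (\<xi> k \<omega>) = y}))"
proof -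
  have [measurable]: "T k x \<in> borel_measurable borel" by (rule T_measurable[OF k x])
  have g: "(\<lambda>w. c * of_bool (T k x w = y)) \<in> borel_measurable borel" by measurable
  note e = expectation_past[OF indep k path_weight_measurable[OF less_imp_le[OF k], of G x] I g indicator_integrable(1)[OF k x, of c y]]
  show "integrable M (\<lambda>\<omega>. (path_weight G k \<omega> * of_bool (Y k \<omega> = x)) * (c * of_bool (T k x (\<xi> k \<omega>) = y)))" by (rule e(2))
  show "expectation (\<lambda>\<omega>. (path_weight G k \<omega> * of_bool (Y k \<omega> = x)) * (c * of_bool (T k x (\<xi> k \<omega>) = y)))
      = expectation (\<lambda>\<omega>. path_weight G k \<omega> * of_bool (Y k \<omega> = x)) * (c * of_real (prob {\<omega> \<in> space M. T k x (\<xi> k \<omega>) = y}))"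
    by (simp only: e(1) indicator_integrable(2)[OF k x])
qed

lemma path_weight_integrable:
  assumes "k \<le> n" shows "integrable M (\<lambda>\<omega>. path_weight G k \<omega> * of_bool (Y k \<omega> = x))"
  using assms
proof (induction k arbitrary: x)
  case 0
  then show ?case by (simp add: path_weight_def alive_def)
next
  case (Suc k)
  show ?case
  proof (cases "x \<in> A (Suc k)")
    case True
    have k: "k < n" "k \<le> n" using Suc.prems by auto
    show ?thesis
      unfolding path_weight_Suc_state[OF Suc.prems True]
      by (rule Bochner_Integration.integrable_sum) (rule path_weight_integrable_step(1)[OF k(1) Suc.IH[OF k(2)]])
  next
    case False
    then have z: "path_weight G (Suc k) \<omega> * of_bool (Y (Suc k) \<omega> = x) = 0" for \<omega>
      by (auto simp: path_weight_def alive_Suc simp del: chain.simps)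
    show ?thesis unfolding z by simp
  qed
qed

text \<open>The recursion of a product of matrices whose entries are G k x y times the probability
  of moving from x to y; \<open>matrix_approximation_eq\<close> identifies it with
  \<open>step_product\<close>.\<close>

lemma expectation_path_weight_Suc:
  assumes k: "k < n" and y: "y \<in> A (Suc k)"
  shows "expectation (\<lambda>\<omega>. path_weight G (Suc k) \<omega> * of_bool (Y (Suc k) \<omega> = y))
    = (\<Sum>x\<in>A k. expectation (\<lambda>\<omega>. path_weight G k \<omega> * of_bool (Y k \<omega> = x)) * (G k x y * of_real (prob {\<omega> \<in> space M. T k x (\<xi> k \<omega>) = y})))"
proof -
  note step = path_weight_integrable_step[OF k path_weight_integrable[OF less_imp_le[OF k]]]
  have "expectation (\<lambda>\<omega>. path_weight G (Suc k) \<omega> * of_bool (Y (Suc k) \<omega> = y)) =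
    (\<Sum>x\<in>A k. expectation (\<lambda>\<omega>. (path_weight G k \<omega> * of_bool (Y k \<omega> = x)) * (G k x y * of_bool (T k x (\<xi> k \<omega>) = y))))"
    unfolding path_weight_Suc_state[OF Suc_leI[OF k] y]
    by (rule Bochner_Integration.integral_sum) (rule step(1))
  also have "\<dots> = (\<Sum>x\<in>A k. expectation (\<lambda>\<omega>. path_weight G k \<omega> * of_bool (Y k \<omega> = x)) * (G k x y * of_real (prob {\<omega> \<in> space M. T k x (\<xi> k \<omega>) = y})))"
    by (rule sum.cong[OF refl]) (rule step(2))
  finally show ?thesis .
qed

section \<open>Exponential moments of the accumulated noise\<close>

definition noise :: "(nat \<Rightarrow> real \<Rightarrow> real \<Rightarrow> real) \<Rightarrow> nat \<Rightarrow> 'a \<Rightarrow> real" where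
  "noise R k \<omega> = (\<Sum>j<k. if alive j \<omega> then R j (Y j \<omega>) (\<xi> j \<omega>) else 0)"

context
  fixes R :: "nat \<Rightarrow> real \<Rightarrow> real \<Rightarrow> real" and b e :: real
  assumes R_measurable: "\<And>k x. k < n \<Longrightarrow> x \<in> A k \<Longrightarrow> R k x \<in> borel_measurable borel"
    and R_bound: "\<And>k x w. k < n \<Longrightarrow> x \<in> A k \<Longrightarrow> \<bar>R k x w\<bar> \<le> b"
    and R_mean: "\<And>k x. k < n \<Longrightarrow> x \<in> A k \<Longrightarrow> \<bar>expectation (\<lambda>\<omega>. R k x (\<xi> k \<omega>))\<bar> \<le> e"
    and b0: "0 \<le> b" and e0: "0 \<le> e"
begin

lemma noise_bound: "k \<le> n \<Longrightarrow> \<bar>noise R k \<omega>\<bar> \<le> real k * b"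
proof -
  assume k: "k \<le> n"
  have "\<bar>noise R k \<omega>\<bar> \<le> (\<Sum>j<k. \<bar>if alive j \<omega> then R j (Y j \<omega>) (\<xi> j \<omega>) else 0\<bar>)"
    unfolding noise_def by (rule sum_abs)
  also have "\<dots> \<le> (\<Sum>j<k. b)"
    by (rule sum_mono) (use k b0 alive_mem R_bound in auto)
  finally show ?thesis by simp
qed

lemma noise_Suc_state:
  assumes k: "k < n"
  shows "f (noise R (Suc k) \<omega>) = f (noise R k \<omega>) * of_bool (\<not> alive k \<omega>)
    + (\<Sum>x\<in>A k. of_bool (alive k \<omega> \<and> Y k \<omega> = x) * f (noise R k \<omega> + R k x (\<xi> k \<omega>)) :: real)"
proof (cases "alive k \<omega>")
  case True
  then show ?thesis
    using sum_over_state[of "A k" "Y k \<omega>" "\<lambda>x. f (noise R k \<omega> + R k x (\<xi> k \<omega>))"] finite_A[of k] k alive_mem[OF True]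
    by (simp add: noise_def)
next
  case False then show ?thesis by (simp add: noise_def)
qed

lemma noise_measurable: "k \<le> n \<Longrightarrow> noise R k \<in> borel_measurable (past M \<xi> k)"
proof (induction k)
  case 0 then show ?case by (simp add: noise_def[abs_def] measurable_const)
next
  case (Suc k)
  then have k: "k < n" "k \<le> n" by auto
  have [measurable]: "noise R k \<in> borel_measurable (past M \<xi> (Suc k))"
    using Suc.IH[OF k(2)] by (rule measurable_past_mono[rotated]) simp
  have [measurable]: "Y k \<in> borel_measurable (past M \<xi> (Suc k))"
    using Y_measurable[OF k(2)] by (rule measurable_past_mono[rotated]) simp
  have [measurable]: "Measurable.pred (past M \<xi> (Suc k)) (alive k)"
    using alive_measurable[OF k(2)] by (rule measurable_past_mono[rotated]) simp
  have [measurable]: "\<xi> k \<in> borel_measurable (past M \<xi> (Suc k))" by (rule measurable_past_component) simp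
  have Rm: "(\<lambda>\<omega>. R k x (\<xi> k \<omega>)) \<in> borel_measurable (past M \<xi> (Suc k))" if "x \<in> A k" for x
    using measurable_compose[OF _ R_measurable[OF k(1) that]] by measurable
  show ?case
    unfolding noise_Suc_state[OF k(1), where f = "\<lambda>x. x"]
    by (intro borel_measurable_add borel_measurable_sum borel_measurable_times Rm) measurable
qed

text \<open>At each fixed state, exp z <= 1 + z + z^2 for |z| <= 1 turns the bound \<open>b\<close>
  and the mean bound \<open>e\<close> into a factor 1 + |l| e + (l b)^2, and independence of the
  next variable multiplies these factors. The noise is not a martingale, its conditional means being
  only small; this costs the term |l| e.\<close>

lemma noise_mgf:
  assumes lb: "\<bar>l\<bar> * b \<le> 1"
  shows "k \<le> n \<Longrightarrow> expectation (\<lambda>\<omega>. exp (l * noise R k \<omega>)) \<le> (1 + \<bar>l\<bar> * e + (l * b)\<^sup>2) ^ k"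
proof (induction k)
  case 0 then show ?case by (simp add: noise_def prob_space)
next
  case (Suc k)
  then have k: "k < n" "k \<le> n" by auto
  let ?c = "1 + \<bar>l\<bar> * e + (l * b)\<^sup>2"
  have c1: "1 \<le> ?c" using e0 by simp
  let ?D = "\<lambda>\<omega>. exp (l * noise R k \<omega>) * of_bool (\<not> alive k \<omega>)"
  let ?S = "\<lambda>x \<omega>. exp (l * noise R k \<omega>) * of_bool (alive k \<omega> \<and> Y k \<omega> = x)"
  note [measurable] = noise_measurable[OF k(2)] Y_measurable[OF k(2)] alive_measurable[OF k(2)]
  have mM: "f \<in> borel_measurable M" if "f \<in> borel_measurable (past M \<xi> k)" for f :: "'a \<Rightarrow> real"
    by (rule measurable_past_imp_measurable[OF rv that]) (use k in auto)
  have eb: "exp (l * noise R k \<omega>) \<le> exp (\<bar>l\<bar> * (real k * b))" for \<omega>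
  proof -
    have "l * noise R k \<omega> \<le> \<bar>l\<bar> * \<bar>noise R k \<omega>\<bar>" by (metis abs_ge_self abs_mult)
    also have "\<dots> \<le> \<bar>l\<bar> * (real k * b)" using noise_bound[OF k(2), of \<omega>] by (intro mult_left_mono) auto
    finally show ?thesis by simp
  qed
  have Sm: "?S x \<in> borel_measurable (past M \<xi> k)" for x by measurable
  have Dm: "?D \<in> borel_measurable (past M \<xi> k)" by measurable
  have SI: "integrable M (?S x)" for x
    by (rule integrable_const_bound[where B = "exp (\<bar>l\<bar> * (real k * b))"]) (use eb mM[OF Sm] in auto)
  have DI: "integrable M ?D"
    by (rule integrable_const_bound[where B = "exp (\<bar>l\<bar> * (real k * b))"]) (use eb mM[OF Dm] in auto)
  have gm: "(\<lambda>w. exp (l * R k x w)) \<in> borel_measurable borel" if "x \<in> A k" for x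
    using R_measurable[OF k(1) that] by measurable
  have RI: "integrable M (\<lambda>\<omega>. R k x (\<xi> k \<omega>))" if "x \<in> A k" for x
    by (rule integrable_const_bound[where B = b])
      (use R_bound[OF k(1) that] measurable_compose[OF rv[OF k(1)] R_measurable[OF k(1) that]] in auto)
  have lR: "\<bar>l * R k x w\<bar> \<le> \<bar>l\<bar> * b" if "x \<in> A k" for x w
    using R_bound[OF k(1) that, of w] by (simp add: abs_mult mult_left_mono)
  have gb: "exp (l * R k x w) \<le> 1 + l * R k x w + (l * b)\<^sup>2" if x: "x \<in> A k" for x w
  proof -
    let ?z = "l * R k x w"
    have z1: "\<bar>?z\<bar> \<le> 1" using lR[OF x, of w] lb by linarith
    have "exp ?z \<le> 1 + ?z + ?z\<^sup>2"
    proof (cases "0 \<le> ?z")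
      case True then show ?thesis using z1 by (intro exp_bound) auto
    next
      case False
      have "exp ?z = 1 / exp (- ?z)" by (simp add: exp_minus inverse_eq_divide)
      also have "\<dots> \<le> 1 / (1 + (- ?z))" using False exp_ge_add_one_self[of "- ?z"] by (intro divide_left_mono) auto
      also have "\<dots> \<le> 1 + ?z + ?z\<^sup>2"
      proof -
        \<comment> \<open>The product telescopes to 1 - z^3, which is at least 1 for negative
          z.\<close>
        have "1 \<le> (1 + ?z + ?z\<^sup>2) * (1 + (- ?z))"
        proof -
          have "(1 + ?z + ?z\<^sup>2) * (1 + (- ?z)) = 1 + (- ?z) * ?z\<^sup>2" by (simp add: algebra_simps power2_eq_square)
          moreover have "0 \<le> (- ?z) * ?z\<^sup>2" using False by (intro mult_nonneg_nonneg) auto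
          ultimately show ?thesis by linarith
        qed
        then show ?thesis using False by (subst pos_divide_le_eq) auto
      qed
      finally show ?thesis .
    qed
    moreover have "?z\<^sup>2 \<le> (l * b)\<^sup>2"
    proof -
      have "\<bar>?z\<bar> \<le> \<bar>l * b\<bar>" using lR[OF x, of w] b0 by (simp add: abs_mult)
      then show ?thesis by (simp only: abs_le_square_iff)
    qed
    ultimately show ?thesis by linarith
  qed
  have gI: "integrable M (\<lambda>\<omega>. exp (l * R k x (\<xi> k \<omega>)))" if x: "x \<in> A k" for x
  proof (rule integrable_const_bound[where B = "exp 1"])
    show "AE \<omega> in M. norm (exp (l * R k x (\<xi> k \<omega>))) \<le> exp 1"
    proof (rule AE_I2)
      fix \<omega>
      show "norm (exp (l * R k x (\<xi> k \<omega>))) \<le> exp 1"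
        using lR[OF x, of "\<xi> k \<omega>"] lb by simp
    qed
    show "(\<lambda>\<omega>. exp (l * R k x (\<xi> k \<omega>))) \<in> borel_measurable M"
      using measurable_compose[OF rv[OF k(1)] gm[OF x]] .
  qed
  have gE: "expectation (\<lambda>\<omega>. exp (l * R k x (\<xi> k \<omega>))) \<le> ?c" if x: "x \<in> A k" for x
  proof -
    have "expectation (\<lambda>\<omega>. exp (l * R k x (\<xi> k \<omega>))) \<le> expectation (\<lambda>\<omega>. (1 + (l * b)\<^sup>2) + l * R k x (\<xi> k \<omega>))"
    proof (rule integral_mono[OF gI[OF x]])
      show "integrable M (\<lambda>\<omega>. (1 + (l * b)\<^sup>2) + l * R k x (\<xi> k \<omega>))" using RI[OF x] by auto
      show "exp (l * R k x (\<xi> k \<omega>)) \<le> (1 + (l * b)\<^sup>2) + l * R k x (\<xi> k \<omega>)" for \<omega>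
        using gb[OF x, of "\<xi> k \<omega>"] by linarith
    qed
    also have "\<dots> = (1 + (l * b)\<^sup>2) + l * expectation (\<lambda>\<omega>. R k x (\<xi> k \<omega>))"
      using RI[OF x] by (simp add: prob_space)
    also have "l * expectation (\<lambda>\<omega>. R k x (\<xi> k \<omega>)) \<le> \<bar>l\<bar> * e"
    proof -
      have "l * expectation (\<lambda>\<omega>. R k x (\<xi> k \<omega>)) \<le> \<bar>l\<bar> * \<bar>expectation (\<lambda>\<omega>. R k x (\<xi> k \<omega>))\<bar>"
        by (metis abs_ge_self abs_mult)
      also have "\<dots> \<le> \<bar>l\<bar> * e" using R_mean[OF k(1) x] by (intro mult_left_mono) auto
      finally show ?thesis .
    qed
    finally show ?thesis by simp
  qed
  have eq: "exp (l * noise R (Suc k) \<omega>) = ?D \<omega> + (\<Sum>x\<in>A k. ?S x \<omega> * exp (l * R k x (\<xi> k \<omega>)))" for \<omega>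
    using noise_Suc_state[OF k(1), where f = "\<lambda>z. exp (l * z)" and \<omega> = \<omega>]
    by (simp add: distrib_left exp_add mult_ac)
  have "expectation (\<lambda>\<omega>. exp (l * noise R (Suc k) \<omega>)) = expectation ?D + (\<Sum>x\<in>A k. expectation (\<lambda>\<omega>. ?S x \<omega> * exp (l * R k x (\<xi> k \<omega>))))"
    unfolding eq
    by (subst Bochner_Integration.integral_add)
      (auto intro!: DI Bochner_Integration.integrable_sum Bochner_Integration.integral_sum expectation_past(2)[OF indep k(1) Sm SI gm gI])
  also have "\<dots> = expectation ?D + (\<Sum>x\<in>A k. expectation (?S x) * expectation (\<lambda>\<omega>. exp (l * R k x (\<xi> k \<omega>))))"
    by (intro arg_cong2[where f = "(+)"] refl sum.cong expectation_past(1)[OF indep k(1) Sm SI gm gI])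
  \<comment> \<open>On dead paths the noise does not change, a factor of 1; enlarging it to
    \<open>?c\<close> lets both parts recombine into the moment at time k.\<close>
  also have "\<dots> \<le> expectation ?D * ?c + (\<Sum>x\<in>A k. expectation (?S x) * ?c)"
  proof (rule add_mono)
    have "0 \<le> expectation ?D" by (rule Bochner_Integration.integral_nonneg) auto
    then show "expectation ?D \<le> expectation ?D * ?c" using c1 mult_left_mono[OF c1] by fastforce
    show "(\<Sum>x\<in>A k. expectation (?S x) * expectation (\<lambda>\<omega>. exp (l * R k x (\<xi> k \<omega>)))) \<le> (\<Sum>x\<in>A k. expectation (?S x) * ?c)"
      by (intro sum_mono mult_left_mono gE Bochner_Integration.integral_nonneg) auto
  qed
  also have "\<dots> = (expectation ?D + (\<Sum>x\<in>A k. expectation (?S x))) * ?c"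
    by (simp add: distrib_right sum_distrib_right)
  also have "expectation ?D + (\<Sum>x\<in>A k. expectation (?S x)) = expectation (\<lambda>\<omega>. ?D \<omega> + (\<Sum>x\<in>A k. ?S x \<omega>))"
    by (subst Bochner_Integration.integral_add) (auto intro!: DI SI Bochner_Integration.integrable_sum Bochner_Integration.integral_sum[symmetric])
  also have "\<dots> = expectation (\<lambda>\<omega>. exp (l * noise R k \<omega>))"
  proof (rule Bochner_Integration.integral_cong[OF refl])
    fix \<omega>
    have "(\<Sum>x\<in>A k. ?S x \<omega>) = exp (l * noise R k \<omega>) * of_bool (alive k \<omega>)"
    proof (cases "alive k \<omega>")
      case True
      then show ?thesis using sum_over_state[of "A k" "Y k \<omega>" "\<lambda>_. exp (l * noise R k \<omega>)"] finite_A[OF k(2)] alive_mem[OF True]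
        by (simp add: mult.commute)
    qed simp
    then show "?D \<omega> + (\<Sum>x\<in>A k. ?S x \<omega>) = exp (l * noise R k \<omega>)" by simp
  qed
  also have "\<dots> * ?c \<le> ?c ^ k * ?c" using Suc.IH[OF k(2)] c1 by (intro mult_right_mono) auto
  finally show ?case by (simp add: mult.commute)
qed

end

end

section \<open>Euler schemes for the diffusion\<close>

text \<open>The recursion is summed before absolute values are taken, so \<open>rho\<close> enters
  only through its partial sums and keeps its cancellation. What remains is a discrete Gronwall
  inequality, closed by the geometric sum.\<close>

lemma euler_error:
  fixes x y :: "nat \<Rightarrow> real"
  assumes y: "\<And>j. j < k \<Longrightarrow> y (Suc j) = y j + d j * \<Delta> + dw j + rho j"
    and x: "\<And>j. j < k \<Longrightarrow> \<bar>x (Suc j) - (x j + c j * \<Delta> + dw j)\<bar> \<le> e * \<Delta>"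
    and dc: "\<And>j. j < k \<Longrightarrow> \<bar>d j - c j\<bar> \<le> K * \<bar>y j - x j\<bar>"
    and rho: "\<And>i. i \<le> k \<Longrightarrow> \<bar>\<Sum>j<i. rho j\<bar> \<le> \<epsilon>"
    and e0: "\<bar>y 0 - x 0\<bar> \<le> e0" and pos: "0 \<le> K" "0 \<le> \<Delta>" "0 \<le> e"
  shows "i \<le> k \<Longrightarrow> \<bar>y i - x i\<bar> \<le> (e0 + \<epsilon> + e * (real k * \<Delta>)) * (1 + K * \<Delta>) ^ i"
proof -
  let ?E = "e0 + \<epsilon> + e * (real k * \<Delta>)"
  have E0: "0 \<le> ?E" using e0 rho[of 0] pos by (intro add_nonneg_nonneg) auto
  have dev: "y i - x i = (y 0 - x 0) + (\<Sum>j<i. (d j - c j) * \<Delta>) + (\<Sum>j<i. rho j) - (\<Sum>j<i. x (Suc j) - (x j + c j * \<Delta> + dw j))" if "i \<le> k" for i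
    using that
  proof (induction i)
    case (Suc i)
    then show ?case using y[of i] by (simp add: algebra_simps)
  qed simp
  have step: "\<bar>y i - x i\<bar> \<le> ?E + K * \<Delta> * (\<Sum>j<i. \<bar>y j - x j\<bar>)" if i: "i \<le> k" for i
  proof -
    have "\<bar>\<Sum>j<i. (d j - c j) * \<Delta>\<bar> \<le> (\<Sum>j<i. \<bar>(d j - c j) * \<Delta>\<bar>)" by (rule sum_abs)
    also have "\<dots> \<le> (\<Sum>j<i. K * \<bar>y j - x j\<bar> * \<Delta>)"
      using dc i pos by (intro sum_mono) (simp add: abs_mult mult_right_mono)
    finally have 1: "\<bar>\<Sum>j<i. (d j - c j) * \<Delta>\<bar> \<le> K * \<Delta> * (\<Sum>j<i. \<bar>y j - x j\<bar>)"
      by (simp add: sum_distrib_left mult_ac)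
    have "\<bar>\<Sum>j<i. x (Suc j) - (x j + c j * \<Delta> + dw j)\<bar> \<le> (\<Sum>j<i. \<bar>x (Suc j) - (x j + c j * \<Delta> + dw j)\<bar>)" by (rule sum_abs)
    also have "\<dots> \<le> (\<Sum>j<i. e * \<Delta>)" using x i by (intro sum_mono) auto
    also have "\<dots> \<le> e * (real k * \<Delta>)" using i pos by (simp add: mult_left_mono mult_right_mono mult.left_commute)
    finally have 2: "\<bar>\<Sum>j<i. x (Suc j) - (x j + c j * \<Delta> + dw j)\<bar> \<le> e * (real k * \<Delta>)" .
    show ?thesis using 1 2 rho[OF i] e0 unfolding dev[OF i] by linarith
  qed
  have geo: "K * \<Delta> * (\<Sum>j<i. (1 + K * \<Delta>) ^ j) = (1 + K * \<Delta>) ^ i - 1" for i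
    by (induction i) (auto simp: algebra_simps)
  show "i \<le> k \<Longrightarrow> \<bar>y i - x i\<bar> \<le> ?E * (1 + K * \<Delta>) ^ i"
  proof (induction i rule: less_induct)
    case (less i)
    have "\<bar>y i - x i\<bar> \<le> ?E + K * \<Delta> * (\<Sum>j<i. \<bar>y j - x j\<bar>)" by (rule step[OF less.prems])
    also have "\<dots> \<le> ?E + K * \<Delta> * (\<Sum>j<i. ?E * (1 + K * \<Delta>) ^ j)"
      using less pos by (intro add_left_mono mult_left_mono sum_mono) auto
    also have "\<dots> = ?E + ?E * (K * \<Delta> * (\<Sum>j<i. (1 + K * \<Delta>) ^ j))"
      by (simp add: sum_distrib_left mult_ac)
    also have "\<dots> = ?E * (1 + K * \<Delta>) ^ i" unfolding geo by (simp add: algebra_simps)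
    finally show ?case .
  qed
qed

lemma one_plus_power_le_exp:
  assumes "0 \<le> z" "real i * z \<le> c" shows "(1 + z) ^ i \<le> exp (c::real)"
proof -
  have "(1 + z) ^ i \<le> exp z ^ i" using assms by (intro power_mono exp_ge_add_one_self) auto
  also have "\<dots> = exp (real i * z)" by (simp add: exp_of_nat_mult)
  finally show ?thesis using assms(2) by (simp add: order.trans)
qed

lemma set_integral_Icc_refl: "(LINT s:{a..a}|lborel. f s) = (0::real)" for a :: real
  using set_borel_integral_eq_integral(2)[OF borel_integrable_atLeastAtMost'[of a a f]] by simp

section \<open>Local drift bounds and the distance between chain and diffusion\<close>

locale smooth_drift =
  fixes mu :: "real \<Rightarrow> real \<Rightarrow> real"
  assumes mu_t: "\<And>x. C1_on_unit_interval (\<lambda>t. mu t x)"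
    and mu_x: "\<And>t. t \<in> {0..1} \<Longrightarrow> C2_on_real (mu t)"
    and mu_bound: "\<And>r. r > 0 \<Longrightarrow> \<exists>K. \<forall>t\<in>{0..1}. \<forall>x. \<bar>x\<bar> \<le> r \<longrightarrow>
      \<bar>mu t x\<bar> + \<bar>partial_t mu t x\<bar> + \<bar>partial_x mu t x\<bar> + \<bar>partial_xx mu t x\<bar> \<le> K"
begin

definition drift_bound :: "real \<Rightarrow> real \<Rightarrow> bool" where
  "drift_bound K r \<longleftrightarrow> 0 \<le> K \<and>
    (\<forall>t\<in>{0..1}. \<forall>x. \<bar>x\<bar> \<le> r \<longrightarrow> \<bar>mu t x\<bar> \<le> K \<and> \<bar>partial_x mu t x\<bar> \<le> K \<and>
      \<bar>partial_t mu t x + mu t x * partial_x mu t x + 1/2 * partial_xx mu t x\<bar> \<le> K) \<and>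
    (\<forall>s\<in>{0..1}. \<forall>t\<in>{0..1}. \<forall>x y. \<bar>x\<bar> \<le> r \<longrightarrow> \<bar>y\<bar> \<le> r \<longrightarrow> \<bar>mu t x - mu s y\<bar> \<le> K * (\<bar>t - s\<bar> + \<bar>x - y\<bar>))"

text \<open>The mean value inequality in t on [0, 1] and in x on [-r, r] gives the joint Lipschitz
  bound by moving one coordinate at a time. In the constant 2K + K^2 the square comes from the
  product of the drift with its x-derivative.\<close>

lemma drift_bound_exists:
  assumes r: "0 < r" shows "\<exists>K. drift_bound K r"
proof -
  obtain K where K: "\<And>t x. t \<in> {0..1} \<Longrightarrow> \<bar>x\<bar> \<le> r \<Longrightarrow>
      \<bar>mu t x\<bar> + \<bar>partial_t mu t x\<bar> + \<bar>partial_x mu t x\<bar> + \<bar>partial_xx mu t x\<bar> \<le> K"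
    using mu_bound[OF r] by blast
  have K0: "0 \<le> K" using K[of 0 0] r by simp
  have bd: "\<bar>mu t x\<bar> \<le> K" "\<bar>partial_t mu t x\<bar> \<le> K" "\<bar>partial_x mu t x\<bar> \<le> K" "\<bar>partial_xx mu t x\<bar> \<le> K"
    if "t \<in> {0..1}" "\<bar>x\<bar> \<le> r" for t x
    using K[OF that] by linarith+
  have lt: "\<bar>mu t x - mu s x\<bar> \<le> K * \<bar>t - s\<bar>" if st: "s \<in> {0..1}" "t \<in> {0..1}" and x: "\<bar>x\<bar> \<le> r" for s t x
  proof -
    obtain f' where f': "\<And>t. t \<in> {0..1} \<Longrightarrow> ((\<lambda>t. mu t x) has_real_derivative f' t) (at t within {0..1})"
      using mu_t[of x] unfolding C1_on_unit_interval_def by blast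
    have "f' t = partial_t mu t x" if "t \<in> {0..1}" for t
      using vector_derivative_within_closed_interval[of 0 1 t "\<lambda>t. mu t x" "f' t"] f'[OF that] that
      by (simp add: partial_t_def has_real_derivative_iff_has_vector_derivative)
    then have b: "norm (f' t) \<le> K" if "t \<in> {0..1}" for t using bd(2)[OF that x] that by simp
    have "norm (mu t x - mu s x) \<le> K * norm (t - s)"
      by (rule field_differentiable_bound[of "{0..1}" _ f']) (use f' b st in auto)
    then show ?thesis by simp
  qed
  have lx: "\<bar>mu t x - mu t y\<bar> \<le> K * \<bar>x - y\<bar>" if t: "t \<in> {0..1}" and xy: "\<bar>x\<bar> \<le> r" "\<bar>y\<bar> \<le> r" for t x y
  proof -
    obtain f' where f': "\<And>x. (mu t has_real_derivative f' x) (at x)"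
      using mu_x[OF t] unfolding C2_on_real_def by blast
    have "f' x = partial_x mu t x" for x using DERIV_imp_deriv[OF f'] by (simp add: partial_x_def)
    then have b: "norm (f' x) \<le> K" if "x \<in> {-r..r}" for x using bd(3)[OF t, of x] that by auto
    have "norm (mu t x - mu t y) \<le> K * norm (x - y)"
      by (rule field_differentiable_bound[of "{-r..r}" _ f'])
        (use f' b xy in \<open>auto intro: has_field_derivative_at_within\<close>)
    then show ?thesis by simp
  qed
  have "drift_bound (2 * K + K * K) r"
    unfolding drift_bound_def
  proof (intro conjI ballI allI impI)
    show "0 \<le> 2 * K + K * K" using K0 by simp
    have KK: "0 \<le> K * K" using K0 by simp
    fix t x assume tx: "t \<in> {0..1::real}" "\<bar>x\<bar> \<le> r"
    show "\<bar>mu t x\<bar> \<le> 2 * K + K * K" "\<bar>partial_x mu t x\<bar> \<le> 2 * K + K * K"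
      using bd[OF tx] K0 KK by linarith+
    have "\<bar>mu t x * partial_x mu t x\<bar> \<le> K * K" using bd[OF tx] K0 by (auto simp: abs_mult intro!: mult_mono)
    then show "\<bar>partial_t mu t x + mu t x * partial_x mu t x + 1/2 * partial_xx mu t x\<bar> \<le> 2 * K + K * K"
      using bd(2,4)[OF tx] by linarith
  next
    fix s t x y assume st: "s \<in> {0..1::real}" "t \<in> {0..1::real}" and xy: "\<bar>x\<bar> \<le> r" "\<bar>y\<bar> \<le> r"
    have "\<bar>mu t x - mu s y\<bar> \<le> K * \<bar>t - s\<bar> + K * \<bar>x - y\<bar>"
      using lt[OF st(1,2) xy(2)] lx[OF st(2) xy] by linarith
    also have "\<dots> = K * (\<bar>t - s\<bar> + \<bar>x - y\<bar>)" by (simp add: algebra_simps)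
    also have "\<dots> \<le> (2 * K + K * K) * (\<bar>t - s\<bar> + \<bar>x - y\<bar>)"
      using K0 by (intro mult_right_mono) auto
    finally show "\<bar>mu t x - mu s y\<bar> \<le> (2 * K + K * K) * (\<bar>t - s\<bar> + \<bar>x - y\<bar>)" .
  qed
  then show ?thesis by blast
qed

lemma drift_boundD:
  assumes "drift_bound K r"
  shows "0 \<le> K" "t \<in> {0..1} \<Longrightarrow> \<bar>x\<bar> \<le> r \<Longrightarrow> \<bar>mu t x\<bar> \<le> K" "t \<in> {0..1} \<Longrightarrow> \<bar>x\<bar> \<le> r \<Longrightarrow> \<bar>partial_x mu t x\<bar> \<le> K"
    "t \<in> {0..1} \<Longrightarrow> \<bar>x\<bar> \<le> r \<Longrightarrow> \<bar>partial_t mu t x + mu t x * partial_x mu t x + 1/2 * partial_xx mu t x\<bar> \<le> K"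
    "s \<in> {0..1} \<Longrightarrow> t \<in> {0..1} \<Longrightarrow> \<bar>x\<bar> \<le> r \<Longrightarrow> \<bar>y\<bar> \<le> r \<Longrightarrow> \<bar>mu t x - mu s y\<bar> \<le> K * (\<bar>t - s\<bar> + \<bar>x - y\<bar>)"
  using assms by (auto simp: drift_bound_def)

text \<open>The Lipschitz bound makes the drift along the path continuous, so its integral splits at
  s. Freezing the drift at s gives the Euler error; dropping it altogether gives the cruder second
  bound, meant for one long step.\<close>

lemma path_increment:
  assumes db: "drift_bound K r"
    and xc: "continuous_on {0..1} x" and xr: "\<And>t. t \<in> {0..1} \<Longrightarrow> \<bar>x t\<bar> \<le> r"
    and eq: "\<And>t. t \<in> {0..1} \<Longrightarrow> x t = x0 + (LINT s:{0..t}|lborel. mu s (x s)) + w t"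
    and osc: "\<And>s t. s \<in> {0..1} \<Longrightarrow> t \<in> {0..1} \<Longrightarrow> \<bar>s - t\<bar> \<le> \<Delta> \<Longrightarrow> \<bar>x s - x t\<bar> \<le> om"
    and st: "0 \<le> s" "s \<le> t" "t \<le> 1" "t - s \<le> \<Delta>"
  shows "\<bar>x t - (x s + mu s (x s) * (t - s) + (w t - w s))\<bar> \<le> K * (\<Delta> + om) * (t - s)"
    and "\<bar>x t - (x s + (w t - w s))\<bar> \<le> K * (t - s)"
proof -
  note D = drift_boundD[OF db]
  have mc: "continuous_on {0..1} (\<lambda>u. mu u (x u))"
    unfolding continuous_on_iff
  proof (intro ballI allI impI)
    fix u e :: real assume u: "u \<in> {0..1}" and e: "0 < e"
    obtain d where d: "0 < d" "\<And>v. v \<in> {0..1} \<Longrightarrow> dist v u < d \<Longrightarrow> dist (x v) (x u) < e / (2 * (K + 1))"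
      using xc[unfolded continuous_on_iff, rule_format, OF u, of "e / (2 * (K + 1))"] e D(1) by auto
    show "\<exists>d>0. \<forall>v\<in>{0..1}. dist v u < d \<longrightarrow> dist (mu v (x v)) (mu u (x u)) < e"
    proof (intro exI[of _ "min d (e / (2 * (K + 1)))"] conjI ballI impI)
      show "0 < min d (e / (2 * (K + 1)))" using d e D(1) by simp
      fix v assume v: "v \<in> {0..1}" "dist v u < min d (e / (2 * (K + 1)))"
      have "dist (mu v (x v)) (mu u (x u)) \<le> K * (\<bar>v - u\<bar> + \<bar>x v - x u\<bar>)"
        using D(5)[OF u v(1) xr[OF v(1)] xr[OF u]] by (simp add: dist_real_def)
      also have "\<dots> \<le> (K + 1) * (\<bar>v - u\<bar> + \<bar>x v - x u\<bar>)" by (intro mult_right_mono) auto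
      also have "\<dots> < (K + 1) * (e / (2 * (K + 1)) + e / (2 * (K + 1)))"
        using d(2)[OF v(1)] v D(1) by (intro mult_strict_left_mono add_strict_mono) (auto simp: dist_real_def)
      also have "\<dots> = e"
      proof -
        have *: "c * (e / (2 * c) + e / (2 * c)) = e" if "0 < c" for c :: real using that by (simp add: field_simps)
        show ?thesis by (rule *) (use D(1) in simp)
      qed
      finally show "dist (mu v (x v)) (mu u (x u)) < e" .
    qed
  qed
  have I: "(LINT s:{0..t}|lborel. mu s (x s)) = integral {0..t} (\<lambda>u. mu u (x u))" if "t \<in> {0..1}" for t
    by (rule set_borel_integral_eq_integral(2)[OF borel_integrable_atLeastAtMost'])
      (use mc that in \<open>auto intro: continuous_on_subset\<close>)
  have t01: "s \<in> {0..1}" "t \<in> {0..1}" using st by auto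
  have mct: "continuous_on {s..t} (\<lambda>u. mu u (x u))" by (rule continuous_on_subset[OF mc]) (use st in auto)
  have "integral {0..s} (\<lambda>u. mu u (x u)) + integral {s..t} (\<lambda>u. mu u (x u)) = integral {0..t} (\<lambda>u. mu u (x u))"
    by (rule Henstock_Kurzweil_Integration.integral_combine)
      (use st in \<open>auto intro!: integrable_continuous_real continuous_on_subset[OF mc]\<close>)
  then have inc: "x t = x s + integral {s..t} (\<lambda>u. mu u (x u)) + (w t - w s)"
    using eq[OF t01(1)] eq[OF t01(2)] I[OF t01(1)] I[OF t01(2)] by simp
  have "norm (integral {s..t} (\<lambda>u. mu u (x u))) \<le> K * (t - s)"
    by (rule integral_bound[OF st(2) mct]) (use D(2) xr st in auto)
  then show "\<bar>x t - (x s + (w t - w s))\<bar> \<le> K * (t - s)" using inc by simp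
  have "norm (integral {s..t} (\<lambda>u. mu u (x u) - mu s (x s))) \<le> (K * (\<Delta> + om)) * (t - s)"
  proof (rule integral_bound[OF st(2)])
    show "continuous_on {s..t} (\<lambda>u. mu u (x u) - mu s (x s))" by (intro continuous_intros mct)
    fix u assume u: "u \<in> {s..t}"
    then have u01: "u \<in> {0..1}" using st by auto
    have "\<bar>mu u (x u) - mu s (x s)\<bar> \<le> K * (\<bar>u - s\<bar> + \<bar>x u - x s\<bar>)"
      by (rule D(5)[OF t01(1) u01 xr[OF u01] xr[OF t01(1)]])
    also have "\<dots> \<le> K * (\<Delta> + om)"
      using osc[OF u01 t01(1)] u st D(1) by (intro mult_left_mono add_mono) auto
    finally show "norm (mu u (x u) - mu s (x s)) \<le> K * (\<Delta> + om)" by simp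
  qed
  also have "integral {s..t} (\<lambda>u. mu u (x u) - mu s (x s)) = integral {s..t} (\<lambda>u. mu u (x u)) - mu s (x s) * (t - s)"
    using st by (subst Henstock_Kurzweil_Integration.integral_diff) (auto intro!: integrable_continuous_real mct)
  finally show "\<bar>x t - (x s + mu s (x s) * (t - s) + (w t - w s))\<bar> \<le> K * (\<Delta> + om) * (t - s)"
    using inc by (simp add: algebra_simps)
qed

text \<open>The second-order drift terms and the deviation of the slope from 1 are moved into a
  modified noise \<open>rho'\<close>; per step they are at most \<Delta> K (\<Delta> + om)/2, hence
  small in total, and \<open>euler_error\<close> applies. States have to lie in the strip only
  before time k, so the state in which the chain leaves it is covered as well.\<close>

lemma chain_error:
  assumes db: "drift_bound K r" and n: "0 < n" and k: "k \<le> n"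
    and xc: "continuous_on {0..1} x" and xr: "\<And>t. t \<in> {0..1} \<Longrightarrow> \<bar>x t\<bar> \<le> r"
    and eq: "\<And>t. t \<in> {0..1} \<Longrightarrow> x t = x0 + (LINT s:{0..t}|lborel. mu s (x s)) + w t"
    and w0: "w 0 = 0"
    and osc: "\<And>s t. s \<in> {0..1} \<Longrightarrow> t \<in> {0..1} \<Longrightarrow> \<bar>s - t\<bar> \<le> 1 / real n \<Longrightarrow> \<bar>x s - x t\<bar> \<le> om \<and> \<bar>w s - w t\<bar> \<le> om"
    and y0: "y 0 = x0" and yr: "\<And>j. j < k \<Longrightarrow> \<bar>y j\<bar> \<le> r"
    and y: "\<And>j. j < k \<Longrightarrow> y (Suc j) = y j + discrete_drift mu n (Suc j) (y j)
        + (1 + 1/2 * time_step n * partial_x mu (time_point n j) (y j)) * (w (time_point n (Suc j)) - w (time_point n j)) + rho j"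
    and rho: "\<And>i. i \<le> k \<Longrightarrow> \<bar>\<Sum>j<i. rho j\<bar> \<le> \<epsilon>"
    and i: "i \<le> k"
  shows "\<bar>y i - x (time_point n i)\<bar> \<le> (\<epsilon> + 2 * K * (1 / real n + om)) * exp K"
proof -
  note D = drift_boundD[OF db]
  let ?D = "time_step n" and ?t = "time_point n"
  have D0: "?D = 1 / real n" "0 < ?D" using n by (auto simp: time_step_def)
  have om0: "0 \<le> om" using osc[of 0 0] by simp
  have t01: "?t j \<in> {0..1}" if "j \<le> k" for j using that k n by (auto simp: time_point_def)
  have tS: "?t (Suc j) - ?t j = ?D" for j by (simp add: time_point_def time_step_def add_divide_distrib)
  have tle: "?t j \<le> ?t (Suc j)" for j by (simp add: time_point_def divide_right_mono)
  define dw where "dw = (\<lambda>j. w (?t (Suc j)) - w (?t j))"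
  have dwb: "\<bar>dw j\<bar> \<le> om" if "j < k" for j
    using osc[of "?t (Suc j)" "?t j"] t01[of j] t01[of "Suc j"] that tS[of j] D0 by (simp add: dw_def)
  define q where "q = (\<lambda>j. partial_t mu (?t j) (y j) + mu (?t j) (y j) * partial_x mu (?t j) (y j) + 1/2 * partial_xx mu (?t j) (y j))"
  define rho' where "rho' = (\<lambda>j. rho j + (1/2 * ?D * q j * ?D + 1/2 * ?D * partial_x mu (?t j) (y j) * dw j))"
  have ex: "\<bar>1/2 * ?D * q j * ?D + 1/2 * ?D * partial_x mu (?t j) (y j) * dw j\<bar> \<le> ?D * (1/2 * K * (?D + om))" if j: "j < k" for j
  proof -
    have q: "\<bar>q j\<bar> \<le> K" and p: "\<bar>partial_x mu (?t j) (y j)\<bar> \<le> K"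
      using D(3,4)[OF t01 yr] j unfolding q_def by auto
    have "\<bar>1/2 * ?D * q j * ?D\<bar> \<le> 1/2 * ?D * K * ?D"
      unfolding abs_mult using q D0(2) D(1) by (intro mult_mono) auto
    moreover have "\<bar>1/2 * ?D * partial_x mu (?t j) (y j) * dw j\<bar> \<le> 1/2 * ?D * K * om"
      unfolding abs_mult using p dwb[OF j] D0 D(1) by (intro mult_mono) auto
    moreover have "1/2 * ?D * K * ?D + 1/2 * ?D * K * om = ?D * (1/2 * K * (?D + om))" by (simp add: algebra_simps)
    ultimately show ?thesis by linarith
  qed
  have kD: "real k * ?D \<le> 1" using k n by (simp add: D0 field_simps)
  have "\<bar>y i - (x \<circ> ?t) i\<bar> \<le> (0 + (\<epsilon> + 1/2 * K * (?D + om)) + (K * (?D + om)) * (real k * ?D)) * (1 + K * ?D) ^ i"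
  proof (rule euler_error[where k = k and d = "\<lambda>j. mu (?t j) (y j)" and c = "\<lambda>j. mu (?t j) (x (?t j))" and dw = dw and rho = rho'])
    fix j assume j: "j < k"
    show "y (Suc j) = y j + mu (?t j) (y j) * ?D + dw j + rho' j"
      unfolding y[OF j] by (simp add: rho'_def dw_def q_def discrete_drift_def Let_def algebra_simps)
    have "\<bar>x (?t (Suc j)) - (x (?t j) + mu (?t j) (x (?t j)) * (?t (Suc j) - ?t j) + (w (?t (Suc j)) - w (?t j)))\<bar> \<le> K * (?D + om) * (?t (Suc j) - ?t j)"
      by (rule path_increment(1)[OF db xc xr eq, of ?D om])
        (use osc t01[of j] t01[of "Suc j"] j tS[of j] D0 tle in auto)
    then show "\<bar>(x \<circ> ?t) (Suc j) - ((x \<circ> ?t) j + mu (?t j) (x (?t j)) * ?D + dw j)\<bar> \<le> K * (?D + om) * ?D"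
      by (simp add: tS dw_def)
    show "\<bar>mu (?t j) (y j) - mu (?t j) (x (?t j))\<bar> \<le> K * \<bar>y j - (x \<circ> ?t) j\<bar>"
      using D(5)[OF t01[of j] t01[of j] yr[OF j] xr[OF t01[of j]]] j by simp
  next
    fix i assume i: "i \<le> k"
    have "\<bar>\<Sum>j<i. rho' j\<bar> \<le> \<bar>\<Sum>j<i. rho j\<bar> + \<bar>\<Sum>j<i. 1/2 * ?D * q j * ?D + 1/2 * ?D * partial_x mu (?t j) (y j) * dw j\<bar>"
      unfolding rho'_def sum.distrib[of rho] by (rule abs_triangle_ineq)
    also have "\<bar>\<Sum>j<i. 1/2 * ?D * q j * ?D + 1/2 * ?D * partial_x mu (?t j) (y j) * dw j\<bar> \<le> (\<Sum>j<i. ?D * (1/2 * K * (?D + om)))"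
      by (rule order.trans[OF sum_abs sum_mono]) (use ex i in auto)
    also have "\<dots> = (real i * ?D) * (1/2 * K * (?D + om))" by simp
    also have "\<dots> \<le> 1 * (1/2 * K * (?D + om))"
    proof (rule mult_right_mono)
      have "real i * ?D \<le> real k * ?D" using i D0 by (intro mult_right_mono) auto
      then show "real i * ?D \<le> 1" using kD by linarith
    qed (use D(1) D0 om0 in auto)
    finally show "\<bar>\<Sum>j<i. rho' j\<bar> \<le> \<epsilon> + 1/2 * K * (?D + om)" using rho[OF i] by linarith
  next
    show "\<bar>y 0 - (x \<circ> ?t) 0\<bar> \<le> 0"
      using eq[of 0] w0 y0 set_integral_Icc_refl[of 0 "\<lambda>s. mu s (x s)"] by (simp add: time_point_def)
  qed (use D(1) D0 om0 i in auto)
  also have "\<dots> \<le> (\<epsilon> + 2 * K * (1 / real n + om)) * exp K"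
  proof (rule mult_mono)
    have "(K * (?D + om)) * (real k * ?D) \<le> (K * (?D + om)) * 1"
      using kD D(1) D0 om0 by (intro mult_left_mono) auto
    moreover have "0 \<le> K * (?D + om)" using D(1) D0 om0 by simp
    ultimately show "0 + (\<epsilon> + 1/2 * K * (?D + om)) + (K * (?D + om)) * (real k * ?D) \<le> \<epsilon> + 2 * K * (1 / real n + om)"
      unfolding D0(1) by linarith
    have "real i * (K * ?D) \<le> real k * (K * ?D)" using i D(1) D0 by (intro mult_right_mono) auto
    also have "\<dots> = K * (real k * ?D)" by simp
    also have "\<dots> \<le> K * 1" using kD D(1) by (intro mult_left_mono) auto
    finally show "(1 + K * ?D) ^ i \<le> exp K" using D(1) D0 by (intro one_plus_power_le_exp) auto
    show "0 \<le> \<epsilon> + 2 * K * (1 / real n + om)" using rho[of 0] D(1) om0 by simp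
  qed (use D(1) D0 in auto)
  finally show ?thesis by simp
qed

end

section \<open>The diffusion almost surely does not touch the boundary\<close>

text \<open>Step j adds \<open>f (Suc j)\<close>: index 0 is left to the Gaussian that enters the
  initial value \<open>z\<close>, so one independent family can serve for both.\<close>

primrec euler :: "(real \<Rightarrow> real \<Rightarrow> real) \<Rightarrow> (nat \<Rightarrow> real) \<Rightarrow> real \<Rightarrow> real \<Rightarrow> (nat \<Rightarrow> real) \<Rightarrow> nat \<Rightarrow> real" where
  "euler b \<tau> \<Delta> z f 0 = z"
| "euler b \<tau> \<Delta> z f (Suc j) = euler b \<tau> \<Delta> z f j + b (\<tau> j) (euler b \<tau> \<Delta> z f j) * \<Delta> + f (Suc j)"

lemma one_minus_ge_exp:
  assumes "0 \<le> x" "x \<le> 1/2" shows "exp (- 2 * x) \<le> 1 - (x::real)"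
proof -
  have "1 + 2 * x \<le> exp (2 * x)" by (rule exp_ge_add_one_self)
  then have "exp (- 2 * x) \<le> 1 / (1 + 2 * x)" using assms
    by (simp add: exp_minus inverse_eq_divide frac_le)
  also have "\<dots> \<le> 1 - x"
  proof -
    have "x * (2 * x) \<le> x * 1" using assms by (intro mult_left_mono) auto
    then have "1 \<le> (1 - x) * (1 + 2 * x)" by (simp add: algebra_simps)
    then show ?thesis using assms by (simp add: pos_divide_le_eq)
  qed
  finally show ?thesis .
qed

text \<open>For two schemes with the same noise the increments cancel, and each step shrinks the gap
  at most by the factor 1 - K\<Delta>. Over at most 1/\<Delta> steps this leaves exp(-2K), by 1 - x
  >= exp(-2x) for 0 <= x <= 1/2.\<close>

lemma euler_slope:
  assumes b: "\<And>t x y. \<bar>b t x - b t y\<bar> \<le> K * \<bar>x - y\<bar>" and \<Delta>: "0 \<le> \<Delta>" "K * \<Delta> \<le> 1/2" "0 \<le> K"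
    and z: "z \<le> z'" and j: "real j * \<Delta> \<le> 1"
  shows "exp (- 2 * K) * (z' - z) \<le> euler b \<tau> \<Delta> z' f j - euler b \<tau> \<Delta> z f j"
proof -
  have "(1 - K * \<Delta>) ^ j * (z' - z) \<le> euler b \<tau> \<Delta> z' f j - euler b \<tau> \<Delta> z f j" for j
  proof (induction j)
    case 0 show ?case by simp
  next
    case (Suc j)
    let ?D = "euler b \<tau> \<Delta> z' f j - euler b \<tau> \<Delta> z f j"
    have "0 \<le> (1 - K * \<Delta>) ^ j * (z' - z)" using \<Delta> z by (intro mult_nonneg_nonneg zero_le_power) auto
    then have D0: "0 \<le> ?D" using Suc by linarith
    have "(1 - K * \<Delta>) ^ Suc j * (z' - z) = (1 - K * \<Delta>) * ((1 - K * \<Delta>) ^ j * (z' - z))" by simp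
    also have "\<dots> \<le> (1 - K * \<Delta>) * ?D" using Suc \<Delta> by (intro mult_left_mono) auto
    also have "\<dots> = ?D - K * ?D * \<Delta>" by (simp add: algebra_simps)
    also have "\<dots> \<le> ?D + (b (\<tau> j) (euler b \<tau> \<Delta> z' f j) - b (\<tau> j) (euler b \<tau> \<Delta> z f j)) * \<Delta>"
    proof -
      have "\<bar>b (\<tau> j) (euler b \<tau> \<Delta> z' f j) - b (\<tau> j) (euler b \<tau> \<Delta> z f j)\<bar> \<le> K * ?D"
        using b[of "\<tau> j" "euler b \<tau> \<Delta> z' f j" "euler b \<tau> \<Delta> z f j"] D0 by simp
      then have "- (K * ?D) * \<Delta> \<le> (b (\<tau> j) (euler b \<tau> \<Delta> z' f j) - b (\<tau> j) (euler b \<tau> \<Delta> z f j)) * \<Delta>"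
        using \<Delta> by (intro mult_right_mono) auto
      then have "- (K * ?D * \<Delta>) \<le> (b (\<tau> j) (euler b \<tau> \<Delta> z' f j) - b (\<tau> j) (euler b \<tau> \<Delta> z f j)) * \<Delta>"
        by (simp only: mult_minus_left)
      then show ?thesis by linarith
    qed
    also have "\<dots> = euler b \<tau> \<Delta> z' f (Suc j) - euler b \<tau> \<Delta> z f (Suc j)" by (simp add: algebra_simps)
    finally show ?case .
  qed
  moreover have "exp (- 2 * K) * (z' - z) \<le> (1 - K * \<Delta>) ^ j * (z' - z)"
  proof (rule mult_right_mono)
    have "K * (real j * \<Delta>) \<le> K * 1" using j \<Delta> by (intro mult_left_mono) auto
    then have "- 2 * K \<le> real j * (- 2 * (K * \<Delta>))" by (simp add: mult_ac)
    then have "exp (- 2 * K) \<le> exp (real j * (- 2 * (K * \<Delta>)))" by (simp only: exp_le_cancel_iff)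
    also have "\<dots> = exp (- 2 * (K * \<Delta>)) ^ j" by (rule exp_of_nat_mult)
    also have "\<dots> \<le> (1 - K * \<Delta>) ^ j" using \<Delta> by (intro power_mono one_minus_ge_exp) auto
    finally show "exp (- 2 * K) \<le> (1 - K * \<Delta>) ^ j" .
  qed (use z in simp)
  ultimately show ?thesis using order.trans by blast
qed

text \<open>A set of diameter at most l lies in an interval of length 2l about any of its points,
  and the density is at most 1/\<sigma>.\<close>

lemma emeasure_normal_le:
  assumes s: "0 < \<sigma>" and S: "\<And>x y. x \<in> S \<Longrightarrow> y \<in> S \<Longrightarrow> x \<le> y \<Longrightarrow> y - x \<le> l" and l: "0 \<le> l"
  shows "emeasure (normal_measure \<sigma>) S \<le> ennreal (2 * l / \<sigma>)"
proof (cases "S = {}")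
  case False
  then obtain x where x: "x \<in> S" by blast
  have "S \<subseteq> {x - l..x + l}"
  proof
    fix y assume "y \<in> S"
    then show "y \<in> {x - l..x + l}" using S[OF x, of y] S[of y x] x l by (cases "x \<le> y") auto
  qed
  then have "emeasure (normal_measure \<sigma>) S \<le> emeasure (normal_measure \<sigma>) {x - l..x + l}"
    by (rule emeasure_mono) simp
  also have "\<dots> = (\<integral>\<^sup>+u. ennreal (normal_density 0 \<sigma> u) * indicator {x - l..x + l} u \<partial>lborel)"
    by (simp add: normal_measure_def emeasure_density)
  also have "\<dots> \<le> (\<integral>\<^sup>+u. ennreal (1 / \<sigma>) * indicator {x - l..x + l} u \<partial>lborel)"
  proof (intro nn_integral_mono mult_right_mono ennreal_leI)
    fix u
    have "\<sigma> \<le> sqrt (2 * pi * \<sigma>\<^sup>2)"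
    proof (rule real_le_rsqrt)
      have "1 * \<sigma>\<^sup>2 \<le> 2 * pi * \<sigma>\<^sup>2" using pi_gt3 by (intro mult_right_mono) auto
      then show "\<sigma>\<^sup>2 \<le> 2 * pi * \<sigma>\<^sup>2" by simp
    qed
    then have "exp (- u\<^sup>2 / (2 * \<sigma>\<^sup>2)) / sqrt (2 * pi * \<sigma>\<^sup>2) \<le> 1 / \<sigma>"
      using s by (intro frac_le) auto
    then show "normal_density 0 \<sigma> u \<le> 1 / \<sigma>" by (simp add: normal_density_def)
  qed auto
  also have "\<dots> = ennreal (1 / \<sigma>) * ennreal (2 * l)"
    using l by (simp add: nn_integral_cmult_indicator)
  also have "\<dots> = ennreal (2 * l / \<sigma>)" using s l by (simp flip: ennreal_mult)
  finally show ?thesis .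
qed simp

text \<open>Fix the later increments. Any two initial values for which the scheme stays on its side
  of g up to \<epsilon> and also comes within \<epsilon> of it differ by at most 2 \<epsilon>
  exp(2K): at the index where the one farther inside gets close to g, the other is at most
  \<epsilon> beyond. Since \<xi> 0 is independent of these increments, Fubini and the bound on its
  density conclude. The sign u selects upper or lower boundary.\<close>

lemma (in prob_space) prob_euler_near_le:
  fixes \<tau> g :: "nat \<Rightarrow> real" and x0 :: real
  assumes ind: "indep_vars (\<lambda>_. borel) \<xi> {..<Suc n}" and \<xi>0: "distributed M lborel (\<xi> 0) (normal_density 0 \<sigma>)"
    and s: "0 < \<sigma>" and b: "\<And>t x y. \<bar>b t x - b t y\<bar> \<le> K * \<bar>x - y\<bar>"
    and \<Delta>: "0 \<le> \<Delta>" "K * \<Delta> \<le> 1/2" "0 \<le> K" "real n * \<Delta> \<le> 1"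
    and u: "u = 1 \<or> u = (-1::real)" and \<epsilon>: "0 \<le> \<epsilon>"
  defines "Z \<equiv> \<lambda>j \<omega>. euler b \<tau> \<Delta> (x0 + \<xi> 0 \<omega>) (\<lambda>i. \<xi> i \<omega>) j"
  defines "B \<equiv> {\<omega> \<in> space M. (\<forall>j\<le>n. u * (Z j \<omega> - g j) \<le> \<epsilon>) \<and> (\<exists>j\<le>n. - \<epsilon> \<le> u * (Z j \<omega> - g j))}"
  shows "B \<in> events" "prob B \<le> 4 * \<epsilon> * exp (2 * K) / \<sigma>"
proof -
  let ?P = "PiM {1..n} (\<lambda>_. borel :: real measure)" and ?Q = "PiM {0::nat} (\<lambda>_. borel :: real measure)"
  define E where "E = (\<lambda>j (p :: (nat \<Rightarrow> real) \<times> (nat \<Rightarrow> real)). euler b \<tau> \<Delta> (x0 + fst p 0) (snd p) j :: real)"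
  define S where "S = {p \<in> space (?Q \<Otimes>\<^sub>M ?P). (\<forall>j\<in>{..n}. u * (E j p - g j) \<le> \<epsilon>) \<and> (\<exists>j\<in>{..n}. - \<epsilon> \<le> u * (E j p - g j))}"
  have bm: "b t \<in> borel_measurable borel" for t
  proof (rule borel_measurable_continuous_onI)
    have "dist (b t x) (b t y) \<le> K * dist x y" for x y using b[of t x y] by (simp add: dist_real_def)
    then have "K-lipschitz_on UNIV (b t)" using \<Delta>(3) by (intro lipschitz_onI) auto
    then show "continuous_on UNIV (b t)" by (rule lipschitz_on_continuous_on)
  qed
  have E[measurable]: "E j \<in> borel_measurable (?Q \<Otimes>\<^sub>M ?P)" if "j \<le> n" for j
    using that
  proof (induction j)
    case 0
    have "(\<lambda>p. fst p 0) \<in> borel_measurable (?Q \<Otimes>\<^sub>M ?P)"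
      by (rule measurable_compose[OF measurable_fst measurable_component_singleton]) simp
    then show ?case unfolding E_def by simp
  next
    case (Suc j)
    have 1: "E j \<in> borel_measurable (?Q \<Otimes>\<^sub>M ?P)" using Suc by simp
    have 2: "(\<lambda>p. snd p (Suc j)) \<in> borel_measurable (?Q \<Otimes>\<^sub>M ?P)"
      by (rule measurable_compose[OF measurable_snd measurable_component_singleton]) (use Suc in simp)
    have eq: "E (Suc j) = (\<lambda>p. E j p + b (\<tau> j) (E j p) * \<Delta> + snd p (Suc j))" by (simp add: E_def fun_eq_iff)
    show ?case unfolding eq
      by (intro borel_measurable_add borel_measurable_times borel_measurable_const 1 2 measurable_compose[OF 1 bm])
  qed
  have S: "S \<in> sets (?Q \<Otimes>\<^sub>M ?P)"
    unfolding S_def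
    by (intro sets.sets_Collect_conj sets.sets_Collect_finite_All sets.sets_Collect_finite_Ex borel_measurable_le
        borel_measurable_times borel_measurable_diff borel_measurable_const E) auto
  let ?H = "\<lambda>\<omega>. \<lambda>i\<in>{1..n}. \<xi> i \<omega>" and ?J = "\<lambda>\<omega>. \<lambda>i\<in>{0::nat}. \<xi> i \<omega>"
  have rv: "\<xi> i \<in> borel_measurable M" if "i \<le> n" for i using ind that by (auto simp: indep_vars_def)
  have Hm: "?H \<in> M \<rightarrow>\<^sub>M ?P" by (rule measurable_restrict) (use rv in auto)
  have H0m: "?J \<in> M \<rightarrow>\<^sub>M ?Q" by (rule measurable_restrict) (use rv in auto)
  have EZ: "euler b \<tau> \<Delta> z (?H \<omega>) j = euler b \<tau> \<Delta> z (\<lambda>i. \<xi> i \<omega>) j" if "j \<le> n" for z \<omega> j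
    using that by (induction j) auto
  have pm: "(\<lambda>\<omega>. (?J \<omega>, ?H \<omega>)) \<in> M \<rightarrow>\<^sub>M (?Q \<Otimes>\<^sub>M ?P)" using H0m Hm by (rule measurable_Pair)
  have EJ: "E j (?J \<omega>, ?H \<omega>) = Z j \<omega>" if "j \<le> n" for j \<omega>
    using EZ[OF that, of "x0 + \<xi> 0 \<omega>" \<omega>] by (simp add: E_def Z_def)
  have BS: "B = (\<lambda>\<omega>. (?J \<omega>, ?H \<omega>)) -` S \<inter> space M"
  proof (rule set_eqI)
    fix \<omega>
    have "(?J \<omega>, ?H \<omega>) \<in> space (?Q \<Otimes>\<^sub>M ?P)" if "\<omega> \<in> space M" using measurable_space[OF pm that] by simp
    then show "\<omega> \<in> B \<longleftrightarrow> \<omega> \<in> (\<lambda>\<omega>. (?J \<omega>, ?H \<omega>)) -` S \<inter> space M"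
      unfolding B_def S_def vimage_def Int_iff mem_Collect_eq Bex_def Ball_def atMost_iff using EJ by metis
  qed
  show B: "B \<in> events" unfolding BS by (rule measurable_sets[OF pm S])
  have iv: "indep_var ?Q ?J ?P ?H"
    by (rule indep_var_restrict[OF ind]) auto
  have dist0: "distr M borel (\<xi> 0) = normal_measure \<sigma>"
    using distributed_distr_eq_density[OF \<xi>0] by (simp add: normal_measure_def cong: distr_cong)
  interpret H0: prob_space "distr M ?Q ?J" by (rule prob_space_distr[OF H0m])
  interpret H: prob_space "distr M ?P ?H" by (rule prob_space_distr[OF Hm])
  interpret pair_sigma_finite "distr M ?Q ?J" "distr M ?P ?H" ..
  have joint: "distr M (?Q \<Otimes>\<^sub>M ?P) (\<lambda>\<omega>. (?J \<omega>, ?H \<omega>)) = distr M ?Q ?J \<Otimes>\<^sub>M distr M ?P ?H"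
    using indep_var_distribution_eq[THEN iffD1, OF iv] by simp
  have Ssets: "S \<in> sets (distr M ?Q ?J \<Otimes>\<^sub>M distr M ?P ?H)"
    using S by (simp cong: sets_pair_measure_cong)
  have "emeasure M B = emeasure (distr M ?Q ?J \<Otimes>\<^sub>M distr M ?P ?H) S"
    unfolding joint[symmetric] BS using pm S by (simp add: emeasure_distr)
  also have "\<dots> = (\<integral>\<^sup>+h. emeasure (distr M ?Q ?J) ((\<lambda>f. (f, h)) -` S) \<partial>distr M ?P ?H)"
    by (rule emeasure_pair_measure_alt2[OF Ssets])
  also have "\<dots> = (\<integral>\<^sup>+h. emeasure (normal_measure \<sigma>) {z. (\<lambda>i\<in>{0}. z, h) \<in> S} \<partial>distr M ?P ?H)"
  proof (rule nn_integral_cong)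
    fix h
    have A: "(\<lambda>f. (f, h)) -` S \<in> sets ?Q" using sets_Pair2[OF S] by simp
    have cm: "(\<lambda>z. \<lambda>i\<in>{0::nat}. z) \<in> borel \<rightarrow>\<^sub>M ?Q" by (rule measurable_restrict) simp
    have I: "{z. (\<lambda>i\<in>{0}. z, h) \<in> S} \<in> sets borel"
      using measurable_sets[OF cm A] by (simp add: vimage_def)
    have "emeasure (distr M ?Q ?J) ((\<lambda>f. (f, h)) -` S) = emeasure M (?J -` ((\<lambda>f. (f, h)) -` S) \<inter> space M)"
      by (rule emeasure_distr[OF H0m A])
    also have "?J -` ((\<lambda>f. (f, h)) -` S) \<inter> space M = \<xi> 0 -` {z. (\<lambda>i\<in>{0}. z, h) \<in> S} \<inter> space M"
    proof -
      have "?J \<omega> = (\<lambda>i\<in>{0}. \<xi> 0 \<omega>)" for \<omega> by auto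
      then show ?thesis by auto
    qed
    also have "emeasure M \<dots> = emeasure (distr M borel (\<xi> 0)) {z. (\<lambda>i\<in>{0}. z, h) \<in> S}"
      by (rule emeasure_distr[symmetric]) (use rv I in auto)
    finally show "emeasure (distr M ?Q ?J) ((\<lambda>f. (f, h)) -` S) = emeasure (normal_measure \<sigma>) {z. (\<lambda>i\<in>{0}. z, h) \<in> S}"
      by (simp only: dist0)
  qed
  also have "\<dots> \<le> (\<integral>\<^sup>+h. ennreal (2 * (2 * \<epsilon> * exp (2 * K)) / \<sigma>) \<partial>distr M ?P ?H)"
  proof (rule nn_integral_mono, rule emeasure_normal_le[OF s])
    fix h z0 z0' assume z0: "z0 \<in> {z. (\<lambda>i\<in>{0}. z, h) \<in> S}" "z0' \<in> {z. (\<lambda>i\<in>{0}. z, h) \<in> S}" "z0 \<le> z0'"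
    define z z' where "z = (\<lambda>i\<in>{0::nat}. z0)" and "z' = (\<lambda>i\<in>{0::nat}. z0')"
    have z: "(z, h) \<in> S" "(z', h) \<in> S" using z0 by (auto simp: z_def z'_def)
    have "\<exists>j\<le>n. E j (z', h) - E j (z, h) \<le> 2 * \<epsilon>"
    proof (cases "u = 1")
      case True
      obtain j where "j \<le> n" "- \<epsilon> \<le> u * (E j (z, h) - g j)" using z(1) by (auto simp: S_def)
      moreover have "u * (E j (z', h) - g j) \<le> \<epsilon>" using z(2) \<open>j \<le> n\<close> by (auto simp: S_def)
      ultimately show ?thesis using True by (intro exI[of _ j]) auto
    next
      case False
      then have u1: "u = -1" using u by simp
      obtain j where "j \<le> n" "- \<epsilon> \<le> u * (E j (z', h) - g j)" using z(2) by (auto simp: S_def)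
      moreover have "u * (E j (z, h) - g j) \<le> \<epsilon>" using z(1) \<open>j \<le> n\<close> by (auto simp: S_def)
      ultimately show ?thesis using u1 by (intro exI[of _ j]) auto
    qed
    then obtain j where j: "j \<le> n" "E j (z', h) - E j (z, h) \<le> 2 * \<epsilon>" by blast
    have "real j * \<Delta> \<le> real n * \<Delta>" using j \<Delta> by (intro mult_right_mono) auto
    then have jD: "real j * \<Delta> \<le> 1" using \<Delta> by linarith
    have "exp (- 2 * K) * ((x0 + z' 0) - (x0 + z 0)) \<le> E j (z', h) - E j (z, h)"
      unfolding E_def fst_conv snd_conv by (rule euler_slope[OF b \<Delta>(1-3) _ jD]) (use z0 in \<open>simp add: z_def z'_def\<close>)
    then have "exp (- 2 * K) * (z0' - z0) \<le> 2 * \<epsilon>" using j by (simp add: z_def z'_def)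
    then have "exp (2 * K) * (exp (- 2 * K) * (z0' - z0)) \<le> exp (2 * K) * (2 * \<epsilon>)" by (intro mult_left_mono) auto
    then show "z0' - z0 \<le> 2 * \<epsilon> * exp (2 * K)"
    proof -
      have "exp (2 * K) * exp (- 2 * K) = 1" by (simp flip: exp_add)
      then have "exp (2 * K) * (exp (- 2 * K) * (z0' - z0)) = z0' - z0" by (simp only: mult.assoc[symmetric] mult_1_left)
      moreover assume "exp (2 * K) * (exp (- 2 * K) * (z0' - z0)) \<le> exp (2 * K) * (2 * \<epsilon>)"
      ultimately show ?thesis by (simp only: mult.commute)
    qed
  qed (use \<epsilon> in auto)
  also have "\<dots> = ennreal (4 * \<epsilon> * exp (2 * K) / \<sigma>)"
    using H.emeasure_space_1 by (simp add: mult.assoc)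
  finally show "prob B \<le> 4 * \<epsilon> * exp (2 * K) / \<sigma>"
    using s \<epsilon> by (simp add: emeasure_eq_measure)
qed

section \<open>The late Euler scheme and the null event of touching\<close>

locale diffusion = smooth_drift mu + standard_brownian_motion_on M "{0..1}" W
  for mu :: "real \<Rightarrow> real \<Rightarrow> real" and M :: "'a measure" and W :: "real \<Rightarrow> 'a \<Rightarrow> real" +
  fixes X :: "real \<Rightarrow> 'a \<Rightarrow> real" and x0 :: real
  assumes X_measurable: "\<And>t. t \<in> {0..1} \<Longrightarrow> X t \<in> borel_measurable M"
    and X_continuous: "\<And>\<omega>. \<omega> \<in> space M \<Longrightarrow> continuous_on {0..1} (\<lambda>t. X t \<omega>)"
    and X_eq: "AE \<omega> in M. \<forall>t\<in>{0..1}.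
      X t \<omega> = x0 + (LINT s:{0..t}|lborel. mu s (X s \<omega>)) + W t \<omega>"
begin

definition regular :: "'a \<Rightarrow> bool" where
  "regular \<omega> \<longleftrightarrow> \<omega> \<in> space M \<and> W 0 \<omega> = 0 \<and> continuous_on {0..1} (\<lambda>t. W t \<omega>) \<and>
    (\<forall>t\<in>{0..1}. X t \<omega> = x0 + (LINT s:{0..t}|lborel. mu s (X s \<omega>)) + W t \<omega>)"

lemma AE_regular: "AE \<omega> in M. regular \<omega>"
  using start_0 continuous_paths X_eq AE_space unfolding regular_def by eventually_elim auto

lemma regular_X0: "regular \<omega> \<Longrightarrow> X 0 \<omega> = x0"
  using set_integral_Icc_refl[of 0 "\<lambda>s. mu s (X s \<omega>)"] by (auto simp: regular_def)

text \<open>Truncating time and space makes the drift globally Lipschitz, as monotonicity of the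
  Euler scheme requires; along paths bounded by \<open>r\<close> it agrees with
  \<open>mu\<close>.\<close>

definition clamped :: "real \<Rightarrow> real \<Rightarrow> real \<Rightarrow> real" where
  "clamped r t x = mu (max 0 (min 1 t)) (max (- r) (min r x))"

lemma clamped_lipschitz:
  assumes "drift_bound K r" "0 < r"
  shows "\<bar>clamped r t x - clamped r t y\<bar> \<le> K * \<bar>x - y\<bar>"
proof -
  have "\<bar>clamped r t x - clamped r t y\<bar> \<le> K * (\<bar>max 0 (min 1 t) - max 0 (min 1 t)\<bar> + \<bar>max (- r) (min r x) - max (- r) (min r y)\<bar>)"
    unfolding clamped_def by (rule drift_boundD(5)[OF assms(1)]) (use assms(2) in auto)
  also have "\<dots> \<le> K * \<bar>x - y\<bar>" using drift_boundD(1)[OF assms(1)] by (intro mult_left_mono) auto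
  finally show ?thesis .
qed

lemma clamped_eq: "t \<in> {0..1} \<Longrightarrow> \<bar>x\<bar> \<le> r \<Longrightarrow> clamped r t x = mu t x"
  by (simp add: clamped_def)

definition late_time :: "real \<Rightarrow> nat \<Rightarrow> nat \<Rightarrow> real" where
  "late_time a n j = a + (1 - a) * real j / real n"

definition late_increment :: "real \<Rightarrow> nat \<Rightarrow> nat \<Rightarrow> 'a \<Rightarrow> real" where
  "late_increment a n i \<omega> = (case i of 0 \<Rightarrow> W a \<omega> - W 0 \<omega> | Suc j \<Rightarrow> W (late_time a n (Suc j)) \<omega> - W (late_time a n j) \<omega>)"

text \<open>An Euler scheme whose first step is the whole interval \<open>[0, a]\<close>, so that it is a strictly
  monotone function of the Gaussian variable \<open>W a\<close>, which is independent of the later increments.\<close>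

definition late_euler :: "real \<Rightarrow> real \<Rightarrow> nat \<Rightarrow> nat \<Rightarrow> 'a \<Rightarrow> real" where
  "late_euler r a n j \<omega> = euler (clamped r) (late_time a n) ((1 - a) / real n)
     (x0 + late_increment a n 0 \<omega>) (\<lambda>i. late_increment a n i \<omega>) j"

lemma late_time_in: "0 < a \<Longrightarrow> a < 1 \<Longrightarrow> j \<le> n \<Longrightarrow> late_time a n j \<in> {a..1}"
proof -
  assume a: "0 < a" "a < 1" and j: "j \<le> n"
  have "(1 - a) * (real j / real n) \<le> (1 - a) * 1"
    using a j by (intro mult_left_mono) (auto simp: divide_le_eq)
  then show ?thesis using a by (auto simp: late_time_def)
qed

lemma late_time_near:
  assumes b: "0 < b" "b < 1" and n: "0 < n" and t: "t \<in> {b..1}"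
  shows "\<exists>j\<le>n. \<bar>late_time b n j - t\<bar> \<le> 1 / real n"
proof -
  define z where "z = (t - b) / (1 - b) * real n"
  have z0: "0 \<le> z" using b t by (simp add: z_def)
  have "(t - b) / (1 - b) \<le> 1" using b t by simp
  then have zn: "z \<le> 1 * real n" unfolding z_def by (intro mult_right_mono) auto
  define j where "j = nat \<lfloor>z\<rfloor>"
  have j: "real j \<le> z" "z < real j + 1" using z0 by (auto simp: j_def)
  have "real j \<le> real n" using j zn by linarith
  then have jn: "j \<le> n" by simp
  have "(1 - b) * z / real n = t - b" using b n by (simp add: z_def)
  then have "late_time b n j - t = (1 - b) * real j / real n - (1 - b) * z / real n" by (simp add: late_time_def)
  also have "\<dots> = (1 - b) * ((real j - z) / real n)" by (simp add: diff_divide_distrib right_diff_distrib)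
  finally have "\<bar>late_time b n j - t\<bar> = (1 - b) * (\<bar>real j - z\<bar> / real n)" using b by (simp add: abs_mult)
  also have "\<dots> \<le> 1 * (1 / real n)" using b j by (intro mult_mono divide_right_mono) auto
  finally show ?thesis using jn by auto
qed

lemma late_time_Suc: "late_time a n (Suc j) - late_time a n j = (1 - a) / real n"
  by (cases "n = 0") (simp_all add: late_time_def field_simps)

lemma late_increment_indep:
  assumes a: "0 < a" "a < 1" and n: "0 < n"
  shows "indep_vars (\<lambda>_. borel) (late_increment a n) {..<Suc n}"
    and "distributed M lborel (late_increment a n 0) (normal_density 0 (sqrt a))"
proof -
  define \<sigma> where "\<sigma> = (\<lambda>i. case i of 0 \<Rightarrow> 0 | Suc j \<Rightarrow> late_time a n j)"
  have "indep_vars (\<lambda>_. borel) (\<lambda>i \<omega>. W (\<sigma> (Suc i)) \<omega> - W (\<sigma> i) \<omega>) {..<Suc n}"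
  proof (rule indep_increments)
    show "\<forall>i\<le>Suc n. \<sigma> i \<in> {0..1}"
    proof (intro allI impI)
      fix i assume i: "i \<le> Suc n"
      show "\<sigma> i \<in> {0..1}"
      proof (cases i)
        case (Suc j) then show ?thesis using late_time_in[OF a, of j n] i a by (auto simp: \<sigma>_def)
      qed (simp add: \<sigma>_def)
    qed
    show "\<forall>i<Suc n. \<sigma> i < \<sigma> (Suc i)"
    proof (intro allI impI)
      fix i assume i: "i < Suc n"
      show "\<sigma> i < \<sigma> (Suc i)"
      proof (cases i)
        case 0 then show ?thesis using a by (simp add: \<sigma>_def late_time_def)
      next
        case (Suc j)
        have "0 < (1 - a) / real n" using a n by simp
        then show ?thesis using late_time_Suc[of a n j] Suc by (simp add: \<sigma>_def)
      qed
    qed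
  qed
  moreover have "(\<lambda>i \<omega>. W (\<sigma> (Suc i)) \<omega> - W (\<sigma> i) \<omega>) = late_increment a n"
    by (auto simp: fun_eq_iff \<sigma>_def late_increment_def late_time_def split: nat.split)
  ultimately show "indep_vars (\<lambda>_. borel) (late_increment a n) {..<Suc n}" by simp
  show "distributed M lborel (late_increment a n 0) (normal_density 0 (sqrt a))"
    using normal_increments[of 0 a] a by (simp add: late_increment_def[abs_def])
qed

text \<open>The first step omits the drift on [0, a] and costs K a; the later steps form an ordinary
  Euler scheme, whose error is of order a once the mesh and the oscillation of the path over it are
  at most a/2. Both are of smaller order than sqrt a, the standard deviation of the first
  step.\<close>

lemma late_euler_error:
  assumes db: "drift_bound K r" and r: "0 < r" and a: "0 < a" "a < 1" and reg: "regular \<omega>"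
    and Xr: "\<And>t. t \<in> {0..1} \<Longrightarrow> \<bar>X t \<omega>\<bar> \<le> r"
    and osc: "\<And>s t. s \<in> {0..1} \<Longrightarrow> t \<in> {0..1} \<Longrightarrow> \<bar>s - t\<bar> \<le> 1 / real n \<Longrightarrow> \<bar>X s \<omega> - X t \<omega>\<bar> \<le> a / 2"
    and n: "0 < n" "1 / real n \<le> a / 2" and j: "j \<le> n"
  shows "\<bar>late_euler r a n j \<omega> - X (late_time a n j) \<omega>\<bar> \<le> 2 * K * a * exp K"
proof -
  note D = drift_boundD[OF db]
  let ?\<tau> = "late_time a n" and ?D = "(1 - a) / real n"
  note lt = late_time_in[OF a]
  have t01: "?\<tau> j \<in> {0..1}" if "j \<le> n" for j using lt[OF that] a by auto
  have D0: "0 < ?D" using a n by simp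
  have D1: "?D \<le> 1 / real n" using a n by (simp add: divide_right_mono)
  have nD: "real n * ?D \<le> 1" using a n by simp
  have xc: "continuous_on {0..1} (\<lambda>t. X t \<omega>)" using reg X_continuous by (auto simp: regular_def)
  have eq: "X t \<omega> = x0 + (LINT s:{0..t}|lborel. mu s (X s \<omega>)) + W t \<omega>" if "t \<in> {0..1}" for t
    using reg that by (auto simp: regular_def)
  have "\<bar>late_euler r a n j \<omega> - (\<lambda>i. X (?\<tau> i) \<omega>) j\<bar> \<le> (K * a + 0 + (K * (?D + a / 2)) * (real n * ?D)) * (1 + K * ?D) ^ j"
    unfolding late_euler_def
  proof (rule euler_error[where k = n and d = "\<lambda>j. clamped r (?\<tau> j) (late_euler r a n j \<omega>)"
        and c = "\<lambda>j. mu (?\<tau> j) (X (?\<tau> j) \<omega>)" and dw = "\<lambda>j. late_increment a n (Suc j) \<omega>" and rho = "\<lambda>_. 0"])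
    fix i assume i: "i < n"
    have "\<bar>X (?\<tau> (Suc i)) \<omega> - (X (?\<tau> i) \<omega> + mu (?\<tau> i) (X (?\<tau> i) \<omega>) * (?\<tau> (Suc i) - ?\<tau> i) + (W (?\<tau> (Suc i)) \<omega> - W (?\<tau> i) \<omega>))\<bar>
      \<le> K * (?D + a / 2) * (?\<tau> (Suc i) - ?\<tau> i)"
    proof (rule path_increment(1)[OF db xc Xr eq, of ?D "a / 2"])
      show "\<bar>X s \<omega> - X t \<omega>\<bar> \<le> a / 2" if "s \<in> {0..1}" "t \<in> {0..1}" "\<bar>s - t\<bar> \<le> ?D" for s t
        using osc[OF that(1,2)] that(3) D1 by linarith
      show "?\<tau> i \<le> ?\<tau> (Suc i)" "?\<tau> (Suc i) - ?\<tau> i \<le> ?D" using late_time_Suc[of a n i] D0 by linarith+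
    qed (use t01[of i] t01[of "Suc i"] i in auto)
    then show "\<bar>X (?\<tau> (Suc i)) \<omega> - (X (?\<tau> i) \<omega> + mu (?\<tau> i) (X (?\<tau> i) \<omega>) * ?D + late_increment a n (Suc i) \<omega>)\<bar> \<le> K * (?D + a / 2) * ?D"
      unfolding late_time_Suc by (simp add: late_increment_def)
    have "mu (?\<tau> i) (X (?\<tau> i) \<omega>) = clamped r (?\<tau> i) (X (?\<tau> i) \<omega>)"
      using t01[of i] Xr[of "?\<tau> i"] i by (simp add: clamped_eq)
    then show "\<bar>clamped r (?\<tau> i) (late_euler r a n i \<omega>) - mu (?\<tau> i) (X (?\<tau> i) \<omega>)\<bar>
      \<le> K * \<bar>euler (clamped r) ?\<tau> ?D (x0 + late_increment a n 0 \<omega>) (\<lambda>i. late_increment a n i \<omega>) i - X (?\<tau> i) \<omega>\<bar>"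
      using clamped_lipschitz[OF db r, of "?\<tau> i" "late_euler r a n i \<omega>" "X (?\<tau> i) \<omega>"] by (simp add: late_euler_def)
  next
    have "\<bar>X a \<omega> - (X 0 \<omega> + (W a \<omega> - W 0 \<omega>))\<bar> \<le> K * (a - 0)"
    proof (rule path_increment(2)[OF db xc Xr eq, of 1 "2 * r"])
      show "\<bar>X s \<omega> - X t \<omega>\<bar> \<le> 2 * r" if "s \<in> {0..1}" "t \<in> {0..1}" for s t
        using Xr[OF that(1)] Xr[OF that(2)] by linarith
    qed (use a in auto)
    then show "\<bar>euler (clamped r) ?\<tau> ?D (x0 + late_increment a n 0 \<omega>) (\<lambda>i. late_increment a n i \<omega>) 0 - X (?\<tau> 0) \<omega>\<bar> \<le> K * a"
      using regular_X0[OF reg] by (simp add: late_increment_def late_time_def abs_minus_commute)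
  qed (use D(1) D0 a j in \<open>auto simp: late_euler_def\<close>)
  also have "\<dots> \<le> (2 * K * a) * exp K"
  proof (rule mult_mono)
    have "(K * (?D + a / 2)) * (real n * ?D) \<le> (K * (a / 2 + a / 2)) * 1"
    proof (rule mult_mono[OF _ nD])
      have "?D \<le> a / 2" using D1 n by linarith
      then show "K * (?D + a / 2) \<le> K * (a / 2 + a / 2)" by (rule mult_left_mono[OF add_right_mono D(1)])
    qed (use D(1) D0 a in auto)
    then show "K * a + 0 + (K * (?D + a / 2)) * (real n * ?D) \<le> 2 * K * a" by simp
    have "real j * (K * ?D) = K * (real j * ?D)" by simp
    also have "\<dots> \<le> K * (real n * ?D)" using j D(1) D0 by (intro mult_left_mono mult_right_mono) auto
    also have "\<dots> \<le> K * 1" using nD D(1) by (intro mult_left_mono) auto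
    finally have "real j * (K * ?D) \<le> K" by simp
    then show "(1 + K * ?D) ^ j \<le> exp K" by (rule one_plus_power_le_exp[OF mult_nonneg_nonneg[OF D(1) less_imp_le[OF D0]]])
  qed (use D(1) D0 a in auto)
  finally show ?thesis by simp
qed

text \<open>A path that touches g after time a forces the late scheme, for all large n, to come
  within \<open>\<epsilon> a\<close> of g without exceeding it by more, which has probability of
  order \<epsilon>(a)/sqrt a. The bound on the path keeps the clamped drift exact, and the strict
  start excludes touching at time 0.\<close>

lemma touch_null:
  assumes g: "continuous_on {0..1} g" and u: "u = 1 \<or> u = (-1::real)" and start: "u * (x0 - g 0) < 0" and r: "0 < r"
  shows "AE \<omega> in M. \<not> ((\<forall>t\<in>{0..1}. \<bar>X t \<omega>\<bar> \<le> r \<and> u * (X t \<omega> - g t) \<le> 0) \<and> (\<exists>t\<in>{0..1}. X t \<omega> = g t))"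
proof -
  obtain K where db: "drift_bound K r" using drift_bound_exists[OF r] by blast
  note D = drift_boundD[OF db]
  \<comment> \<open>3 (K + 1) exp(K) a covers the scheme error 2 K a exp(K) together with a/2 each
    for the oscillation of the path and of g over one mesh.\<close>
  define \<epsilon> where "\<epsilon> = (\<lambda>a. 3 * (K + 1) * exp K * a)"
  define B where "B = (\<lambda>a n. {\<omega> \<in> space M. (\<forall>j\<le>n. u * (late_euler r a n j \<omega> - g (late_time a n j)) \<le> \<epsilon> a) \<and>
      (\<exists>j\<le>n. - \<epsilon> a \<le> u * (late_euler r a n j \<omega> - g (late_time a n j)))})"
  define C where "C = 12 * (K + 1) * exp K * exp (2 * K)"
  \<comment> \<open>From here on K times the step is at most 1/2, as \<open>euler_slope\<close>
    demands.\<close>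
  define n0 where "n0 = Suc (nat \<lceil>2 * K\<rceil>)"
  have B: "B a n \<in> events" "prob (B a n) \<le> C * sqrt a" if a: "0 < a" "a < 1" and n: "n0 \<le> n" for a n
  proof -
    have n': "0 < n" "2 * K \<le> real n" using n by (auto simp: n0_def) linarith
    have k: "K * ((1 - a) / real n) \<le> 1 / 2"
    proof -
      have "K * (1 - a) \<le> K * 1" using a D(1) by (intro mult_left_mono) auto
      then show ?thesis using n' by (simp add: field_simps)
    qed
    have nD: "real n * ((1 - a) / real n) \<le> 1" "0 \<le> (1 - a) / real n" using n' a by auto
    have e0: "0 \<le> \<epsilon> a" using D(1) a by (simp add: \<epsilon>_def)
    have sa: "0 < sqrt a" using a by simp
    have *: "B a n \<in> events" "prob (B a n) \<le> 4 * \<epsilon> a * exp (2 * K) / sqrt a"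
      using prob_euler_near_le[where \<xi> = "late_increment a n" and n = n and \<sigma> = "sqrt a" and b = "clamped r" and K = K
          and \<Delta> = "(1 - a) / real n" and u = u and \<epsilon> = "\<epsilon> a" and ?x0.0 = x0 and \<tau> = "late_time a n" and g = "\<lambda>j. g (late_time a n j)",
          OF late_increment_indep[OF a n'(1)] sa _ nD(2) k D(1) nD(1) u e0] clamped_lipschitz[OF db r]
      unfolding B_def late_euler_def by blast+
    show "B a n \<in> events" by (rule *(1))
    have "prob (B a n) \<le> 4 * \<epsilon> a * exp (2 * K) / sqrt a" by (rule *(2))
    also have "\<dots> = C * (a / sqrt a)" by (simp add: C_def \<epsilon>_def)
    also have "a / sqrt a = sqrt a" using a by (simp add: real_div_sqrt)
    finally show "prob (B a n) \<le> C * sqrt a" .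
  qed
  \<comment> \<open>The limes inferior in n of the events \<open>B a n\<close>: a measurable event
    that contains, up to a null set, touching after time a, whose own description quantifies over
    uncountably many times.\<close>
  define L where "L = (\<lambda>a. \<Union>m. \<Inter>i. B a (n0 + m + i))"
  have L: "L a \<in> events" "prob (L a) \<le> C * sqrt a" if a: "0 < a" "a < 1" for a
  proof -
    have ev: "(\<Inter>i. B a (n0 + m + i)) \<in> events" for m
      by (rule sets.countable_INT') (use B(1)[OF a] in auto)
    then show "L a \<in> events" unfolding L_def by (rule sets.countable_UN'[rotated 1, OF image_subsetI]) auto
    have "incseq (\<lambda>m. \<Inter>i. B a (n0 + m + i))"
    proof (rule incseq_SucI, rule INT_greatest)
      fix m i
      show "(\<Inter>i. B a (n0 + m + i)) \<subseteq> B a (n0 + Suc m + i)"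
        using INT_lower[of "Suc i" UNIV "\<lambda>i. B a (n0 + m + i)"] by simp
    qed
    then have lim: "(\<lambda>m. prob (\<Inter>i. B a (n0 + m + i))) \<longlonglongrightarrow> prob (L a)"
      unfolding L_def by (intro finite_Lim_measure_incseq) (use ev in auto)
    show "prob (L a) \<le> C * sqrt a"
    proof (rule LIMSEQ_le_const2[OF lim], intro exI allI impI)
      fix m
      have "prob (\<Inter>i. B a (n0 + m + i)) \<le> prob (B a (n0 + m + 0))"
        by (rule finite_measure_mono[OF INF_lower[OF UNIV_I]]) (rule B(1)[OF a], simp)
      also have "\<dots> \<le> C * sqrt a" by (rule B(2)[OF a]) simp
      finally show "prob (\<Inter>i. B a (n0 + m + i)) \<le> C * sqrt a" .
    qed
  qed
  define a where "a = (\<lambda>m::nat. 1 / (real m + 2))"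
  have a: "0 < a m" "a m < 1" for m by (auto simp: a_def field_simps)
  have alim: "(\<lambda>m. C * sqrt (a m)) \<longlonglongrightarrow> 0"
  proof -
    have "a \<longlonglongrightarrow> 0" using LIMSEQ_ignore_initial_segment[OF lim_1_over_n[where 'a = real], of 2] by (simp add: a_def[abs_def] add.commute)
    then have "(\<lambda>m. C * sqrt (a m)) \<longlonglongrightarrow> C * sqrt 0" by (intro tendsto_intros)
    then show ?thesis by simp
  qed
  \<comment> \<open>The touching time is positive but unknown: it exceeds a (m + i) for all i once m
    is large, so excluding the intersection for every m covers all cases.\<close>
  have null: "(\<Inter>i. L (a (m + i))) \<in> null_sets M" for m
  proof -
    have ev: "(\<Inter>i. L (a (m + i))) \<in> events" by (rule sets.countable_INT') (use L(1)[OF a] in auto)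
    have "prob (\<Inter>i. L (a (m + i))) \<le> 0"
    proof (rule LIMSEQ_le_const[OF LIMSEQ_ignore_initial_segment[OF alim, of m]], intro exI allI impI)
      fix i
      have "prob (\<Inter>i. L (a (m + i))) \<le> prob (L (a (m + i)))"
        by (rule finite_measure_mono) (use L(1)[OF a] in auto)
      also have "\<dots> \<le> C * sqrt (a (m + i))" by (rule L(2)[OF a])
      finally show "prob (\<Inter>i. L (a (m + i))) \<le> C * sqrt (a (i + m))" by (simp add: add.commute)
    qed
    then have "prob (\<Inter>i. L (a (m + i))) = 0" using measure_nonneg[of M] by (simp add: order.antisym)
    then show ?thesis using ev by (simp add: null_sets_def emeasure_eq_measure)
  qed
  have hit: "\<omega> \<in> L b" if b: "0 < b" "b < 1" and reg: "regular \<omega>"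
    and inside: "\<And>t. t \<in> {0..1} \<Longrightarrow> \<bar>X t \<omega>\<bar> \<le> r \<and> u * (X t \<omega> - g t) \<le> 0"
    and t: "t \<in> {b..1}" "X t \<omega> = g t" for \<omega> b t
  proof -
    have xc: "continuous_on {0..1} (\<lambda>t. X t \<omega>)" using reg X_continuous by (auto simp: regular_def)
    have "uniformly_continuous_on {0..1} (\<lambda>t. X t \<omega>)" "uniformly_continuous_on {0..1} g"
      using compact_uniformly_continuous[OF xc] compact_uniformly_continuous[OF g] by auto
    then obtain d1 d2 where d: "0 < d1" "0 < d2"
      "\<And>s t. s \<in> {0..1} \<Longrightarrow> t \<in> {0..1} \<Longrightarrow> \<bar>s - t\<bar> < d1 \<Longrightarrow> \<bar>X s \<omega> - X t \<omega>\<bar> < b / 2"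
      "\<And>s t. s \<in> {0..1} \<Longrightarrow> t \<in> {0..1} \<Longrightarrow> \<bar>s - t\<bar> < d2 \<Longrightarrow> \<bar>g s - g t\<bar> < b / 2"
      unfolding uniformly_continuous_on_def dist_real_def using b by (metis half_gt_zero)
    have "eventually (\<lambda>n. 1 / real n < min (min d1 d2) (b / 2)) sequentially"
      by (rule order_tendstoD(2)[OF lim_1_over_n[where 'a = real]]) (use d b in auto)
    then have "eventually (\<lambda>n. 0 < n \<and> 1 / real n < min (min d1 d2) (b / 2)) sequentially"
      using eventually_gt_at_top[of 0] by eventually_elim auto
    then obtain N where N: "\<And>n. N \<le> n \<Longrightarrow> 0 < n \<and> 1 / real n < min (min d1 d2) (b / 2)"
      by (auto simp: eventually_sequentially)
    have e1: "2 * K * b * exp K + b \<le> \<epsilon> b"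
    proof -
      have "2 * K * b * exp K + b * 1 \<le> 2 * K * b * exp K + b * exp K" using b D(1) by (intro add_left_mono mult_left_mono) auto
      also have "\<dots> \<le> 3 * K * b * exp K + 3 * b * exp K" using b D(1) by (intro add_mono mult_right_mono) auto
      also have "\<dots> = \<epsilon> b" by (simp add: \<epsilon>_def algebra_simps)
      finally show ?thesis by simp
    qed
    have "\<omega> \<in> B b n" if "N \<le> n" for n
    proof -
      note n = N[OF that]
      have err: "\<bar>late_euler r b n j \<omega> - X (late_time b n j) \<omega>\<bar> \<le> 2 * K * b * exp K" if "j \<le> n" for j
      proof (rule late_euler_error[OF db r b reg _ _ _ _ that])
        show "\<bar>X s \<omega> - X t \<omega>\<bar> \<le> b / 2" if "s \<in> {0..1}" "t \<in> {0..1}" "\<bar>s - t\<bar> \<le> 1 / real n" for s t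
          using d(3)[OF that(1,2)] that(3) n by simp
      qed (use inside n in auto)
      have t01: "late_time b n j \<in> {0..1}" if "j \<le> n" for j using late_time_in[OF b that] b by auto
      have up: "u * (late_euler r b n j \<omega> - g (late_time b n j)) \<le> \<epsilon> b" if j: "j \<le> n" for j
      proof -
        have "u * (X (late_time b n j) \<omega> - g (late_time b n j)) \<le> 0" using inside[OF t01[OF j]] by simp
        then show ?thesis using err[OF j] u e1 b by auto
      qed
      obtain j where j: "j \<le> n" "\<bar>late_time b n j - t\<bar> \<le> 1 / real n"
        using late_time_near[OF b _ t(1), of n] n by auto
      have t': "t \<in> {0..1}" using t b by auto
      have "\<bar>X (late_time b n j) \<omega> - X t \<omega>\<bar> < b / 2" "\<bar>g (late_time b n j) - g t\<bar> < b / 2"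
        using d(3)[OF t01[OF j(1)] t'] d(4)[OF t01[OF j(1)] t'] j(2) n by auto
      then have "\<bar>late_euler r b n j \<omega> - g (late_time b n j)\<bar> \<le> \<epsilon> b"
        using err[OF j(1)] e1 t(2) by linarith
      then have "- \<epsilon> b \<le> u * (late_euler r b n j \<omega> - g (late_time b n j))" using u by auto
      then show ?thesis using up j reg unfolding B_def regular_def by auto
    qed
    then have "\<forall>i. \<omega> \<in> B b (n0 + N + i)" by simp
    then show ?thesis unfolding L_def by blast
  qed
  have "AE \<omega> in M. \<forall>m. \<omega> \<notin> (\<Inter>i. L (a (m + i)))"
    unfolding AE_all_countable using AE_not_in[OF null] by blast
  then show ?thesis
    using AE_regular
  proof eventually_elim
    case (elim \<omega>)
    show ?case
    proof
      assume c: "(\<forall>t\<in>{0..1}. \<bar>X t \<omega>\<bar> \<le> r \<and> u * (X t \<omega> - g t) \<le> 0) \<and> (\<exists>t\<in>{0..1}. X t \<omega> = g t)"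
      then obtain t where t: "t \<in> {0..1}" "X t \<omega> = g t" by blast
      have "t \<noteq> 0" using t start regular_X0[OF elim(2)] by auto
      then have t0: "0 < t" using t by auto
      have "eventually (\<lambda>m. a m < t) sequentially"
      proof -
        have "a \<longlonglongrightarrow> 0" using LIMSEQ_ignore_initial_segment[OF lim_1_over_n[where 'a = real], of 2] by (simp add: a_def[abs_def] add.commute)
        then show ?thesis using t0 by (rule order_tendstoD)
      qed
      then obtain m where "\<forall>i\<ge>m. a i < t" by (auto simp: eventually_sequentially)
      then have m: "a (m + i) < t" for i by simp
      have "\<omega> \<in> L (a (m + i))" for i
      proof -
        have ti: "t \<in> {a (m + i)..1}" using m[of i] t by simp
        show ?thesis by (rule hit[OF a elim(2) _ ti t(2)]) (use c in auto)
      qed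
      then show False using elim(1) by auto
    qed
  qed
qed

end

section \<open>The approximating chain\<close>

lemma normal_density_shift: "normal_density m \<sigma> y = normal_density 0 \<sigma> (y - m)"
  by (simp add: normal_density_def)

lemma normal_measure_mean:
  assumes "0 < \<sigma>"
  shows "integrable (normal_measure \<sigma>) (\<lambda>u. u)" "(LINT u|normal_measure \<sigma>. u) = 0"
  using normal_moment_nz_1[OF assms, of 0]
  by (auto simp: normal_measure_def has_bochner_integral_iff integrable_density integral_density)

locale corridor = diffusion mu M W X x0
  for mu :: "real \<Rightarrow> real \<Rightarrow> real" and M :: "'a measure" and W X :: "real \<Rightarrow> 'a \<Rightarrow> real" and x0 :: real +
  fixes gminus gplus :: "real \<Rightarrow> real" and V :: "real \<Rightarrow> complex" and phi :: "real \<Rightarrow> real" and \<delta> \<gamma> :: real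
  assumes g_continuous: "continuous_on {0..1} gminus" "continuous_on {0..1} gplus"
    and g_start: "gminus 0 < x0" "x0 < gplus 0"
    and g_gap: "(INF t\<in>{0..1}. gplus t - gminus t) > 0"
    and V: "continuous_on UNIV V"
    and phi: "continuous_on UNIV phi"
    and \<delta>: "0 < \<delta>" "\<delta> \<le> 1/2"
    and \<gamma>: "\<gamma> > 0"
begin

definition gap :: real where "gap = (INF t\<in>{0..1}. gplus t - gminus t)"

lemma gap: "0 < gap" "t \<in> {0..1} \<Longrightarrow> gap \<le> gplus t - gminus t"
proof -
  show "0 < gap" using g_gap by (simp add: gap_def)
  have "continuous_on {0..1} (\<lambda>t. gplus t - gminus t)" by (intro continuous_intros g_continuous)
  then have "compact ((\<lambda>t. gplus t - gminus t) ` {0..1})" by (intro compact_continuous_image) auto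
  then have "bdd_below ((\<lambda>t. gplus t - gminus t) ` {0..1})" by (intro bounded_imp_bdd_below compact_imp_bounded)
  then show "t \<in> {0..1} \<Longrightarrow> gap \<le> gplus t - gminus t" unfolding gap_def by (intro cINF_lower)
qed

definition radius :: real where
  "radius = (SOME r. 0 < r \<and> (\<forall>t\<in>{0..1}. \<bar>gminus t\<bar> \<le> r \<and> \<bar>gplus t\<bar> \<le> r))"

lemma radius: "0 < radius" "t \<in> {0..1} \<Longrightarrow> \<bar>gminus t\<bar> \<le> radius" "t \<in> {0..1} \<Longrightarrow> \<bar>gplus t\<bar> \<le> radius"
proof -
  have "bounded (gminus ` {0..1})" "bounded (gplus ` {0..1})"
    using g_continuous by (auto intro!: compact_imp_bounded compact_continuous_image)
  then obtain a b where ab: "\<forall>t\<in>{0..1}. \<bar>gminus t\<bar> \<le> a" "\<forall>t\<in>{0..1}. \<bar>gplus t\<bar> \<le> b"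
    unfolding bounded_iff by (auto simp: image_iff)
  have "\<exists>r. 0 < r \<and> (\<forall>t\<in>{0..1}. \<bar>gminus t\<bar> \<le> r \<and> \<bar>gplus t\<bar> \<le> r)"
  proof (intro exI[of _ "max 1 (max a b)"] conjI ballI)
    fix t :: real assume "t \<in> {0..1}"
    then show "\<bar>gminus t\<bar> \<le> max 1 (max a b)" "\<bar>gplus t\<bar> \<le> max 1 (max a b)" using ab by fastforce+
  qed simp
  from someI_ex[OF this, folded radius_def]
  show "0 < radius" "t \<in> {0..1} \<Longrightarrow> \<bar>gminus t\<bar> \<le> radius" "t \<in> {0..1} \<Longrightarrow> \<bar>gplus t\<bar> \<le> radius" by auto
qed

definition lip :: real where "lip = (SOME K. drift_bound K radius)"

lemma lip: "drift_bound lip radius"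
  unfolding lip_def by (rule someI_ex[OF drift_bound_exists[OF radius(1)]])

abbreviation "gmesh \<equiv> mesh gminus gplus \<delta> \<gamma>"
abbreviation "rgrid \<equiv> restricted_grid x0 gminus gplus \<delta> \<gamma>"

definition scale :: "nat \<Rightarrow> real" where "scale n = time_step n powr (1/2 + \<delta>)"

text \<open>The coupling error of \<open>lattice_coupling\<close>, with the ratio of standard deviation to mesh replaced by
  its lower bound over all steps.\<close>

definition eta :: "nat \<Rightarrow> real" where
  "eta n = 1000 * exp (- (\<gamma> / 4 * (sqrt (time_step n) / scale n))\<^sup>2 / 1300)"

text \<open>Beyond 0 < n the conditions guarantee, in order: an integer part of at least 1 in the
  mesh; a mesh of at most 1/1000 of the standard deviation, as the mesh is at most (2/\<gamma>)
  scale and the slope at least 1/2; slopes between 1/2 and 3/2.\<close>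

definition large :: "nat \<Rightarrow> bool" where
  "large n \<longleftrightarrow> 0 < n \<and> scale n \<le> \<gamma> * gap \<and> 4000 / \<gamma> * scale n \<le> sqrt (time_step n) \<and> lip * time_step n \<le> 1"

lemma eta_nonneg: "0 \<le> eta n" by (simp add: eta_def)

lemma time_point_in: "k \<le> n \<Longrightarrow> time_point n k \<in> {0..1}"
  by (cases "n = 0") (auto simp: time_point_def divide_le_eq)

text \<open>For z >= 1 the integer part of z is at least z/2; this is the factor 2 over
  1/\<gamma>.\<close>

lemma mesh_bounds:
  assumes n: "large n" and k: "1 \<le> k" "k \<le> n"
  shows "0 < gmesh n k" "gmesh n k \<le> 2 / \<gamma> * scale n"
proof -
  have n0: "0 < n" "scale n \<le> \<gamma> * gap" using n by (auto simp: large_def)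
  define w where "w = gplus (time_point n k) - gminus (time_point n k)"
  define s where "s = mesh_scale \<delta> n k"
  have ts: "0 < time_step n" "time_step n \<le> 1" using n0 by (auto simp: time_step_def)
  have w: "gap \<le> w" unfolding w_def by (rule gap(2)[OF time_point_in[OF k(2)]])
  then have w0: "0 < w" using gap(1) by linarith
  have s0: "0 < s" using ts by (simp add: s_def mesh_scale_def)
  have ss: "s \<le> scale n"
  proof (cases "k = n")
    case True
    \<comment> \<open>The last time step uses the scale \<open>time_step n\<close>; by \<delta> <=
      1/2 it is no coarser than the others, so one bound serves all steps.\<close>
    have "time_step n powr 1 \<le> time_step n powr (1/2 + \<delta>)" using ts \<delta> by (intro powr_mono') auto
    then show ?thesis using True ts by (simp add: s_def mesh_scale_def scale_def)
  qed (simp add: s_def mesh_scale_def scale_def)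
  define z where "z = \<gamma> * w / s"
  have "\<gamma> * gap \<le> \<gamma> * w" using w \<gamma> by (intro mult_left_mono) auto
  then have "s \<le> \<gamma> * w" using ss n0 by linarith
  then have z1: "1 \<le> z" using s0 by (simp add: z_def)
  define l where "l = (of_int \<lfloor>z\<rfloor> :: real)"
  have l: "1 \<le> l" "z < l + 1" using z1 by (auto simp: l_def)
  have zl: "z / 2 \<le> l" using l by linarith
  have eq: "gmesh n k = w / l"
    unfolding mesh_def mesh_ratio_def Let_def using s0
    by (simp add: w_def[symmetric] s_def[symmetric] z_def[symmetric] l_def)
  show "0 < gmesh n k" unfolding eq using w0 l by simp
  have "w / l \<le> w / (z / 2)" using zl z1 w0 by (intro divide_left_mono) auto
  also have "\<dots> = 2 / \<gamma> * s" using w0 \<gamma> s0 by (simp add: z_def)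
  also have "\<dots> \<le> 2 / \<gamma> * scale n" using ss \<gamma> by (intro mult_left_mono) auto
  finally show "gmesh n k \<le> 2 / \<gamma> * scale n" unfolding eq .
qed

lemma rgridD:
  assumes "x \<in> rgrid n k"
  shows "gminus (time_point n k) < x" "x < gplus (time_point n k)"
  using assms g_start by (auto simp: restricted_grid_def time_point_def split: if_splits)

lemma rgrid_abs_le:
  assumes "x \<in> rgrid n k" "k \<le> n" shows "\<bar>x\<bar> \<le> radius"
  using rgridD[OF assms(1)] radius(2,3)[OF time_point_in[OF assms(2)]] by linarith

lemma rgridI:
  assumes "0 < k" "y = gplus (time_point n k) - of_int j * gmesh n k"
    "gminus (time_point n k) < y" "y < gplus (time_point n k)"
  shows "y \<in> rgrid n k"
  using assms by (auto simp: restricted_grid_def grid_def)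

lemma finite_rgrid:
  assumes n: "large n" and k: "k \<le> n" shows "finite (rgrid n k)"
proof (cases "k = 0")
  case False
  let ?t = "time_point n k" and ?h = "gmesh n k"
  have h: "0 < ?h" using mesh_bounds(1)[OF n _ k] False by simp
  have "rgrid n k \<subseteq> (\<lambda>j::int. gplus ?t - of_int j * ?h) ` {0..\<lceil>(gplus ?t - gminus ?t) / ?h\<rceil>}"
  proof
    fix x assume x: "x \<in> rgrid n k"
    then obtain j :: int where j: "x = gplus ?t - of_int j * ?h"
      using False by (auto simp: restricted_grid_def grid_def)
    have "0 < of_int j * ?h" "of_int j * ?h < gplus ?t - gminus ?t" using rgridD[OF x] j by auto
    then have "0 < (of_int j :: real)" "of_int j < (gplus ?t - gminus ?t) / ?h"
      using h by (auto simp: zero_less_mult_iff pos_less_divide_eq)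
    then have "j \<in> {0..\<lceil>(gplus ?t - gminus ?t) / ?h\<rceil>}" by (auto simp: le_ceiling_iff)
    then show "x \<in> (\<lambda>j::int. gplus ?t - of_int j * ?h) ` {0..\<lceil>(gplus ?t - gminus ?t) / ?h\<rceil>}" using j by blast
  qed
  then show ?thesis by (rule finite_subset) simp
qed (simp add: restricted_grid_def)

definition increment :: "nat \<Rightarrow> nat \<Rightarrow> 'a \<Rightarrow> real" where
  "increment n k \<omega> = W (time_point n (Suc k)) \<omega> - W (time_point n k) \<omega>"

lemma increment_distributed:
  assumes "k < n" shows "distributed M lborel (increment n k) (normal_density 0 (sqrt (time_step n)))"
proof -
  have "time_point n (Suc k) - time_point n k = time_step n"
    by (simp add: time_point_def time_step_def add_divide_distrib)
  moreover have "time_point n k < time_point n (Suc k)" using assms by (simp add: time_point_def divide_strict_right_mono)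
  ultimately show ?thesis
    using normal_increments[of "time_point n k" "time_point n (Suc k)"] time_point_in[of k n] time_point_in[of "Suc k" n] assms
    by (simp add: increment_def[abs_def])
qed

lemma increment_indep:
  assumes "0 < n" shows "indep_vars (\<lambda>_. borel) (increment n) {..<n}"
  unfolding increment_def[abs_def]
  by (rule indep_increments) (use time_point_in assms in \<open>auto simp: time_point_def divide_strict_right_mono\<close>)

text \<open>For large n, the standard deviation of the transition over [t_k, t_(k+1)] divided by
  sqrt \<Delta>. Steps are counted from 0 here, so \<open>k\<close> belongs to
  \<open>discrete_drift\<close> and \<open>discrete_variance\<close> at
  \<open>Suc k\<close>.\<close>

definition slope :: "nat \<Rightarrow> nat \<Rightarrow> real \<Rightarrow> real" where
  "slope n k x = 1 + 1/2 * time_step n * partial_x mu (time_point n k) x"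

text \<open>Everything that later arguments use of the coupling for one step. Positivity of the
  weight is included because, with the relative bound, it forces the coupled probability to be
  positive, so that the two may be divided.\<close>

definition is_step_map :: "nat \<Rightarrow> nat \<Rightarrow> real \<Rightarrow> (real \<Rightarrow> real) \<Rightarrow> bool" where
  "is_step_map n k x T \<longleftrightarrow> T \<in> borel_measurable borel \<and>
    (\<forall>w. \<bar>T w - (x + discrete_drift mu n (Suc k) x + slope n k x * w)\<bar> \<le> 2 * gmesh n (Suc k)) \<and>
    (\<forall>w. \<exists>j::int. T w = gplus (time_point n (Suc k)) - of_int j * gmesh n (Suc k)) \<and>
    (\<forall>y\<in>rgrid n (Suc k). \<bar>transition_weight mu gminus gplus \<delta> \<gamma> n (Suc k) x y - prob {\<omega> \<in> space M. T (increment n k \<omega>) = y}\<bar>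
        \<le> eta n * prob {\<omega> \<in> space M. T (increment n k \<omega>) = y} \<and> 0 < transition_weight mu gminus gplus \<delta> \<gamma> n (Suc k) x y) \<and>
    \<bar>expectation (\<lambda>\<omega>. T (increment n k \<omega>) - (x + discrete_drift mu n (Suc k) x + slope n k x * increment n k \<omega>))\<bar> \<le> 2 * eta n"

lemma slope_bounds:
  assumes n: "large n" and k: "k \<le> n" and x: "x \<in> rgrid n k"
  shows "1/2 \<le> slope n k x" "slope n k x \<le> 3/2"
proof -
  have "\<bar>partial_x mu (time_point n k) x\<bar> \<le> lip"
    by (rule drift_boundD(3)[OF lip time_point_in[OF k] rgrid_abs_le[OF x k]])
  moreover have t: "0 \<le> time_step n" by (simp add: time_step_def)
  ultimately have "\<bar>1/2 * time_step n * partial_x mu (time_point n k) x\<bar> \<le> 1/2 * time_step n * lip"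
    unfolding abs_mult by (intro mult_mono) auto
  also have "\<dots> \<le> 1/2" using n by (simp add: large_def mult.commute)
  finally show "1/2 \<le> slope n k x" "slope n k x \<le> 3/2" unfolding slope_def by linarith+
qed

text \<open>The increment times the slope is Gaussian with the standard deviation of the scheme. It
  is coupled to the grid, anchored at the upper boundary and shifted back by the predicted mean
  \<open>m\<close>; adding \<open>m\<close> gives the step. The bias \<eta> \<sigma> becomes 2 eta
  because \<sigma> <= 2.\<close>

lemma step_map_exists:
  assumes n: "large n" and k: "k < n" and x: "x \<in> rgrid n k"
  shows "\<exists>T. is_step_map n k x T"
proof -
  define \<Delta> where "\<Delta> = time_step n"
  define s where "s = slope n k x"
  define h where "h = gmesh n (Suc k)"
  define m where "m = x + discrete_drift mu n (Suc k) x"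
  define \<sigma> where "\<sigma> = s * sqrt \<Delta>"
  define G where "G = gplus (time_point n (Suc k))"
  have n0: "0 < n" "4000 / \<gamma> * scale n \<le> sqrt \<Delta>" using n by (auto simp: large_def \<Delta>_def)
  have \<Delta>: "0 < \<Delta>" "sqrt \<Delta> \<le> 1" using n0 by (auto simp: \<Delta>_def time_step_def)
  have sc: "0 < scale n" using n0 by (simp add: scale_def time_step_def)
  have s: "1/2 \<le> s" "s \<le> 3/2" using slope_bounds[OF n _ x] k by (auto simp: s_def)
  have h: "0 < h" "h \<le> 2 / \<gamma> * scale n" using mesh_bounds[OF n, of "Suc k"] k by (auto simp: h_def)
  have \<sigma>: "0 < \<sigma>" "1/2 * sqrt \<Delta> \<le> \<sigma>" using s \<Delta> by (auto simp: \<sigma>_def)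
  have \<sigma>2: "\<sigma> \<le> 2"
  proof -
    have "s * sqrt \<Delta> \<le> (3/2) * 1" using s \<Delta> by (intro mult_mono) auto
    then show ?thesis by (simp add: \<sigma>_def)
  qed
  have "1000 * h \<le> 1000 * (2 / \<gamma> * scale n)" using h by simp
  also have "\<dots> = 1/2 * (4000 / \<gamma> * scale n)" by simp
  also have "\<dots> \<le> 1/2 * sqrt \<Delta>" using n0 by simp
  finally have hs: "1000 * h \<le> \<sigma>" using \<sigma>(2) by linarith
  define \<eta> where "\<eta> = 1000 * exp (- (\<sigma> / h)\<^sup>2 / 1300)"
  have \<eta>: "\<eta> \<le> eta n"
  proof -
    have "\<gamma> / 4 * (sqrt \<Delta> / scale n) = (1/2 * sqrt \<Delta>) / (2 / \<gamma> * scale n)" using \<gamma> sc by (simp add: field_simps)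
    also have "\<dots> \<le> \<sigma> / h" using \<sigma> h \<Delta> by (intro frac_le) auto
    finally have "(\<gamma> / 4 * (sqrt \<Delta> / scale n))\<^sup>2 \<le> (\<sigma> / h)\<^sup>2" using \<gamma> sc \<Delta> by (intro power_mono) auto
    then show ?thesis by (simp add: \<eta>_def eta_def \<Delta>_def)
  qed
  obtain S where S: "S \<in> borel_measurable borel" "\<And>u. \<bar>S u - u\<bar> \<le> 2 * h" "\<And>u. \<exists>j::int. S u = (G - m) + of_int j * h"
    "\<And>j::int. \<bar>h * normal_density 0 \<sigma> ((G - m) + of_int j * h) - measure (normal_measure \<sigma>) {u. S u = (G - m) + of_int j * h}\<bar>
        \<le> \<eta> * measure (normal_measure \<sigma>) {u. S u = (G - m) + of_int j * h}"
    "\<bar>LINT u|normal_measure \<sigma>. S u\<bar> \<le> \<eta> * \<sigma>"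
    using lattice_coupling[OF h(1) hs, of "G - m"] unfolding \<eta>_def by blast
  note S(1)[measurable]
  let ?T = "\<lambda>w. m + S (s * w)"
  interpret N: prob_space "normal_measure \<sigma>" by (rule prob_space_normal_measure[OF \<sigma>(1)])
  have rv: "increment n k \<in> borel_measurable M" using distributed_measurable[OF increment_distributed[OF k]] by simp
  then have rv': "(\<lambda>\<omega>. s * increment n k \<omega>) \<in> borel_measurable M" by simp
  have dist: "distr M borel (\<lambda>\<omega>. s * increment n k \<omega>) = normal_measure \<sigma>"
  proof -
    have "distributed M lborel (\<lambda>\<omega>. 0 + s * increment n k \<omega>) (normal_density (0 + s * 0) (\<bar>s\<bar> * sqrt \<Delta>))"
      by (rule normal_density_affine[OF increment_distributed[OF k, folded \<Delta>_def]]) (use \<Delta> s in auto)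
    then have "distributed M lborel (\<lambda>\<omega>. s * increment n k \<omega>) (normal_density 0 \<sigma>)" using s by (simp add: \<sigma>_def)
    from distributed_distr_eq_density[OF this] show ?thesis by (simp add: normal_measure_def cong: distr_cong)
  qed
  have pr: "prob {\<omega> \<in> space M. ?T (increment n k \<omega>) = y} = measure (normal_measure \<sigma>) {u. S u = y - m}" for y
  proof -
    have "measure (normal_measure \<sigma>) {u. S u = y - m} = prob ((\<lambda>\<omega>. s * increment n k \<omega>) -` {u. S u = y - m} \<inter> space M)"
      unfolding dist[symmetric] by (rule measure_distr[OF rv']) measurable
    also have "(\<lambda>\<omega>. s * increment n k \<omega>) -` {u. S u = y - m} \<inter> space M = {\<omega> \<in> space M. ?T (increment n k \<omega>) = y}"
      by auto
    finally show ?thesis ..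
  qed
  have sd: "sqrt (discrete_variance mu n (Suc k) x) = \<sigma>"
    using s \<Delta> by (simp add: discrete_variance_def \<sigma>_def s_def slope_def \<Delta>_def real_sqrt_mult)
  have "is_step_map n k x ?T"
    unfolding is_step_map_def m_def[symmetric] s_def[symmetric] h_def[symmetric] G_def[symmetric]
  proof (intro conjI allI ballI)
    show "?T \<in> borel_measurable borel" by measurable
    show "\<bar>?T w - (m + s * w)\<bar> \<le> 2 * h" for w using S(2)[of "s * w"] by simp
    show "\<exists>j::int. ?T w = G - of_int j * h" for w
    proof -
      obtain j :: int where "S (s * w) = (G - m) + of_int j * h" using S(3) by blast
      then show ?thesis by (intro exI[of _ "- j"]) simp
    qed
    fix y assume y: "y \<in> rgrid n (Suc k)"
    then obtain j :: int where j: "y = G - of_int j * h"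
      by (auto simp: restricted_grid_def grid_def G_def h_def)
    have ym: "y - m = (G - m) + of_int (- j) * h" by (simp add: j)
    have tw: "transition_weight mu gminus gplus \<delta> \<gamma> n (Suc k) x y = h * normal_density 0 \<sigma> (y - m)"
      unfolding transition_weight_def sd m_def h_def by (subst normal_density_shift) (simp add: mult.commute)
    show "0 < transition_weight mu gminus gplus \<delta> \<gamma> n (Suc k) x y"
      unfolding tw using h \<sigma> by (simp add: normal_density_pos)
    have "\<bar>transition_weight mu gminus gplus \<delta> \<gamma> n (Suc k) x y - measure (normal_measure \<sigma>) {u. S u = y - m}\<bar>
      \<le> \<eta> * measure (normal_measure \<sigma>) {u. S u = y - m}"
      unfolding tw using S(4)[of "- j"] by (simp only: ym)
    also have "\<dots> \<le> eta n * measure (normal_measure \<sigma>) {u. S u = y - m}"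
      using \<eta> by (intro mult_right_mono) auto
    finally show "\<bar>transition_weight mu gminus gplus \<delta> \<gamma> n (Suc k) x y - prob {\<omega> \<in> space M. ?T (increment n k \<omega>) = y}\<bar>
      \<le> eta n * prob {\<omega> \<in> space M. ?T (increment n k \<omega>) = y}" unfolding pr .
  next
    have i1: "integrable (normal_measure \<sigma>) (\<lambda>u. S u - u)"
      by (rule N.integrable_const_bound[where B = "2 * h"]) (use S(2) in auto)
    note i2 = normal_measure_mean[OF \<sigma>(1)]
    have i3: "integrable (normal_measure \<sigma>) S"
      using Bochner_Integration.integrable_add[OF i1 i2(1)] by simp
    have "expectation (\<lambda>\<omega>. ?T (increment n k \<omega>) - (m + s * increment n k \<omega>)) = expectation (\<lambda>\<omega>. S (s * increment n k \<omega>) - s * increment n k \<omega>)"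
      by simp
    also have "\<dots> = (LINT u|normal_measure \<sigma>. S u - u)"
      unfolding dist[symmetric] by (rule integral_distr[symmetric]) (use rv' in auto)
    also have "\<dots> = (LINT u|normal_measure \<sigma>. S u)" using i2 i3 by simp
    finally have "\<bar>expectation (\<lambda>\<omega>. ?T (increment n k \<omega>) - (m + s * increment n k \<omega>))\<bar> \<le> \<eta> * \<sigma>" using S(5) by simp
    also have "\<dots> \<le> eta n * 2" using \<eta> \<sigma> \<sigma>2 eta_nonneg by (intro mult_mono) auto
    finally show "\<bar>expectation (\<lambda>\<omega>. ?T (increment n k \<omega>) - (m + s * increment n k \<omega>))\<bar> \<le> 2 * eta n" by simp
  qed
  then show ?thesis by blast
qed

definition step_map :: "nat \<Rightarrow> nat \<Rightarrow> real \<Rightarrow> real \<Rightarrow> real" where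
  "step_map n k x = (SOME T. is_step_map n k x T)"

lemma step_map: "large n \<Longrightarrow> k < n \<Longrightarrow> x \<in> rgrid n k \<Longrightarrow> is_step_map n k x (step_map n k x)"
  unfolding step_map_def by (rule someI_ex[OF step_map_exists])

lemma driven_chain: "large n \<Longrightarrow> driven_chain M (increment n) n (rgrid n) (step_map n)"
  by unfold_locales (use step_map finite_rgrid increment_indep in \<open>auto simp: is_step_map_def large_def\<close>)

end

context driven_chain
begin

text \<open>Chernoff bounds for both signs at each of the n + 1 times and a union bound; hence the
  factor 2 (n + 1).\<close>

lemma noise_tail:
  assumes R_measurable: "\<And>k x. k < n \<Longrightarrow> x \<in> A k \<Longrightarrow> R k x \<in> borel_measurable borel"
    and R_bound: "\<And>k x w. k < n \<Longrightarrow> x \<in> A k \<Longrightarrow> \<bar>R k x w\<bar> \<le> b"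
    and R_mean: "\<And>k x. k < n \<Longrightarrow> x \<in> A k \<Longrightarrow> \<bar>expectation (\<lambda>\<omega>. R k x (\<xi> k \<omega>))\<bar> \<le> e"
    and b0: "0 \<le> b" and e0: "0 \<le> e" and l: "0 < l" "l * b \<le> 1"
  shows "{\<omega> \<in> space M. \<exists>k\<le>n. t \<le> \<bar>noise R k \<omega>\<bar>} \<in> events"
    and "prob {\<omega> \<in> space M. \<exists>k\<le>n. t \<le> \<bar>noise R k \<omega>\<bar>}
      \<le> 2 * (real n + 1) * exp (- l * t) * exp (real n * (l * e + (l * b)\<^sup>2))"
proof -
  let ?c = "exp (real n * (l * e + (l * b)\<^sup>2))"
  have m: "noise R k \<in> borel_measurable M" if "k \<le> n" for k
    by (rule measurable_past_imp_measurable[OF rv noise_measurable[OF R_measurable R_bound R_mean b0 e0 that]]) (use that in auto)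
  have int: "integrable M (\<lambda>\<omega>. exp (s * noise R k \<omega>))" if "k \<le> n" for s k
  proof (rule integrable_const_bound[where B = "exp (\<bar>s\<bar> * (real k * b))"])
    show "AE \<omega> in M. norm (exp (s * noise R k \<omega>)) \<le> exp (\<bar>s\<bar> * (real k * b))"
    proof (rule AE_I2)
      fix \<omega>
      have "s * noise R k \<omega> \<le> \<bar>s\<bar> * \<bar>noise R k \<omega>\<bar>" by (metis abs_ge_self abs_mult)
      also have "\<dots> \<le> \<bar>s\<bar> * (real k * b)"
        using noise_bound[OF R_measurable R_bound R_mean b0 e0 that, where \<omega> = \<omega>] by (intro mult_left_mono) auto
      finally show "norm (exp (s * noise R k \<omega>)) \<le> exp (\<bar>s\<bar> * (real k * b))" by simp
    qed
    show "(\<lambda>\<omega>. exp (s * noise R k \<omega>)) \<in> borel_measurable M" using m[OF that] by measurable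
  qed
  have mgf: "expectation (\<lambda>\<omega>. exp (s * noise R k \<omega>)) \<le> ?c" if k: "k \<le> n" and s: "\<bar>s\<bar> = l" for s k
  proof -
    have sb: "\<bar>s\<bar> * b \<le> 1" using s l by simp
    have "expectation (\<lambda>\<omega>. exp (s * noise R k \<omega>)) \<le> (1 + \<bar>s\<bar> * e + (s * b)\<^sup>2) ^ k"
      by (rule noise_mgf[OF R_measurable R_bound R_mean b0 e0 sb k])
    also have "(s * b)\<^sup>2 = (l * b)\<^sup>2" unfolding s[symmetric] by (simp add: power_mult_distrib)
    also have "1 + \<bar>s\<bar> * e + (l * b)\<^sup>2 = 1 + (l * e + (l * b)\<^sup>2)" using s by simp
    also have "(1 + (l * e + (l * b)\<^sup>2)) ^ k \<le> ?c"
    proof (rule one_plus_power_le_exp)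
      show "0 \<le> l * e + (l * b)\<^sup>2" using l e0 by simp
      then show "real k * (l * e + (l * b)\<^sup>2) \<le> real n * (l * e + (l * b)\<^sup>2)" using k by (intro mult_right_mono) auto
    qed
    finally show ?thesis .
  qed
  have ev: "{\<omega> \<in> space M. t \<le> \<bar>noise R k \<omega>\<bar>} \<in> events" if "k \<le> n" for k using m[OF that] by measurable
  have one: "prob {\<omega> \<in> space M. t \<le> \<bar>noise R k \<omega>\<bar>} \<le> 2 * (exp (- l * t) * ?c)" if k: "k \<le> n" for k
  proof -
    have sp: "set_integrable M (space M) (\<lambda>\<omega>. exp (s * noise R k \<omega>))" for s
      using int[OF k, of s] unfolding set_integrable_def by (simp cong: Bochner_Integration.integrable_cong)
    have up: "prob {\<omega> \<in> space M. t \<le> noise R k \<omega>} \<le> exp (- l * t) * ?c"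
    proof -
      have "prob {\<omega> \<in> space M. t \<le> noise R k \<omega>} \<le> exp (- l * t) * (LINT \<omega>:space M|M. exp (l * noise R k \<omega>))"
        by (rule Chernoff_ineq_ge[OF l(1) sp]) simp
      also have "\<dots> \<le> exp (- l * t) * ?c"
        using mgf[OF k, of l] l int[OF k, of l] by (intro mult_left_mono) (auto simp: set_integral_space)
      finally show ?thesis .
    qed
    have lo: "prob {\<omega> \<in> space M. noise R k \<omega> \<le> - t} \<le> exp (- l * t) * ?c"
    proof -
      have "prob {\<omega> \<in> space M. noise R k \<omega> \<le> - t} \<le> exp (l * (- t)) * (LINT \<omega>:space M|M. exp (- l * noise R k \<omega>))"
        by (rule Chernoff_ineq_le[OF l(1) sp]) simp
      also have "\<dots> \<le> exp (l * (- t)) * ?c"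
        using mgf[OF k, of "- l"] l int[OF k, of "- l"] by (intro mult_left_mono) (auto simp: set_integral_space)
      finally show ?thesis by simp
    qed
    have "{\<omega> \<in> space M. t \<le> \<bar>noise R k \<omega>\<bar>} \<subseteq> {\<omega> \<in> space M. t \<le> noise R k \<omega>} \<union> {\<omega> \<in> space M. noise R k \<omega> \<le> - t}" by auto
    then have "prob {\<omega> \<in> space M. t \<le> \<bar>noise R k \<omega>\<bar>} \<le> prob ({\<omega> \<in> space M. t \<le> noise R k \<omega>} \<union> {\<omega> \<in> space M. noise R k \<omega> \<le> - t})"
      by (rule finite_measure_mono) (use m[OF k] in measurable)
    also have "\<dots> \<le> prob {\<omega> \<in> space M. t \<le> noise R k \<omega>} + prob {\<omega> \<in> space M. noise R k \<omega> \<le> - t}"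
      by (rule measure_Un_le) (use m[OF k] in measurable)
    finally show ?thesis using up lo by linarith
  qed
  have eq: "{\<omega> \<in> space M. \<exists>k\<le>n. t \<le> \<bar>noise R k \<omega>\<bar>} = (\<Union>k\<in>{..n}. {\<omega> \<in> space M. t \<le> \<bar>noise R k \<omega>\<bar>})" by auto
  show "{\<omega> \<in> space M. \<exists>k\<le>n. t \<le> \<bar>noise R k \<omega>\<bar>} \<in> events" unfolding eq using ev by auto
  have "prob {\<omega> \<in> space M. \<exists>k\<le>n. t \<le> \<bar>noise R k \<omega>\<bar>} \<le> (\<Sum>k\<in>{..n}. prob {\<omega> \<in> space M. t \<le> \<bar>noise R k \<omega>\<bar>})"
    unfolding eq by (rule finite_measure_subadditive_finite) (use ev in auto)
  also have "\<dots> \<le> (\<Sum>k\<in>{..n}. 2 * (exp (- l * t) * ?c))" by (rule sum_mono) (use one in auto)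
  finally show "prob {\<omega> \<in> space M. \<exists>k\<le>n. t \<le> \<bar>noise R k \<omega>\<bar>}
      \<le> 2 * (real n + 1) * exp (- l * t) * exp (real n * (l * e + (l * b)\<^sup>2))" by (simp add: algebra_simps)
qed

end

section \<open>Exact representation of the matrix product, and smallness of the rounding\<close>

context corridor
begin

definition state :: "nat \<Rightarrow> nat \<Rightarrow> 'a \<Rightarrow> real" where
  "state n k \<omega> = chain x0 (rgrid n) (step_map n) (increment n) k \<omega>"

definition alive_upto :: "nat \<Rightarrow> nat \<Rightarrow> 'a \<Rightarrow> bool" where
  "alive_upto n k \<omega> \<longleftrightarrow> (\<forall>j\<le>k. state n j \<omega> \<in> rgrid n j)"

text \<open>Density of the kernel of the scheme with respect to the kernel of the chain; multiplying
  by it corrects the coupling error exactly.\<close>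

definition mass_ratio :: "nat \<Rightarrow> nat \<Rightarrow> real \<Rightarrow> real \<Rightarrow> real" where
  "mass_ratio n k x y = transition_weight mu gminus gplus \<delta> \<gamma> n (Suc k) x y / prob {\<omega> \<in> space M. step_map n k x (increment n k \<omega>) = y}"

definition step_factor :: "nat \<Rightarrow> nat \<Rightarrow> real \<Rightarrow> real \<Rightarrow> complex" where
  "step_factor n k x y = complex_of_real (mass_ratio n k x y) * complex_of_real (bridge_factor gminus gplus n (Suc k) x y) * potential_factor V n x y"

definition weighted :: "nat \<Rightarrow> 'a \<Rightarrow> complex" where
  "weighted n \<omega> = of_bool (alive_upto n n \<omega>) * (\<Prod>j<n. step_factor n j (state n j \<omega>) (state n (Suc j) \<omega>)) * complex_of_real (phi (state n n \<omega>))"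

definition rounding :: "nat \<Rightarrow> nat \<Rightarrow> real \<Rightarrow> real \<Rightarrow> real" where
  "rounding n k x w = step_map n k x w - (x + discrete_drift mu n (Suc k) x + slope n k x * w)"

definition total_rounding :: "nat \<Rightarrow> nat \<Rightarrow> 'a \<Rightarrow> real" where
  "total_rounding n k \<omega> = (\<Sum>j<k. if alive_upto n j \<omega> then rounding n j (state n j \<omega>) (increment n j \<omega>) else 0)"

lemma mass_ratio_bound:
  assumes "large n" "k < n" "x \<in> rgrid n k" "y \<in> rgrid n (Suc k)"
  shows "\<bar>mass_ratio n k x y - 1\<bar> \<le> eta n" "0 < prob {\<omega> \<in> space M. step_map n k x (increment n k \<omega>) = y}"
proof -
  let ?p = "prob {\<omega> \<in> space M. step_map n k x (increment n k \<omega>) = y}" and ?w = "transition_weight mu gminus gplus \<delta> \<gamma> n (Suc k) x y"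
  have *: "\<bar>?w - ?p\<bar> \<le> eta n * ?p" "0 < ?w"
    using step_map[OF assms(1-3)] assms(4) by (auto simp: is_step_map_def)
  then show p: "0 < ?p" by (cases "?p = 0") (auto simp: measure_nonneg less_le)
  have "mass_ratio n k x y - 1 = (?w - ?p) / ?p"
    unfolding mass_ratio_def diff_divide_distrib using p by simp
  then have "\<bar>mass_ratio n k x y - 1\<bar> = \<bar>?w - ?p\<bar> / ?p" using p by (simp only: abs_divide abs_of_pos)
  also have "\<dots> \<le> eta n" using * p by (simp add: divide_le_eq)
  finally show "\<bar>mass_ratio n k x y - 1\<bar> \<le> eta n" .
qed

text \<open>The mass ratio cancels the probability of the coupled step, so every entry of a step
  matrix is a step factor times a transition probability of the chain, and the recursions agree. The
  representation is exact; the coupling error survives only inside the integrand.\<close>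

lemma matrix_approximation_eq:
  assumes n: "large n"
  shows "matrix_approximation x0 mu gminus gplus V phi \<delta> \<gamma> n = expectation (weighted n)" and "integrable M (weighted n)"
proof -
  interpret C: driven_chain M "increment n" n x0 "rgrid n" "step_map n" by (rule driven_chain[OF n])
  let ?u = "\<lambda>k y. expectation (\<lambda>\<omega>. C.path_weight (step_factor n) k \<omega> * of_bool (C.Y k \<omega> = y))"
  have sp: "step_product x0 mu gminus gplus V \<delta> \<gamma> n k x0 y = ?u k y" if "k \<le> n" "y \<in> rgrid n k" for k y
    using that
  proof (induction k arbitrary: y)
    case 0
    have r0: "rgrid n 0 = {x0}" by (simp add: restricted_grid_def)
    then show ?case using 0 by (simp add: C.path_weight_def C.alive_def prob_space)
  next
    case (Suc k)
    then have k: "k < n" "k \<le> n" by auto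
    have "step_product x0 mu gminus gplus V \<delta> \<gamma> n (Suc k) x0 y
      = (\<Sum>x\<in>rgrid n k. ?u k x * step_matrix mu gminus gplus V \<delta> \<gamma> n (Suc k) x y)"
      using Suc.IH[OF k(2)] by (simp add: matrix_mult_over_def)
    also have "\<dots> = (\<Sum>x\<in>rgrid n k. ?u k x * (step_factor n k x y * of_real (prob {\<omega> \<in> space M. step_map n k x (increment n k \<omega>) = y})))"
    proof (rule sum.cong[OF refl])
      fix x assume x: "x \<in> rgrid n k"
      have "0 < prob {\<omega> \<in> space M. step_map n k x (increment n k \<omega>) = y}" by (rule mass_ratio_bound(2)[OF n k(1) x Suc.prems(2)])
      then have "step_matrix mu gminus gplus V \<delta> \<gamma> n (Suc k) x y
        = step_factor n k x y * of_real (prob {\<omega> \<in> space M. step_map n k x (increment n k \<omega>) = y})"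
        by (simp add: step_matrix_def step_factor_def mass_ratio_def)
      then show "?u k x * step_matrix mu gminus gplus V \<delta> \<gamma> n (Suc k) x y
        = ?u k x * (step_factor n k x y * of_real (prob {\<omega> \<in> space M. step_map n k x (increment n k \<omega>) = y}))" by simp
    qed
    also have "\<dots> = ?u (Suc k) y" by (rule C.expectation_path_weight_Suc[OF k(1) Suc.prems(2), symmetric])
    finally show ?case .
  qed
  have al: "alive_upto n k \<omega> \<longleftrightarrow> C.alive k \<omega>" for k \<omega> by (simp add: alive_upto_def C.alive_def state_def)
  have w: "weighted n \<omega> = (\<Sum>y\<in>rgrid n n. C.path_weight (step_factor n) n \<omega> * of_bool (C.Y n \<omega> = y) * complex_of_real (phi y))" for \<omega>
  proof (cases "C.alive n \<omega>")
    case True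
    have "(\<Sum>y\<in>rgrid n n. C.path_weight (step_factor n) n \<omega> * of_bool (C.Y n \<omega> = y) * complex_of_real (phi y))
      = (\<Sum>y\<in>rgrid n n. of_bool (C.Y n \<omega> = y) * (C.path_weight (step_factor n) n \<omega> * complex_of_real (phi y)))"
      by (rule sum.cong[OF refl]) (simp only: mult.assoc mult.left_commute)
    also have "\<dots> = C.path_weight (step_factor n) n \<omega> * complex_of_real (phi (C.Y n \<omega>))"
      by (rule C.sum_over_state[symmetric, OF finite_rgrid[OF n order_refl] C.alive_mem[OF True]])
    finally show ?thesis using True unfolding weighted_def al C.path_weight_def state_def by simp
  next
    case False
    then show ?thesis unfolding weighted_def al C.path_weight_def by simp
  qed
  have I: "integrable M (\<lambda>\<omega>. C.path_weight (step_factor n) n \<omega> * of_bool (C.Y n \<omega> = y))" for y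
    by (rule C.path_weight_integrable) simp
  show "integrable M (weighted n)"
    unfolding w[abs_def] by (rule Bochner_Integration.integrable_sum) (rule integrable_mult_left, rule I)
  have "matrix_approximation x0 mu gminus gplus V phi \<delta> \<gamma> n = (\<Sum>y\<in>rgrid n n. ?u n y * complex_of_real (phi y))"
    by (simp add: matrix_approximation_def matrix_vec_over_def sp)
  also have "\<dots> = (\<Sum>y\<in>rgrid n n. expectation (\<lambda>\<omega>. C.path_weight (step_factor n) n \<omega> * of_bool (C.Y n \<omega> = y) * complex_of_real (phi y)))"
    by (rule sum.cong[OF refl]) (rule integral_mult_left_zero[symmetric])
  also have "\<dots> = expectation (weighted n)"
    unfolding w[abs_def] by (rule Bochner_Integration.integral_sum[symmetric]) (rule integrable_mult_left, rule I)
  finally show "matrix_approximation x0 mu gminus gplus V phi \<delta> \<gamma> n = expectation (weighted n)" .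
qed

text \<open>sqrt \<Delta> / scale equals n^\<delta>, and 20800 = 16 * 1300.\<close>

lemma eta_eq: "0 < n \<Longrightarrow> eta n = 1000 * exp (- (\<gamma>\<^sup>2 / 20800) * real n powr (2 * \<delta>))"
proof -
  assume n: "0 < n"
  have "sqrt (time_step n) / scale n = real n powr \<delta>"
  proof -
    have "sqrt (time_step n) = time_step n powr (1/2)" using n by (simp add: powr_half_sqrt time_step_def)
    then have "sqrt (time_step n) / scale n = time_step n powr (1/2 - (1/2 + \<delta>))"
      by (simp only: scale_def powr_diff)
    also have "\<dots> = real n powr \<delta>" using n by (simp add: time_step_def powr_divide powr_minus)
    finally show ?thesis .
  qed
  moreover have "(real n powr \<delta>)\<^sup>2 = real n powr (2 * \<delta>)"
    by (simp add: power2_eq_square powr_add[symmetric])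
  ultimately show ?thesis by (simp add: eta_def power_mult_distrib power_divide)
qed

text \<open>A stretched exponential beats every power of n. The first limit controls the product of
  n mass ratios, the second the bias in the exponential moment bound with parameter
  n^\<delta>.\<close>

lemma eta_limits:
  "(\<lambda>n. real n * eta n) \<longlonglongrightarrow> 0" "(\<lambda>n. real n * (real n powr \<delta> * (2 * eta n))) \<longlonglongrightarrow> 0"
proof -
  define c where "c = \<gamma>\<^sup>2 / 20800"
  have c: "0 < c" using \<gamma> by (simp add: c_def)
  have e: "eventually (\<lambda>n. eta n = 1000 * exp (- c * real n powr (2 * \<delta>))) sequentially"
    using eventually_gt_at_top[of 0] by eventually_elim (simp add: eta_eq c_def)
  have "(\<lambda>n. real n * (1000 * exp (- c * real n powr (2 * \<delta>)))) \<longlonglongrightarrow> 0"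
    using c \<delta>(1) by real_asymp
  then show "(\<lambda>n. real n * eta n) \<longlonglongrightarrow> 0"
    by (rule Lim_transform_eventually) (use e in \<open>auto elim: eventually_mono\<close>)
  have "(\<lambda>n. real n * (real n powr \<delta> * (2 * (1000 * exp (- c * real n powr (2 * \<delta>)))))) \<longlonglongrightarrow> 0"
    using c \<delta>(1) by real_asymp
  then show "(\<lambda>n. real n * (real n powr \<delta> * (2 * eta n))) \<longlonglongrightarrow> 0"
    by (rule Lim_transform_eventually) (use e in \<open>auto elim: eventually_mono\<close>)
qed

lemma eventually_large: "eventually large sequentially"
proof -
  define a where "a = \<gamma> * gap"
  define b where "b = 4000 / \<gamma>"
  have ab: "0 < a" "0 < b" using \<gamma> gap(1) by (auto simp: a_def b_def)
  have 1: "eventually (\<lambda>n. (1 / real n) powr (1/2 + \<delta>) \<le> a) sequentially" using ab \<delta>(1) by real_asymp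
  have 2: "eventually (\<lambda>n. b * (1 / real n) powr (1/2 + \<delta>) \<le> sqrt (1 / real n)) sequentially" using ab \<delta>(1) by real_asymp
  have "(\<lambda>n. lip * (1 / real n)) \<longlonglongrightarrow> lip * 0" by (intro tendsto_intros lim_1_over_n)
  then have "eventually (\<lambda>n. lip * (1 / real n) < 1) sequentially" by (rule order_tendstoD) simp
  then have 3: "eventually (\<lambda>n. lip * (1 / real n) \<le> 1) sequentially" by eventually_elim simp
  show ?thesis
    using 1 2 3 eventually_gt_at_top[of 0]
    by eventually_elim (simp add: large_def scale_def time_step_def a_def b_def)
qed

text \<open>Chernoff with l = n^\<delta>: then l b is of order n^(-1/2), so the exponential moments
  stay bounded over n steps, while l times the threshold n^(-\<delta>/2) is n^(\<delta>/2). The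
  failure probabilities decay faster than any power of n.\<close>

lemma AE_total_rounding:
  "AE \<omega> in M. eventually (\<lambda>n. \<forall>k\<le>n. \<bar>total_rounding n k \<omega>\<bar> < time_step n powr (\<delta> / 2)) sequentially"
proof -
  \<comment> \<open>Twice the bound (2/\<gamma>) scale on the mesh, since the rounding error is at
    most two meshes.\<close>
  define b where "b = (\<lambda>n. 4 / \<gamma> * scale n)"
  define l where "l = (\<lambda>n. real n powr \<delta>)"
  define p where "p = (\<lambda>n. 2 * (real n + 1) * exp (- l n * time_step n powr (\<delta> / 2)) * exp (real n * (l n * (2 * eta n) + (l n * b n)\<^sup>2)))"
  define E where "E = (\<lambda>n. if large n \<and> l n * b n \<le> 1 then {\<omega> \<in> space M. \<exists>k\<le>n. time_step n powr (\<delta> / 2) \<le> \<bar>total_rounding n k \<omega>\<bar>} else {})"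
  have E: "E n \<in> events" "large n \<and> l n * b n \<le> 1 \<Longrightarrow> prob (E n) \<le> p n" for n
  proof -
    have "E n \<in> events \<and> prob (E n) \<le> p n" if n: "large n" "l n * b n \<le> 1"
    proof -
      interpret C: driven_chain M "increment n" n x0 "rgrid n" "step_map n" by (rule driven_chain[OF n(1)])
      have al: "alive_upto n k \<omega> \<longleftrightarrow> C.alive k \<omega>" for k \<omega> by (simp add: alive_upto_def C.alive_def state_def)
      have tr: "total_rounding n k \<omega> = C.noise (rounding n) k \<omega>" for k \<omega>
        unfolding total_rounding_def C.noise_def al state_def ..
      note sm = step_map[OF n(1)]
      have n0: "0 < n" using n by (simp add: large_def)
      have 1: "rounding n k x \<in> borel_measurable borel" if "k < n" "x \<in> rgrid n k" for k x
      proof -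
        have [measurable]: "step_map n k x \<in> borel_measurable borel" using sm[OF that] by (simp add: is_step_map_def)
        show ?thesis unfolding rounding_def[abs_def] by measurable
      qed
      have 2: "\<bar>rounding n k x w\<bar> \<le> b n" if "k < n" "x \<in> rgrid n k" for k x w
      proof -
        have "\<bar>rounding n k x w\<bar> \<le> 2 * gmesh n (Suc k)" using sm[OF that] by (simp add: is_step_map_def rounding_def)
        then show ?thesis using mesh_bounds(2)[OF n(1), of "Suc k"] that by (simp add: b_def)
      qed
      have 3: "\<bar>expectation (\<lambda>\<omega>. rounding n k x (increment n k \<omega>))\<bar> \<le> 2 * eta n" if "k < n" "x \<in> rgrid n k" for k x
        using sm[OF that] by (simp add: is_step_map_def rounding_def)
      have 4: "0 \<le> b n" "0 < l n" "0 \<le> 2 * eta n" using \<gamma> n0 by (auto simp: b_def l_def scale_def eta_nonneg)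
      have "{\<omega> \<in> space M. \<exists>k\<le>n. time_step n powr (\<delta> / 2) \<le> \<bar>C.noise (rounding n) k \<omega>\<bar>} \<in> events"
        by (rule C.noise_tail(1)[where R = "rounding n" and b = "b n" and e = "2 * eta n" and l = "l n" and t = "time_step n powr (\<delta> / 2)"]) (fact 4 n(2) | (rule 1 2 3; assumption))+
      moreover have "prob {\<omega> \<in> space M. \<exists>k\<le>n. time_step n powr (\<delta> / 2) \<le> \<bar>C.noise (rounding n) k \<omega>\<bar>} \<le> p n"
        unfolding p_def by (rule C.noise_tail(2)[where R = "rounding n" and b = "b n" and e = "2 * eta n" and l = "l n" and t = "time_step n powr (\<delta> / 2)"]) (fact 4 n(2) | (rule 1 2 3; assumption))+
      moreover have "E n = {\<omega> \<in> space M. \<exists>k\<le>n. time_step n powr (\<delta> / 2) \<le> \<bar>total_rounding n k \<omega>\<bar>}"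
        unfolding E_def by (rule if_P) (use n in blast)
      ultimately show ?thesis unfolding tr by (simp only:)
    qed
    then have P: "large n \<and> l n * b n \<le> 1 \<Longrightarrow> E n \<in> events \<and> prob (E n) \<le> p n" by blast
    then show "large n \<and> l n * b n \<le> 1 \<Longrightarrow> prob (E n) \<le> p n" by blast
    show "E n \<in> events"
    proof (cases "large n \<and> l n * b n \<le> 1")
      case True then show ?thesis using P by blast
    next
      case False
      then have "E n = {}" unfolding E_def by (rule if_not_P)
      then show ?thesis by (simp only: sets.empty_sets)
    qed
  qed
  have lb: "eventually (\<lambda>n. l n * b n \<le> 1 \<and> real n * (l n * b n)\<^sup>2 = (4 / \<gamma>)\<^sup>2) sequentially"
  proof -
    have eq: "l n * b n = 4 / \<gamma> * sqrt (1 / real n)" if n: "0 < n" for n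
    proof -
      have "real n powr \<delta> * scale n = (1 / real n) powr (1/2)"
      proof -
        have "scale n = (1 / real n) powr (1/2) * (1 / real n) powr \<delta>" by (simp add: scale_def time_step_def powr_add)
        moreover have "real n powr \<delta> * (1 / real n) powr \<delta> = 1" using n by (simp add: powr_divide)
        ultimately show ?thesis by (simp add: mult_ac)
      qed
      then show ?thesis using n by (simp add: l_def b_def powr_half_sqrt mult_ac)
    qed
    define g where "g = 4 / \<gamma>"
    have "0 < g" using \<gamma> by (simp add: g_def)
    then have "eventually (\<lambda>n. g * sqrt (1 / real n) \<le> 1) sequentially" by real_asymp
    then show ?thesis using eventually_gt_at_top[of 0]
    proof eventually_elim
      case (elim n)
      have "real n * (4 / \<gamma> * sqrt (1 / real n))\<^sup>2 = (4 / \<gamma>)\<^sup>2"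
      proof -
        have "(sqrt (1 / real n))\<^sup>2 = 1 / real n" by simp
        then have "real n * (4 / \<gamma> * sqrt (1 / real n))\<^sup>2 = real n * ((4 / \<gamma>)\<^sup>2 * (1 / real n))" by (simp only: power_mult_distrib)
        then show ?thesis using elim(2) by simp
      qed
      then show ?case using elim by (simp add: eq g_def)
    qed
  qed
  have pb: "eventually (\<lambda>n. p n \<le> 1 / real n ^ 2) sequentially"
  proof -
    define C where "C = exp (1 + (4 / \<gamma>)\<^sup>2)"
    have "eventually (\<lambda>n. real n * (real n powr \<delta> * (2 * eta n)) < 1) sequentially"
      by (rule order_tendstoD(2)[OF eta_limits(2)]) simp
    moreover have "eventually (\<lambda>n. 2 * (real n + 1) * exp (- (real n powr \<delta> * (1 / real n) powr (\<delta> / 2))) * C \<le> 1 / real n ^ 2) sequentially"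
      using \<delta>(1) by real_asymp
    ultimately show ?thesis using lb
    proof eventually_elim
      case (elim n)
      have "exp (real n * (l n * (2 * eta n) + (l n * b n)\<^sup>2)) \<le> C"
        using elim unfolding C_def by (simp add: l_def distrib_left)
      then have "p n \<le> 2 * (real n + 1) * exp (- l n * time_step n powr (\<delta> / 2)) * C"
        unfolding p_def by (intro mult_left_mono) auto
      then show ?case using elim(2) by (simp add: l_def time_step_def)
    qed
  qed
  have "summable (\<lambda>n. prob (E n))"
  proof (rule summable_comparison_test_ev)
    show "eventually (\<lambda>n. norm (prob (E n)) \<le> 1 / real n ^ 2) sequentially"
      using pb lb eventually_large
    proof eventually_elim
      case (elim n) then show ?case using E(2)[of n] by simp
    qed
    show "summable (\<lambda>n. 1 / real n ^ 2)"
      using inverse_power_summable[of 2, where 'a = real] by (simp add: inverse_eq_divide)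
  qed
  then have "AE \<omega> in M. eventually (\<lambda>n. \<omega> \<in> space M - E n) sequentially"
    by (intro borel_cantelli_AE1) (use E(1) in \<open>auto simp: less_top[symmetric]\<close>)
  then show ?thesis
  proof eventually_elim
    case (elim \<omega>)
    then show ?case using lb eventually_large
    proof eventually_elim
      case (elim n)
      have "E n = {\<omega> \<in> space M. \<exists>k\<le>n. time_step n powr (\<delta> / 2) \<le> \<bar>total_rounding n k \<omega>\<bar>}"
        unfolding E_def by (rule if_P) (use elim in blast)
      then show ?case using elim(1) unfolding not_le[symmetric] by blast
    qed
  qed
qed

end

section \<open>Convergence\<close>

lemma prod_near_one:
  fixes a :: "nat \<Rightarrow> real"
  assumes a: "\<And>j. j < n \<Longrightarrow> \<bar>a j - 1\<bar> \<le> e" and e: "0 \<le> e"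
  shows "\<bar>(\<Prod>j<n. a j) - 1\<bar> \<le> exp (real n * e) - 1"
proof -
  have "\<bar>(\<Prod>j<n. a j) - 1\<bar> \<le> (1 + e) ^ n - 1"
    using a
  proof (induction n)
    case (Suc n)
    have IH: "\<bar>(\<Prod>j<n. a j) - 1\<bar> \<le> (1 + e) ^ n - 1" by (rule Suc.IH) (use Suc.prems in auto)
    have an: "\<bar>a n - 1\<bar> \<le> e" by (rule Suc.prems) simp
    have "(\<Prod>j<Suc n. a j) - 1 = ((\<Prod>j<n. a j) - 1) * a n + (a n - 1)" by (simp add: algebra_simps)
    then have "\<bar>(\<Prod>j<Suc n. a j) - 1\<bar> \<le> \<bar>(\<Prod>j<n. a j) - 1\<bar> * \<bar>a n\<bar> + \<bar>a n - 1\<bar>"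
      by (simp only: abs_mult[symmetric] abs_triangle_ineq)
    also have "\<dots> \<le> ((1 + e) ^ n - 1) * (1 + e) + e"
      using IH an e by (intro add_mono mult_mono) auto
    also have "\<dots> = (1 + e) ^ Suc n - 1" by (simp add: algebra_simps)
    finally show ?case .
  qed simp
  also have "(1 + e) ^ n \<le> exp (real n * e)" by (rule one_plus_power_le_exp) (use e in auto)
  finally show ?thesis by simp
qed

lemma time_point_near:
  assumes n: "0 < n" and t: "t \<in> {0..1}"
  shows "\<exists>j\<le>n. \<bar>time_point n j - t\<bar> \<le> 1 / real n"
proof -
  define j where "j = nat \<lfloor>t * real n\<rfloor>"
  have j: "real j \<le> t * real n" "t * real n < real j + 1" using t by (auto simp: j_def)
  have "t * real n \<le> 1 * real n" using t by (intro mult_right_mono) auto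
  then have jn: "j \<le> n" using j by simp
  have "\<bar>time_point n j - t\<bar> = \<bar>real j - t * real n\<bar> / real n"
    using n by (simp add: time_point_def field_simps flip: abs_div_pos)
  also have "\<dots> \<le> 1 / real n" using j by (intro divide_right_mono) auto
  finally show ?thesis using jn by auto
qed

lemma time_point_Suc: "time_point n (Suc j) = time_point n j + time_step n"
  by (simp add: time_point_def time_step_def add_divide_distrib)

lemma time_point_le: "time_point n j \<le> time_point n (Suc j)"
  by (simp add: time_point_def divide_right_mono)

text \<open>The node values \<open>v\<close> are arbitrary numbers near f on the adjacent cells, so
  that the sum may be formed along the chain while the integral is along the diffusion.\<close>

lemma trapezoid_sum_error:
  fixes f :: "real \<Rightarrow> 'b::{banach, real_normed_field}"
  assumes n: "0 < n" and f: "continuous_on {0..1} f"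
    and near: "\<And>j s. j < n \<Longrightarrow> s \<in> {time_point n j..time_point n (Suc j)} \<Longrightarrow>
      norm (f s - v j) \<le> e \<and> norm (f s - v (Suc j)) \<le> e"
  shows "norm (integral {0..1} f - (\<Sum>j<n. of_real (time_step n) / 2 * (v j + v (Suc j)))) \<le> e"
proof -
  have D: "time_step n = 1 / real n" "0 < time_step n" using n by (auto simp: time_step_def)
  have tp: "0 \<le> time_point n j" for j by (simp add: time_point_def)
  have tp1: "time_point n j \<le> 1" if "j \<le> n" for j using that n by (simp add: time_point_def)
  have io: "f integrable_on {a..b}" if "0 \<le> a" "b \<le> 1" for a b
    by (rule integrable_continuous_real[OF continuous_on_subset[OF f]]) (use that in auto)
  have split: "integral {0..time_point n k} f = (\<Sum>j<k. integral {time_point n j..time_point n (Suc j)} f)" if "k \<le> n" for k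
    using that
  proof (induction k)
    case 0 then show ?case by (simp add: time_point_def)
  next
    case (Suc k)
    have "integral {0..time_point n k} f + integral {time_point n k..time_point n (Suc k)} f = integral {0..time_point n (Suc k)} f"
      by (rule Henstock_Kurzweil_Integration.integral_combine[OF tp time_point_le io]) (use tp1[of "Suc k"] Suc.prems in auto)
    then show ?case using Suc by simp
  qed
  have "time_point n n = 1" using n by (simp add: time_point_def)
  then have "integral {0..1} f - (\<Sum>j<n. of_real (time_step n) / 2 * (v j + v (Suc j)))
    = (\<Sum>j<n. integral {time_point n j..time_point n (Suc j)} f - of_real (time_step n) / 2 * (v j + v (Suc j)))"
    using split[of n] by (simp add: sum_subtractf)
  also have "norm \<dots> \<le> (\<Sum>j<n. time_step n * e)"
  proof (rule order.trans[OF norm_sum sum_mono])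
    fix j assume "j \<in> {..<n}"
    then have j: "j < n" by simp
    let ?I = "{time_point n j..time_point n (Suc j)}" and ?c = "(v j + v (Suc j)) / 2"
    have c: "continuous_on ?I f" by (rule continuous_on_subset[OF f]) (use tp[of j] tp1[of "Suc j"] j in auto)
    have "norm (integral ?I (\<lambda>s. f s - ?c)) \<le> e * (time_point n (Suc j) - time_point n j)"
    proof (rule integral_bound[OF time_point_le])
      show "continuous_on ?I (\<lambda>s. f s - ?c)" by (intro continuous_intros c)
      fix s assume s: "s \<in> ?I"
      have eq: "f s - ?c = ((f s - v j) + (f s - v (Suc j))) / 2" by (simp add: field_simps)
      have "norm (f s - ?c) = norm ((f s - v j) + (f s - v (Suc j))) / 2" unfolding eq norm_divide by simp
      also have "\<dots> \<le> (e + e) / 2"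
        by (rule divide_right_mono[OF order.trans[OF norm_triangle_ineq add_mono]]) (use near[OF j s] in auto)
      finally show "norm (f s - ?c) \<le> e" by simp
    qed
    also have "integral ?I (\<lambda>s. f s - ?c) = integral ?I f - of_real (time_step n) / 2 * (v j + v (Suc j))"
      using integrable_continuous_real[OF c] time_point_le[of n j]
      by (subst Henstock_Kurzweil_Integration.integral_diff) (auto simp: time_point_Suc scaleR_conv_of_real D(2) less_imp_le)
    finally show "norm (integral ?I f - of_real (time_step n) / 2 * (v j + v (Suc j))) \<le> time_step n * e"
      by (simp add: time_point_Suc mult.commute)
  qed
  also have "\<dots> = e" using n by (simp add: D(1))
  finally show ?thesis .
qed

section \<open>Pathwise convergence of the weighted functional\<close>

context corridor
begin

definition trapezoid :: "nat \<Rightarrow> (nat \<Rightarrow> real) \<Rightarrow> complex" where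
  "trapezoid n y = (\<Sum>j<n. complex_of_real (time_step n) / 2 * (V (y j) + V (y (Suc j))))"

text \<open>V is uniformly continuous on an interval extending the range of x by 1, and y eventually
  stays in it. Taking for y the values of x at the nodes yields the limit behind
  \<open>potential_integral_measurable\<close>.\<close>

lemma trapezoid_tendsto:
  assumes x: "continuous_on {0..1} x"
    and y: "\<And>e. 0 < e \<Longrightarrow> eventually (\<lambda>n. \<forall>j\<le>n. \<bar>y n j - x (time_point n j)\<bar> < e) sequentially"
  shows "(\<lambda>n. trapezoid n (y n)) \<longlonglongrightarrow> (LINT s:{0..1}|lborel. V (x s))"
proof (rule LIMSEQ_I)
  fix e :: real assume e: "0 < e"
  have "bounded (x ` {0..1})" using x by (intro compact_imp_bounded compact_continuous_image) auto
  then obtain r where "\<forall>t\<in>{0..1}. \<bar>x t\<bar> \<le> r" unfolding bounded_iff by auto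
  then have r: "\<bar>x t\<bar> \<le> r" if "t \<in> {0..1}" for t using that by blast
  have "uniformly_continuous_on {-(r+1)..r+1} V"
    by (rule compact_uniformly_continuous[OF continuous_on_subset[OF V]]) auto
  then obtain d where d: "0 < d" "\<And>u v. u \<in> {-(r+1)..r+1} \<Longrightarrow> v \<in> {-(r+1)..r+1} \<Longrightarrow> dist u v < d \<Longrightarrow> dist (V u) (V v) < e / 2"
    unfolding uniformly_continuous_on_def using e by (metis half_gt_zero)
  have "uniformly_continuous_on {0..1} x" by (rule compact_uniformly_continuous[OF x]) simp
  then obtain c where c: "0 < c" "\<And>s t. s \<in> {0..1} \<Longrightarrow> t \<in> {0..1} \<Longrightarrow> dist s t < c \<Longrightarrow> dist (x s) (x t) < d / 2"
    unfolding uniformly_continuous_on_def using d(1) by (metis half_gt_zero)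
  have "eventually (\<lambda>n. 1 / real n < c) sequentially"
    by (rule order_tendstoD(2)[OF lim_1_over_n[where 'a = real]]) (rule c(1))
  moreover have "eventually (\<lambda>n. \<forall>j\<le>n. \<bar>y n j - x (time_point n j)\<bar> < min 1 (d / 2)) sequentially"
    using d(1) by (intro y) simp
  ultimately have ev: "eventually (\<lambda>n. norm (trapezoid n (y n) - (LINT s:{0..1}|lborel. V (x s))) < e) sequentially"
    using eventually_gt_at_top[of 0]
  proof eventually_elim
    case (elim n)
    have f: "continuous_on {0..1} (\<lambda>s. V (x s))"
      by (rule continuous_on_compose2[OF V x]) auto
    have tp01: "time_point n j \<in> {0..1}" if "j \<le> n" for j by (rule time_point_in[OF that])
    have close: "norm (V (x s) - V (y n i)) \<le> e / 2" if s: "s \<in> {0..1}" and i: "i \<le> n" "dist s (time_point n i) < c" for s i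
    proof -
      have a: "\<bar>y n i - x (time_point n i)\<bar> < min 1 (d / 2)" using elim(2) i by blast
      have b: "\<bar>x s - x (time_point n i)\<bar> < d / 2" using c(2)[OF s tp01[OF i(1)] i(2)] by (simp add: dist_real_def)
      have "dist (x s) (y n i) < d" using a b unfolding dist_real_def by linarith
      moreover have "x s \<in> {-(r+1)..r+1}" "y n i \<in> {-(r+1)..r+1}"
        using r[OF s] r[OF tp01[OF i(1)]] a by (auto simp: abs_le_iff abs_less_iff)
      ultimately show ?thesis using d(2) by (simp add: dist_norm less_imp_le)
    qed
    have D: "time_step n = 1 / real n" by (simp add: time_step_def)
    have "norm (integral {0..1} (\<lambda>s. V (x s)) - (\<Sum>j<n. of_real (time_step n) / 2 * (V (y n j) + V (y n (Suc j))))) \<le> e / 2"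
    proof (rule trapezoid_sum_error[OF elim(3) f])
      fix j s assume j: "j < n" and s: "s \<in> {time_point n j..time_point n (Suc j)}"
      have s01: "s \<in> {0..1}" using s tp01[of j] tp01[of "Suc j"] j by auto
      have "dist s (time_point n j) < c" "dist s (time_point n (Suc j)) < c"
        using s elim(1) time_point_Suc[of n j] D by (auto simp: dist_real_def)
      then show "norm (V (x s) - V (y n j)) \<le> e / 2 \<and> norm (V (x s) - V (y n (Suc j))) \<le> e / 2"
        using close[OF s01, of j] close[OF s01, of "Suc j"] j by simp
    qed
    moreover have "(LINT s:{0..1}|lborel. V (x s)) = integral {0..1} (\<lambda>s. V (x s))"
      by (rule set_borel_integral_eq_integral(2)[OF borel_integrable_atLeastAtMost'[OF f]])
    ultimately show ?case using e by (simp add: trapezoid_def norm_minus_commute)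
  qed
  then show "\<exists>N. \<forall>n\<ge>N. norm (trapezoid n (y n) - (LINT s:{0..1}|lborel. V (x s))) < e"
    by (simp add: eventually_sequentially)
qed

definition rounding_small :: "'a \<Rightarrow> bool" where
  "rounding_small \<omega> \<longleftrightarrow> eventually (\<lambda>n. \<forall>k\<le>n. \<bar>total_rounding n k \<omega>\<bar> < time_step n powr (\<delta> / 2)) sequentially"

text \<open>Survival is demanded only strictly before i, so the estimate also covers the state just
  produced; this lets \<open>eventually_alive\<close> proceed by induction.\<close>

lemma state_close:
  assumes reg: "regular \<omega>" and small: "rounding_small \<omega>" and e: "0 < e"
  shows "eventually (\<lambda>n. \<forall>i\<le>n. (\<forall>j<i. state n j \<omega> \<in> rgrid n j) \<longrightarrow> \<bar>state n i \<omega> - X (time_point n i) \<omega>\<bar> < e) sequentially"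
proof -
  have xc: "continuous_on {0..1} (\<lambda>t. X t \<omega>)" using reg X_continuous by (auto simp: regular_def)
  have wc: "continuous_on {0..1} (\<lambda>t. W t \<omega>)" using reg by (simp add: regular_def)
  have "bounded ((\<lambda>t. X t \<omega>) ` {0..1})" using xc by (intro compact_imp_bounded compact_continuous_image) auto
  then obtain r0 where "\<forall>t\<in>{0..1}. \<bar>X t \<omega>\<bar> \<le> r0" unfolding bounded_iff by auto
  then have r0: "\<bar>X t \<omega>\<bar> \<le> r0" if "t \<in> {0..1}" for t using that by blast
  \<comment> \<open>The path may leave the corridor, so the constants depend on its own range; the
    convergence is pathwise, which makes this harmless.\<close>
  define r where "r = max r0 radius"
  have r: "0 < r" "\<And>t. t \<in> {0..1} \<Longrightarrow> \<bar>X t \<omega>\<bar> \<le> r" "radius \<le> r" using r0 radius(1) by (auto simp: r_def le_max_iff_disj)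
  obtain K where db: "drift_bound K r" using drift_bound_exists[OF r(1)] by blast
  have K: "0 \<le> K" by (rule drift_boundD(1)[OF db])
  \<comment> \<open>Chosen so that (om + 2K (om + om) + om) exp(K) = e/2.\<close>
  define om where "om = e / (4 * (2 * K + 1) * exp K)"
  have om: "0 < om" using e K by (simp add: om_def)
  have "uniformly_continuous_on {0..1} (\<lambda>t. X t \<omega>)" "uniformly_continuous_on {0..1} (\<lambda>t. W t \<omega>)"
    using compact_uniformly_continuous[OF xc] compact_uniformly_continuous[OF wc] by auto
  then obtain d1 d2 where d: "0 < d1" "0 < d2"
    "\<And>s t. s \<in> {0..1} \<Longrightarrow> t \<in> {0..1} \<Longrightarrow> \<bar>s - t\<bar> < d1 \<Longrightarrow> \<bar>X s \<omega> - X t \<omega>\<bar> < om"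
    "\<And>s t. s \<in> {0..1} \<Longrightarrow> t \<in> {0..1} \<Longrightarrow> \<bar>s - t\<bar> < d2 \<Longrightarrow> \<bar>W s \<omega> - W t \<omega>\<bar> < om"
    unfolding uniformly_continuous_on_def dist_real_def using om by metis
  have 1: "eventually (\<lambda>n. 1 / real n < min om (min d1 d2)) sequentially"
    by (rule order_tendstoD(2)[OF lim_1_over_n[where 'a = real]]) (use om d in simp)
  have 2: "eventually (\<lambda>n. time_step n powr (\<delta> / 2) < om) sequentially"
  proof -
    have "(\<lambda>n. (1 / real n) powr (\<delta> / 2)) \<longlonglongrightarrow> 0" using \<delta>(1) by real_asymp
    then show ?thesis unfolding time_step_def by (rule order_tendstoD(2)) (rule om)
  qed
  show ?thesis
    using 1 2 small[unfolded rounding_small_def] eventually_large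
  proof eventually_elim
    case (elim n)
    have n0: "0 < n" using elim(4) by (simp add: large_def)
    show ?case
    proof (intro allI impI)
      fix i assume i: "i \<le> n" and al: "\<forall>j<i. state n j \<omega> \<in> rgrid n j"
      define rho where "rho = (\<lambda>j. rounding n j (state n j \<omega>) (increment n j \<omega>))"
      have "\<bar>state n i \<omega> - X (time_point n i) \<omega>\<bar> \<le> (om + 2 * K * (1 / real n + om)) * exp K"
      proof (rule chain_error[OF db n0 i xc r(2), where ?x0.0 = x0 and w = "\<lambda>t. W t \<omega>" and rho = rho])
        show "X t \<omega> = x0 + (LINT s:{0..t}|lborel. mu s (X s \<omega>)) + W t \<omega>" if "t \<in> {0..1}" for t
          using reg that by (simp add: regular_def)
        show "W 0 \<omega> = 0" using reg by (simp add: regular_def)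
        show "\<bar>X s \<omega> - X t \<omega>\<bar> \<le> om \<and> \<bar>W s \<omega> - W t \<omega>\<bar> \<le> om" if "s \<in> {0..1}" "t \<in> {0..1}" "\<bar>s - t\<bar> \<le> 1 / real n" for s t
          using d(3)[OF that(1,2)] d(4)[OF that(1,2)] that(3) elim(1) by simp
        show "state n 0 \<omega> = x0" by (simp add: state_def)
        show "\<bar>state n j \<omega>\<bar> \<le> r" if "j < i" for j
          using rgrid_abs_le[of "state n j \<omega>" n j] al that i r(3) by force
        show "state n (Suc j) \<omega> = state n j \<omega> + discrete_drift mu n (Suc j) (state n j \<omega>)
            + (1 + 1/2 * time_step n * partial_x mu (time_point n j) (state n j \<omega>)) * (W (time_point n (Suc j)) \<omega> - W (time_point n j) \<omega>) + rho j"
          if "j < i" for j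
          using al that by (simp add: state_def rho_def rounding_def slope_def increment_def)
        show "\<bar>\<Sum>j<i'. rho j\<bar> \<le> om" if "i' \<le> i" for i'
        proof -
          have "(\<Sum>j<i'. rho j) = total_rounding n i' \<omega>"
            unfolding total_rounding_def rho_def
            by (rule sum.cong) (use al that in \<open>auto simp: alive_upto_def\<close>)
          then show ?thesis using elim(3) elim(2) i that by (metis order.trans less_imp_le)
        qed
      qed simp_all
      also have "\<dots> < (om + 2 * K * (om + om) + om) * exp K"
      proof (rule mult_strict_right_mono)
        have "2 * K * (1 / real n + om) \<le> 2 * K * (om + om)" using elim(1) K by (intro mult_left_mono add_right_mono) auto
        then show "om + 2 * K * (1 / real n + om) < om + 2 * K * (om + om) + om" using om by linarith
      qed simp
      also have "\<dots> = 2 * ((2 * K + 1) * exp K) * om" by (simp add: algebra_simps)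
      also have "\<dots> = e / 2" using K unfolding om_def by (simp add: divide_simps)
      finally show "\<bar>state n i \<omega> - X (time_point n i) \<omega>\<bar> < e" using e by simp
    qed
  qed
qed

lemma corridor_gap:
  assumes w: "\<omega> \<in> space M" and inside: "\<forall>t\<in>{0..1}. gminus t < X t \<omega> \<and> X t \<omega> < gplus t"
  shows "\<exists>z>0. \<forall>t\<in>{0..1}. gminus t + z \<le> X t \<omega> \<and> X t \<omega> \<le> gplus t - z"
proof -
  let ?f = "\<lambda>t. min (X t \<omega> - gminus t) (gplus t - X t \<omega>)"
  have "continuous_on {0..1} ?f" by (intro continuous_intros X_continuous[OF w] g_continuous)
  then obtain t where t: "t \<in> {0..1}" "\<And>s. s \<in> {0..1} \<Longrightarrow> ?f t \<le> ?f s"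
    using continuous_attains_inf[of "{0..1::real}" ?f] by auto
  show ?thesis
  proof (intro exI[of _ "?f t"] conjI ballI)
    show "0 < ?f t" using inside t(1) by simp
    show "gminus s + ?f t \<le> X s \<omega>" "X s \<omega> \<le> gplus s - ?f t" if "s \<in> {0..1}" for s
      using t(2)[OF that] by linarith+
  qed
qed

text \<open>Induction on time: a chain that has survived so far has its next state within
  \<open>z\<close> of a path keeping distance \<open>z\<close> from the boundaries; this state is a
  lattice point by construction, hence lies in the restricted grid.\<close>

lemma eventually_alive:
  assumes reg: "regular \<omega>" and small: "rounding_small \<omega>"
    and z: "0 < z" "\<forall>t\<in>{0..1}. gminus t + z \<le> X t \<omega> \<and> X t \<omega> \<le> gplus t - z" and e: "0 < e"
  shows "eventually (\<lambda>n. alive_upto n n \<omega> \<and> (\<forall>i\<le>n. \<bar>state n i \<omega> - X (time_point n i) \<omega>\<bar> < e)) sequentially"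
proof -
  have "0 < min e z" using e z by simp
  from state_close[OF reg small this] show ?thesis using eventually_large
  proof eventually_elim
    case (elim n)
    have al: "i \<le> n \<Longrightarrow> state n i \<omega> \<in> rgrid n i" for i
    proof (induction i rule: less_induct)
      case (less i)
      show ?case
      proof (cases i)
        case 0 then show ?thesis by (simp add: state_def restricted_grid_def)
      next
        case (Suc k)
        have close: "\<bar>state n i \<omega> - X (time_point n i) \<omega>\<bar> < min e z" using elim(1) less by simp
        have k: "state n k \<omega> \<in> rgrid n k" "k < n" using less Suc by auto
        have "\<exists>j::int. step_map n k (state n k \<omega>) (increment n k \<omega>) = gplus (time_point n (Suc k)) - of_int j * gmesh n (Suc k)"
          using step_map[OF elim(2) k(2,1)] unfolding is_step_map_def by blast
        then obtain j :: int where "step_map n k (state n k \<omega>) (increment n k \<omega>) = gplus (time_point n (Suc k)) - of_int j * gmesh n (Suc k)" ..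
        then have "state n i \<omega> = gplus (time_point n i) - of_int j * gmesh n i"
          using k(1) Suc by (simp add: state_def)
        then show ?thesis
        proof (rule rgridI[rotated])
          show "gminus (time_point n i) < state n i \<omega>" "state n i \<omega> < gplus (time_point n i)"
            using z(2)[rule_format, OF time_point_in[OF less.prems]] close by linarith+
        qed (simp add: Suc)
      qed
    qed
    then show ?case using elim(1) by (auto simp: alive_upto_def)
  qed
qed

text \<open>The factors converge separately: mass ratios and bridge factors are so close to 1 that n
  of them still multiply to nearly 1, the potential factors combine to the exponential of a
  trapezoidal sum, and phi is continuous.\<close>

lemma weighted_tendsto_inside:
  assumes reg: "regular \<omega>" and small: "rounding_small \<omega>"
    and inside: "\<forall>t\<in>{0..1}. gminus t < X t \<omega> \<and> X t \<omega> < gplus t"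
  shows "(\<lambda>n. weighted n \<omega>) \<longlonglongrightarrow> exp (- (LINT s:{0..1}|lborel. V (X s \<omega>))) * complex_of_real (phi (X 1 \<omega>))"
proof -
  have w: "\<omega> \<in> space M" using reg by (simp add: regular_def)
  obtain z where z: "0 < z" "\<forall>t\<in>{0..1}. gminus t + z \<le> X t \<omega> \<and> X t \<omega> \<le> gplus t - z"
    using corridor_gap[OF w inside] by blast
  note ev = eventually_alive[OF reg small z]
  define rt where "rt = (\<lambda>n j. mass_ratio n j (state n j \<omega>) (state n (Suc j) \<omega>))"
  define br where "br = (\<lambda>n j. bridge_factor gminus gplus n (Suc j) (state n j \<omega>) (state n (Suc j) \<omega>))"
  have 1: "(\<lambda>n. \<Prod>j<n. rt n j) \<longlonglongrightarrow> 1"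
  proof -
    have "(\<lambda>n. exp (real n * eta n) - 1) \<longlonglongrightarrow> exp 0 - 1" by (intro tendsto_intros eta_limits(1))
    then have l: "(\<lambda>n. exp (real n * eta n) - 1) \<longlonglongrightarrow> 0" by simp
    have "eventually (\<lambda>n. norm ((\<Prod>j<n. rt n j) - 1) \<le> exp (real n * eta n) - 1) sequentially"
      using ev[OF zero_less_one] eventually_large
    proof eventually_elim
      case (elim n)
      have "\<bar>(\<Prod>j<n. rt n j) - 1\<bar> \<le> exp (real n * eta n) - 1"
      proof (rule prod_near_one[OF _ eta_nonneg])
        fix j assume "j < n"
        then show "\<bar>rt n j - 1\<bar> \<le> eta n"
          unfolding rt_def using elim by (intro mass_ratio_bound(1)) (auto simp: alive_upto_def)
      qed
      then show ?case by simp
    qed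
    from Lim_null_comparison[OF this l] show ?thesis by (simp add: LIM_zero_iff)
  qed
  have 2: "(\<lambda>n. \<Prod>j<n. br n j) \<longlonglongrightarrow> 1"
  proof -
    \<comment> \<open>Eventually the chain keeps distance z/2 from both boundaries, and
      (2/\<Delta>)(z/2)^2 = n z^2/2; the factor 2 counts the boundaries.\<close>
    define b where "b = (\<lambda>n. 2 * exp (- (real n * z\<^sup>2 / 2)))"
    have "(\<lambda>n. exp (real n * b n) - 1) \<longlonglongrightarrow> exp 0 - 1"
      unfolding b_def using z(1) by (intro tendsto_diff tendsto_exp tendsto_const) real_asymp
    then have l: "(\<lambda>n. exp (real n * b n) - 1) \<longlonglongrightarrow> 0" by simp
    have z2: "0 < z / 2" using z by simp
    have "eventually (\<lambda>n. norm ((\<Prod>j<n. br n j) - 1) \<le> exp (real n * b n) - 1) sequentially"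
      using ev[OF z2] eventually_large
    proof eventually_elim
      case (elim n)
      have n0: "0 < n" using elim(2) by (simp add: large_def)
      have far: "z / 2 \<le> gplus (time_point n i) - state n i \<omega>" "z / 2 \<le> state n i \<omega> - gminus (time_point n i)" if "i \<le> n" for i
      proof -
        have "\<bar>state n i \<omega> - X (time_point n i) \<omega>\<bar> < z / 2" using elim(1) that by blast
        then show "z / 2 \<le> gplus (time_point n i) - state n i \<omega>" "z / 2 \<le> state n i \<omega> - gminus (time_point n i)"
          using z(2)[rule_format, OF time_point_in[OF that]] by linarith+
      qed
      have "\<bar>(\<Prod>j<n. br n j) - 1\<bar> \<le> exp (real n * b n) - 1"
      proof (rule prod_near_one)
        show "0 \<le> b n" by (simp add: b_def)
        fix j assume j: "j < n"
        have expo: "exp (- (2 / time_step n) * p * q) \<le> exp (- (real n * z\<^sup>2 / 2))" if "z\<^sup>2 / 4 \<le> p * q" for p q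
        proof -
          have "real n * (z\<^sup>2 / 4) \<le> real n * (p * q)" using that by (intro mult_left_mono) auto
          then show ?thesis by (simp add: time_step_def mult.assoc)
        qed
        have zz: "(z / 2) * (z / 2) = z\<^sup>2 / 4" by (simp add: power2_eq_square)
        have p1: "z\<^sup>2 / 4 \<le> (gplus (time_point n j) - state n j \<omega>) * (gplus (time_point n (Suc j)) - state n (Suc j) \<omega>)"
          unfolding zz[symmetric] using far[of j] far[of "Suc j"] j z(1) by (intro mult_mono) auto
        have "z\<^sup>2 / 4 \<le> (state n j \<omega> - gminus (time_point n j)) * (state n (Suc j) \<omega> - gminus (time_point n (Suc j)))"
          unfolding zz[symmetric] using far[of j] far[of "Suc j"] j z(1) by (intro mult_mono) auto
        then have p2: "z\<^sup>2 / 4 \<le> (gminus (time_point n j) - state n j \<omega>) * (gminus (time_point n (Suc j)) - state n (Suc j) \<omega>)"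
          by (simp add: algebra_simps)
        have two: "\<bar>1 - A - B - 1\<bar> \<le> 2 * c" if "A \<le> c" "B \<le> c" "0 < A" "0 < B" for A B c :: real
          using that by linarith
        show "\<bar>br n j - 1\<bar> \<le> b n"
          unfolding br_def bridge_factor_def b_def diff_Suc_1
          by (rule two[OF expo[OF p1] expo[OF p2] exp_gt_zero exp_gt_zero])
      qed
      then show ?case by simp
    qed
    from Lim_null_comparison[OF this l] show ?thesis by (simp add: LIM_zero_iff)
  qed
  have ev': "eventually (\<lambda>n. \<forall>i\<le>n. \<bar>state n i \<omega> - X (time_point n i) \<omega>\<bar> < e) sequentially" if "0 < e" for e
    using ev[OF that] by eventually_elim auto
  have 3: "(\<lambda>n. exp (- trapezoid n (\<lambda>j. state n j \<omega>))) \<longlonglongrightarrow> exp (- (LINT s:{0..1}|lborel. V (X s \<omega>)))"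
    by (intro tendsto_exp tendsto_minus trapezoid_tendsto[OF X_continuous[OF w]] ev')
  have "(\<lambda>n. state n n \<omega>) \<longlonglongrightarrow> X 1 \<omega>"
  proof (rule LIMSEQ_I)
    fix e :: real assume "0 < e"
    from ev'[OF this] have "eventually (\<lambda>n. norm (state n n \<omega> - X 1 \<omega>) < e) sequentially"
      using eventually_gt_at_top[of 0]
    proof eventually_elim
      case (elim n)
      have "time_point n n = 1" using elim(2) by (simp add: time_point_def)
      then show ?case using elim(1) by (metis order_refl real_norm_def)
    qed
    then show "\<exists>N. \<forall>n\<ge>N. norm (state n n \<omega> - X 1 \<omega>) < e" by (simp add: eventually_sequentially)
  qed
  then have 4: "(\<lambda>n. phi (state n n \<omega>)) \<longlonglongrightarrow> phi (X 1 \<omega>)"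
    by (rule continuous_on_tendsto_compose[OF phi]) auto
  have "(\<lambda>n. complex_of_real (\<Prod>j<n. rt n j) * complex_of_real (\<Prod>j<n. br n j) * exp (- trapezoid n (\<lambda>j. state n j \<omega>)) * complex_of_real (phi (state n n \<omega>)))
    \<longlonglongrightarrow> complex_of_real 1 * complex_of_real 1 * exp (- (LINT s:{0..1}|lborel. V (X s \<omega>))) * complex_of_real (phi (X 1 \<omega>))"
    by (intro tendsto_mult tendsto_of_real 1 2 3 4)
  then have "(\<lambda>n. complex_of_real (\<Prod>j<n. rt n j) * complex_of_real (\<Prod>j<n. br n j) * exp (- trapezoid n (\<lambda>j. state n j \<omega>)) * complex_of_real (phi (state n n \<omega>)))
    \<longlonglongrightarrow> exp (- (LINT s:{0..1}|lborel. V (X s \<omega>))) * complex_of_real (phi (X 1 \<omega>))" by simp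
  then show ?thesis
  proof (rule Lim_transform_eventually)
    have "eventually (\<lambda>n. alive_upto n n \<omega>) sequentially" using ev[OF z(1)] by eventually_elim auto
    then show "eventually (\<lambda>n. complex_of_real (\<Prod>j<n. rt n j) * complex_of_real (\<Prod>j<n. br n j) * exp (- trapezoid n (\<lambda>j. state n j \<omega>)) * complex_of_real (phi (state n n \<omega>)) = weighted n \<omega>) sequentially"
    proof eventually_elim
      case (elim n)
      have "exp (- trapezoid n (\<lambda>j. state n j \<omega>)) = (\<Prod>j<n. potential_factor V n (state n j \<omega>) (state n (Suc j) \<omega>))"
        by (simp add: trapezoid_def potential_factor_def exp_sum sum_negf[symmetric])
      then show ?case using elim
        by (simp add: weighted_def step_factor_def rt_def br_def prod.distrib)
    qed
  qed
qed

text \<open>A chain surviving up to time 1 would be uniformly close to the diffusion, which by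
  continuity is outside the corridor by a definite amount at some grid time; so the chain has been
  killed and its weight is exactly 0.\<close>

lemma weighted_eventually_0:
  assumes reg: "regular \<omega>" and small: "rounding_small \<omega>"
    and t: "t \<in> {0..1}" "X t \<omega> < gminus t \<or> gplus t < X t \<omega>"
  shows "eventually (\<lambda>n. weighted n \<omega> = 0) sequentially"
proof -
  have xc: "continuous_on {0..1} (\<lambda>t. X t \<omega>)" using reg X_continuous by (auto simp: regular_def)
  define f where "f = (\<lambda>t. max (gminus t - X t \<omega>) (X t \<omega> - gplus t))"
  have fc: "continuous_on {0..1} f" unfolding f_def by (intro continuous_intros xc g_continuous)
  have ft: "0 < f t" using t(2) by (auto simp: f_def)
  obtain d where d: "0 < d" "\<And>s. s \<in> {0..1} \<Longrightarrow> dist s t < d \<Longrightarrow> dist (f s) (f t) < f t / 2"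
    using fc[unfolded continuous_on_iff, rule_format, OF t(1), of "f t / 2"] ft by auto
  have ft2: "0 < f t / 2" using ft by simp
  have "eventually (\<lambda>n. 1 / real n < d) sequentially"
    by (rule order_tendstoD(2)[OF lim_1_over_n[where 'a = real]]) (rule d(1))
  then show ?thesis using state_close[OF reg small ft2] eventually_gt_at_top[of 0]
  proof eventually_elim
    case (elim n)
    have "\<not> alive_upto n n \<omega>"
    proof
      assume al: "alive_upto n n \<omega>"
      obtain j where j: "j \<le> n" "\<bar>time_point n j - t\<bar> \<le> 1 / real n" using time_point_near[OF elim(3) t(1)] by blast
      have "dist (f (time_point n j)) (f t) < f t / 2"
        by (rule d(2)[OF time_point_in[OF j(1)]]) (use j(2) elim(1) in \<open>simp add: dist_real_def\<close>)
      then have A: "f t / 2 < f (time_point n j)" unfolding dist_real_def by linarith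
      have B: "\<bar>state n j \<omega> - X (time_point n j) \<omega>\<bar> < f t / 2"
        using elim(2) j(1) al by (simp add: alive_upto_def)
      have C: "gminus (time_point n j) < state n j \<omega>" "state n j \<omega> < gplus (time_point n j)"
        using al j(1) rgridD by (auto simp: alive_upto_def)
      have "f (time_point n j) = gminus (time_point n j) - X (time_point n j) \<omega> \<or> f (time_point n j) = X (time_point n j) \<omega> - gplus (time_point n j)"
        unfolding f_def max_def by simp
      then show False
      proof
        assume "f (time_point n j) = gminus (time_point n j) - X (time_point n j) \<omega>"
        then show False using A B C by linarith
      next
        assume "f (time_point n j) = X (time_point n j) \<omega> - gplus (time_point n j)"
        then show False using A B C by linarith
      qed
    qed
    then show ?case by (simp add: weighted_def)
  qed
qed

text \<open>\<open>touch_null\<close> for the upper boundary with u = 1 and the lower one with u =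
  -1. A path within the closed corridor is bounded by \<open>radius\<close>, as required
  there.\<close>

lemma AE_no_touch:
  "AE \<omega> in M. (\<forall>t\<in>{0..1}. gminus t < X t \<omega> \<and> X t \<omega> < gplus t) \<or> (\<exists>t\<in>{0..1}. X t \<omega> < gminus t \<or> gplus t < X t \<omega>)"
proof -
  have "AE \<omega> in M. \<not> ((\<forall>t\<in>{0..1}. \<bar>X t \<omega>\<bar> \<le> radius \<and> 1 * (X t \<omega> - gplus t) \<le> 0) \<and> (\<exists>t\<in>{0..1}. X t \<omega> = gplus t))"
    by (rule touch_null[OF g_continuous(2) _ _ radius(1)]) (use g_start in auto)
  moreover have "AE \<omega> in M. \<not> ((\<forall>t\<in>{0..1}. \<bar>X t \<omega>\<bar> \<le> radius \<and> (-1) * (X t \<omega> - gminus t) \<le> 0) \<and> (\<exists>t\<in>{0..1}. X t \<omega> = gminus t))"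
    by (rule touch_null[OF g_continuous(1) _ _ radius(1)]) (use g_start in auto)
  ultimately show ?thesis
  proof eventually_elim
    case (elim \<omega>)
    show ?case
    proof (rule ccontr)
      assume n: "\<not> ?case"
      then have c: "gminus t \<le> X t \<omega>" "X t \<omega> \<le> gplus t" if "t \<in> {0..1}" for t
        using that by (auto simp: not_less)
      have "\<bar>X t \<omega>\<bar> \<le> radius" if "t \<in> {0..1}" for t using c[OF that] radius(2,3)[OF that] by linarith
      moreover obtain t where "t \<in> {0..1}" "\<not> (gminus t < X t \<omega> \<and> X t \<omega> < gplus t)" using n by blast
      moreover have "X t \<omega> = gminus t \<or> X t \<omega> = gplus t" using c[OF \<open>t \<in> {0..1}\<close>] calculation(3) by linarith
      ultimately show False using elim c by fastforce
    qed
  qed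
qed

section \<open>Measurability of the limit, domination and conclusion\<close>

text \<open>By compactness a path strictly inside keeps some margin 1/(m + 1), which can be tested
  at countably many grid times; conversely continuity carries a fixed margin at all grid times to
  positive distance at every t.\<close>

lemma inside_measurable: "{\<omega> \<in> space M. \<forall>t\<in>{0..1}. gminus t < X t \<omega> \<and> X t \<omega> < gplus t} \<in> events"
proof -
  let ?P = "\<lambda>m n j \<omega>. gminus (time_point n j) + 1 / real (Suc m) \<le> X (time_point n j) \<omega> \<and> X (time_point n j) \<omega> \<le> gplus (time_point n j) - 1 / real (Suc m)"
  have iff: "(\<forall>t\<in>{0..1}. gminus t < X t \<omega> \<and> X t \<omega> < gplus t) \<longleftrightarrow> (\<exists>m. \<forall>n. \<forall>j\<in>{..n}. ?P m n j \<omega>)" if w: "\<omega> \<in> space M" for \<omega>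
  proof
    assume "\<forall>t\<in>{0..1}. gminus t < X t \<omega> \<and> X t \<omega> < gplus t"
    from corridor_gap[OF w this] obtain z where z: "0 < z" "\<forall>t\<in>{0..1}. gminus t + z \<le> X t \<omega> \<and> X t \<omega> \<le> gplus t - z" by blast
    obtain m where m: "1 / real (Suc m) < z" using nat_approx_posE[OF z(1)] by blast
    have "?P m n j \<omega>" if "j \<in> {..n}" for n j
    proof -
      have "j \<le> n" using that by simp
      from z(2)[rule_format, OF time_point_in[OF this]] m show ?thesis by linarith
    qed
    then show "\<exists>m. \<forall>n. \<forall>j\<in>{..n}. ?P m n j \<omega>" by blast
  next
    assume "\<exists>m. \<forall>n. \<forall>j\<in>{..n}. ?P m n j \<omega>"
    then obtain m where m: "\<And>n j. j \<le> n \<Longrightarrow> ?P m n j \<omega>" by auto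
    show "\<forall>t\<in>{0..1}. gminus t < X t \<omega> \<and> X t \<omega> < gplus t"
    proof
      fix t :: real assume t: "t \<in> {0..1}"
      define f where "f = (\<lambda>t. min (X t \<omega> - gminus t) (gplus t - X t \<omega>))"
      have fc: "continuous_on {0..1} f" unfolding f_def by (intro continuous_intros X_continuous[OF w] g_continuous)
      obtain d where d: "0 < d" "\<And>s. s \<in> {0..1} \<Longrightarrow> dist s t < d \<Longrightarrow> dist (f s) (f t) < 1 / real (Suc m)"
        using fc[unfolded continuous_on_iff, rule_format, OF t, of "1 / real (Suc m)"] by auto
      obtain n where n: "1 / real (Suc n) < d" using nat_approx_posE[OF d(1)] by blast
      obtain j where j: "j \<le> Suc n" "\<bar>time_point (Suc n) j - t\<bar> \<le> 1 / real (Suc n)" using time_point_near[of "Suc n" t] t by auto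
      have "dist (f (time_point (Suc n) j)) (f t) < 1 / real (Suc m)"
        by (rule d(2)[OF time_point_in[OF j(1)]]) (use j(2) n in \<open>simp only: dist_real_def\<close>)
      moreover have "1 / real (Suc m) \<le> f (time_point (Suc n) j)" using m[OF j(1)] unfolding f_def by linarith
      ultimately have "0 < f t" unfolding dist_real_def by linarith
      then show "gminus t < X t \<omega> \<and> X t \<omega> < gplus t" by (simp add: f_def)
    qed
  qed
  have "{\<omega> \<in> space M. \<exists>m. \<forall>n. \<forall>j\<in>{..n}. ?P m n j \<omega>} \<in> events"
  proof (intro sets.sets_Collect_countable_Ex sets.sets_Collect_countable_All sets.sets_Collect_finite_All)
    fix m n j assume "j \<in> {..n::nat}"
    then have [measurable]: "X (time_point n j) \<in> borel_measurable M" by (intro X_measurable time_point_in) simp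
    show "{\<omega> \<in> space M. ?P m n j \<omega>} \<in> events" by measurable
  qed simp
  also have "{\<omega> \<in> space M. \<exists>m. \<forall>n. \<forall>j\<in>{..n}. ?P m n j \<omega>} = {\<omega> \<in> space M. \<forall>t\<in>{0..1}. gminus t < X t \<omega> \<and> X t \<omega> < gplus t}"
    using iff by auto
  finally show ?thesis .
qed

text \<open>A pointwise limit of trapezoidal sums, each depending on finitely many values of
  X.\<close>

lemma potential_integral_measurable: "(\<lambda>\<omega>. LINT s:{0..1}|lborel. V (X s \<omega>)) \<in> borel_measurable M"
proof (rule borel_measurable_LIMSEQ_metric)
  fix \<omega> assume w: "\<omega> \<in> space M"
  show "(\<lambda>n. trapezoid n (\<lambda>j. X (time_point n j) \<omega>)) \<longlonglongrightarrow> (LINT s:{0..1}|lborel. V (X s \<omega>))"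
    by (rule trapezoid_tendsto[OF X_continuous[OF w]]) simp
next
  fix n
  have "(\<lambda>\<omega>. V (X (time_point n j) \<omega>)) \<in> borel_measurable M" if "j \<le> n" for j
    using measurable_compose[OF X_measurable[OF time_point_in[OF that]] borel_measurable_continuous_onI[OF V]] .
  then show "(\<lambda>\<omega>. trapezoid n (\<lambda>j. X (time_point n j) \<omega>)) \<in> borel_measurable M"
    unfolding trapezoid_def by (intro borel_measurable_sum borel_measurable_times borel_measurable_add borel_measurable_const) auto
qed

text \<open>A surviving chain stays in [-radius, radius], where V and phi are bounded although
  neither need be so globally. All mass ratios together contribute at most exp(n eta) <= exp(1),
  each bridge factor at most 1, and all potential factors at most exp(v).\<close>

lemma weighted_bound:
  "\<exists>B. \<forall>n \<omega>. large n \<longrightarrow> real n * eta n \<le> 1 \<longrightarrow> norm (weighted n \<omega>) \<le> B"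
proof -
  have "bounded (V ` {-radius..radius})" "bounded (phi ` {-radius..radius})"
    by (intro compact_imp_bounded compact_continuous_image continuous_on_subset[OF V] continuous_on_subset[OF phi]; simp)+
  then obtain v p where "\<forall>x\<in>{-radius..radius}. norm (V x) \<le> v" and "\<forall>x\<in>{-radius..radius}. \<bar>phi x\<bar> \<le> p"
    unfolding bounded_iff by auto
  then have v: "norm (V x) \<le> v" and p: "\<bar>phi x\<bar> \<le> p" if "x \<in> {-radius..radius}" for x using that by blast+
  have v0: "0 \<le> v" using v[of 0] radius(1) by (auto intro: order.trans[OF norm_ge_zero])
  have p0: "0 \<le> p" using p[of 0] radius(1) by auto
  have "norm (weighted n \<omega>) \<le> exp (1 + v) * p" if n: "large n" "real n * eta n \<le> 1" for n \<omega>
  proof (cases "alive_upto n n \<omega>")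
    case True
    have n0: "0 < n" using n by (simp add: large_def)
    then have D: "0 < time_step n" "real n * time_step n = 1" by (auto simp: time_step_def)
    have mem: "state n j \<omega> \<in> rgrid n j" if "j \<le> n" for j using True that by (simp add: alive_upto_def)
    have rad: "state n j \<omega> \<in> {-radius..radius}" if "j \<le> n" for j
      using rgrid_abs_le[OF mem[OF that] that] by auto
    have "norm (step_factor n j (state n j \<omega>) (state n (Suc j) \<omega>)) \<le> exp (eta n + time_step n * v)" if j: "j < n" for j
    proof -
      let ?x = "state n j \<omega>" and ?y = "state n (Suc j) \<omega>"
      have "\<bar>mass_ratio n j ?x ?y - 1\<bar> \<le> eta n"
        by (rule mass_ratio_bound(1)[OF n(1) j mem mem]) (use j in auto)
      then have r: "\<bar>mass_ratio n j ?x ?y\<bar> \<le> exp (eta n)" using exp_ge_add_one_self[of "eta n"] by linarith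
      \<comment> \<open>Consecutive states lie on the same side of each boundary, so both
        exponentials are in (0, 1] and 1 - A - B is in [-1, 1].\<close>
      have b: "\<bar>bridge_factor gminus gplus n (Suc j) ?x ?y\<bar> \<le> 1"
      proof -
        have gx: "gminus (time_point n j) < ?x" "?x < gplus (time_point n j)" using rgridD[OF mem[of j]] j by auto
        have gy: "gminus (time_point n (Suc j)) < ?y" "?y < gplus (time_point n (Suc j))" using rgridD[OF mem[of "Suc j"]] j by auto
        have "0 \<le> (2 / time_step n) * ((gplus (time_point n j) - ?x) * (gplus (time_point n (Suc j)) - ?y))"
          using gx gy D by (intro mult_nonneg_nonneg) auto
        moreover have "0 \<le> (2 / time_step n) * ((gminus (time_point n j) - ?x) * (gminus (time_point n (Suc j)) - ?y))"
          using gx gy D by (intro mult_nonneg_nonneg mult_nonpos_nonpos) auto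
        ultimately have "exp (- (2 / time_step n) * (gplus (time_point n j) - ?x) * (gplus (time_point n (Suc j)) - ?y)) \<le> 1"
          "exp (- (2 / time_step n) * (gminus (time_point n j) - ?x) * (gminus (time_point n (Suc j)) - ?y)) \<le> 1"
          unfolding exp_le_one_iff by (simp_all only: mult.assoc mult_minus_left neg_le_0_iff_le)
        moreover have "0 < exp (- (2 / time_step n) * (gplus (time_point n j) - ?x) * (gplus (time_point n (Suc j)) - ?y))"
          "0 < exp (- (2 / time_step n) * (gminus (time_point n j) - ?x) * (gminus (time_point n (Suc j)) - ?y))" by simp_all
        ultimately show ?thesis unfolding bridge_factor_def diff_Suc_1 abs_le_iff by linarith
      qed
      have q: "norm (potential_factor V n ?x ?y) \<le> exp (time_step n * v)"
      proof -
        have "norm (potential_factor V n ?x ?y) \<le> exp (norm (- (complex_of_real (time_step n) / 2) * (V ?x + V ?y)))"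
          unfolding potential_factor_def by (rule norm_exp)
        also have "norm (- (complex_of_real (time_step n) / 2) * (V ?x + V ?y)) \<le> time_step n / 2 * (v + v)"
          unfolding norm_mult using D v[OF rad[of j]] v[OF rad[of "Suc j"]] j norm_triangle_ineq[of "V ?x" "V ?y"]
          by (intro mult_mono) (auto simp: norm_divide)
        finally show ?thesis by simp
      qed
      have "norm (step_factor n j ?x ?y) = \<bar>mass_ratio n j ?x ?y\<bar> * \<bar>bridge_factor gminus gplus n (Suc j) ?x ?y\<bar> * norm (potential_factor V n ?x ?y)"
        by (simp add: step_factor_def norm_mult)
      also have "\<dots> \<le> exp (eta n) * 1 * exp (time_step n * v)"
        using r b q by (intro mult_mono) auto
      finally show ?thesis by (simp add: exp_add)
    qed
    then have "norm (\<Prod>j<n. step_factor n j (state n j \<omega>) (state n (Suc j) \<omega>)) \<le> (\<Prod>j<n. exp (eta n + time_step n * v))"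
      unfolding prod_norm[symmetric] by (intro prod_mono) auto
    also have "\<dots> = exp (real n * (eta n + time_step n * v))" by (simp add: exp_of_nat_mult)
    also have "\<dots> \<le> exp (1 + v)"
    proof -
      have "real n * (eta n + time_step n * v) = real n * eta n + (real n * time_step n) * v" by (simp add: algebra_simps)
      then show ?thesis using n(2) D by simp
    qed
    finally have "norm (\<Prod>j<n. step_factor n j (state n j \<omega>) (state n (Suc j) \<omega>)) \<le> exp (1 + v)" .
    then show ?thesis
      using True p[OF rad[of n]] by (simp add: weighted_def norm_mult mult_mono)
  next
    case False then show ?thesis using p0 by (simp add: weighted_def)
  qed
  then show ?thesis by blast
qed

lemma matrix_approximation_tendsto:
  "(\<lambda>n. matrix_approximation x0 mu gminus gplus V phi \<delta> \<gamma> n) \<longlonglongrightarrow> corridor_functional M X gminus gplus V phi"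
proof -
  obtain B where B: "\<And>n \<omega>. large n \<Longrightarrow> real n * eta n \<le> 1 \<Longrightarrow> norm (weighted n \<omega>) \<le> B"
    using weighted_bound by blast
  define ok where "ok = (\<lambda>n. large n \<and> real n * eta n \<le> 1)"
  have "eventually (\<lambda>n. real n * eta n < 1) sequentially" by (rule order_tendstoD(2)[OF eta_limits(1)]) simp
  then have ok: "eventually ok sequentially" using eventually_large by eventually_elim (simp add: ok_def)
  define F where "F = (\<lambda>n \<omega>. if ok n then weighted n \<omega> else 0)"
  let ?A = "{\<omega> \<in> space M. \<forall>t\<in>{0..1}. gminus t < X t \<omega> \<and> X t \<omega> < gplus t}"
  define f where "f = (\<lambda>\<omega>. indicator ?A \<omega> *\<^sub>R (exp (- (LINT s:{0..1}|lborel. V (X s \<omega>))) * complex_of_real (phi (X 1 \<omega>))))"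
  note [measurable] = inside_measurable potential_integral_measurable
  have [measurable]: "(\<lambda>\<omega>. phi (X 1 \<omega>)) \<in> borel_measurable M"
    using measurable_compose[OF X_measurable borel_measurable_continuous_onI[OF phi]] by simp
  have "(\<lambda>n. LINT \<omega>|M. F n \<omega>) \<longlonglongrightarrow> (LINT \<omega>|M. f \<omega>)"
  proof (rule integral_dominated_convergence[where w = "\<lambda>_. max B 0"])
    have "(\<lambda>\<omega>. exp (- (LINT s:{0..1}|lborel. V (X s \<omega>))) * complex_of_real (phi (X 1 \<omega>))) \<in> borel_measurable M"
      by (intro borel_measurable_times borel_measurable_exp borel_measurable_uminus borel_measurable_of_real potential_integral_measurable) measurable
    then show "f \<in> borel_measurable M"
      unfolding f_def using inside_measurable by (intro borel_measurable_scaleR borel_measurable_indicator) auto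
    show "F n \<in> borel_measurable M" for n
      unfolding F_def using matrix_approximation_eq(2)[of n] by (cases "ok n") (auto simp: ok_def)
    show "integrable M (\<lambda>_. max B 0)" by simp
    show "AE \<omega> in M. norm (F n \<omega>) \<le> max B 0" for n
      using B[of n] by (intro AE_I2) (auto simp: F_def ok_def max.coboundedI1)
    show "AE \<omega> in M. (\<lambda>n. F n \<omega>) \<longlonglongrightarrow> f \<omega>"
      using AE_regular AE_total_rounding AE_no_touch
    proof eventually_elim
      case (elim \<omega>)
      have small: "rounding_small \<omega>" using elim(2) by (simp add: rounding_small_def)
      have w: "\<omega> \<in> space M" using elim(1) by (simp add: regular_def)
      have "(\<lambda>n. weighted n \<omega>) \<longlonglongrightarrow> f \<omega>"
      proof (cases "\<omega> \<in> ?A")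
        case True
        then show ?thesis using weighted_tendsto_inside[OF elim(1) small] by (simp add: f_def)
      next
        case False
        then obtain t where "t \<in> {0..1}" "X t \<omega> < gminus t \<or> gplus t < X t \<omega>" using elim(3) w by blast
        from weighted_eventually_0[OF elim(1) small this]
        have "(\<lambda>n. weighted n \<omega>) \<longlonglongrightarrow> 0" by (rule tendsto_eventually)
        then show ?thesis using False by (simp add: f_def)
      qed
      then show ?case
        by (rule Lim_transform_eventually) (use ok in \<open>auto elim!: eventually_mono simp: F_def\<close>)
    qed
  qed
  then have "(\<lambda>n. LINT \<omega>|M. F n \<omega>) \<longlonglongrightarrow> corridor_functional M X gminus gplus V phi"
    by (simp add: corridor_functional_def set_lebesgue_integral_def f_def)
  then show ?thesis
  proof (rule Lim_transform_eventually)
    show "eventually (\<lambda>n. (LINT \<omega>|M. F n \<omega>) = matrix_approximation x0 mu gminus gplus V phi \<delta> \<gamma> n) sequentially"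
      using ok by eventually_elim (simp add: F_def ok_def matrix_approximation_eq(1))
  qed
qed

end

theorem theorem1:
  fixes M :: "'a measure" and W X :: "real \<Rightarrow> 'a \<Rightarrow> real"
    and x0 \<delta> \<gamma> :: real and mu :: "real \<Rightarrow> real \<Rightarrow> real"
    and gminus gplus :: "real \<Rightarrow> real" and V :: "real \<Rightarrow> complex" and phi :: "real \<Rightarrow> real"
  assumes W: "standard_brownian_motion_on M {0..1} W"
    and X_measurable: "\<And>t. t \<in> {0..1} \<Longrightarrow> X t \<in> borel_measurable M"
    and X_continuous: "\<And>\<omega>. \<omega> \<in> space M \<Longrightarrow> continuous_on {0..1} (\<lambda>t. X t \<omega>)"
    and X_eq: "AE \<omega> in M. \<forall>t\<in>{0..1}.
      X t \<omega> = x0 + (LINT s:{0..t}|lborel. mu s (X s \<omega>)) + W t \<omega>"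
    and mu_t: "\<And>x. C1_on_unit_interval (\<lambda>t. mu t x)"
    and mu_x: "\<And>t. t \<in> {0..1} \<Longrightarrow> C2_on_real (mu t)"
    and mu_bound: "\<And>r. r > 0 \<Longrightarrow> \<exists>K. \<forall>t\<in>{0..1}. \<forall>x. \<bar>x\<bar> \<le> r \<longrightarrow>
      \<bar>mu t x\<bar> + \<bar>partial_t mu t x\<bar> + \<bar>partial_x mu t x\<bar> + \<bar>partial_xx mu t x\<bar> \<le> K"
    and g_continuous: "continuous_on {0..1} gminus" "continuous_on {0..1} gplus"
    and g_start: "gminus 0 < x0" "x0 < gplus 0"
    and g_gap: "(INF t\<in>{0..1}. gplus t - gminus t) > 0"
    and V: "continuous_on UNIV V"
    and phi: "continuous_on UNIV phi"
    and \<delta>: "0 < \<delta>" "\<delta> \<le> 1/2"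
    and \<gamma>: "\<gamma> > 0"
  shows "(\<lambda>n. matrix_approximation x0 mu gminus gplus V phi \<delta> \<gamma> n)
           \<longlonglongrightarrow> corridor_functional M X gminus gplus V phi"
proof -
  interpret W: standard_brownian_motion_on M "{0..1}" W by (rule W)
  interpret corridor mu M W X x0 gminus gplus V phi \<delta> \<gamma>
    by unfold_locales (fact assms)+
  show ?thesis by (rule matrix_approximation_tendsto)
qed

end
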